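(* For any $f\in H^2(\mathbb B)$ there exists an element $a\in\mathbb B$ such that $$|\langle f,e_a\rangle|=\max_{b\in\mathbb B}|\langle f,e_b\rangle|.$$
   Context: $\mathbb H$ is the skew field of quaternions, $\mathbb S=\{I\in\mathbb H: I^2=-1\}$, $\mathbb C_I=\{x+yI:x,y\in\mathbb R\}$, and $\mathbb B$ is the open Euclidean unit ball of $\mathbb H$. A function $f:\mathbb B\to\mathbb H$ is a slice function if $f(x+yJ)=\frac12\big(f(x+yI)+f(x-yI)\big)+\frac{JI}{2}\big(f(x-yI)-f(x+yI)\big)$ for all $x,y\in\mathbb R$, $I,J\in\mathbb S$ with the points in $\mathbb B$. It is slice regular if it is a slice function and, for each $I\in\mathbb S$, the restriction $f_I$ of $f$ to $\mathbb B\cap\mathbb C_I$ has continuous partial derivatives and satisfies $\frac12(\partial_x+I\partial_y)f_I(x+yI)=0$. A slice regular function on $\mathbb B$ has a power series expansion $f(q)=\sum_{n\ge0}q^na_n$ with $a_n\in\mathbb H$. The $*$-product of $f=\sum q^na_n$ and $g=\sum q^nb_n$ is $(f*g)(q)=\sum_{n\ge0}q^n\sum_{k=0}^na_kb_{n-k}$. With $f^c(q)=\sum q^n\bar a_n$ and $f^s=f*f^c$, the regular reciprocal is $f^{-*}=\frac1{f^s}f^c$ (the inverse of $f$ for $*$, where $f^s\neq0$). The slice Hardy space $H^2(\mathbb B)$ consists of the slice regular functions $f$ on $\mathbb B$ with $\sup_{0\le r<1}\frac1{2\pi}\int_0^{2\pi}|f(re^{It})|^2dt<\infty$ for some (equivalently,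 every) $I\in\mathbb S$. Such $f$ is identified with its radial limit on $\partial\mathbb B$, and $H^2(\mathbb B)$ is a right quaternionic Hilbert space (right $\mathbb H$-linear in the first variable) with $$\langle f,g\rangle=\frac1{4\pi^2}\int_{\partial\mathbb B}\frac{1}{|\mathrm{Im}(q)|^2}\,\overline{g(q)}f(q)\,d\sigma(q),\qquad \|f\|^2=\langle f,f\rangle,$$ $d\sigma$ being the surface measure on $\partial\mathbb B$. For $a\in\mathbb B$, the slice normalized Szegő kernel is $e_a(q)=\sqrt{1-|a|^2}\,(1-q\bar a)^{-*}$. *)

theory Defs
  imports "HOL-Analysis.Analysis"
begin

section \<open>Quaternions\<close>

datatype quat = Quat (qRe: real) (qI: real) (qJ: real) (qK: real)

lemma quat_eq_iff: "p = q \<longleftrightarrow> qRe p = qRe q \<and> qI p = qI q \<and> qJ p = qJ q \<and> qK p = qK q"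
  by (cases p; cases q) simp

instantiation quat :: real_vector
begin

definition "0 = Quat 0 0 0 0"
definition "p + q = Quat (qRe p + qRe q) (qI p + qI q) (qJ p + qJ q) (qK p + qK q)"
definition "p - q = Quat (qRe p - qRe q) (qI p - qI q) (qJ p - qJ q) (qK p - qK q)"
definition "- q = Quat (- qRe q) (- qI q) (- qJ q) (- qK q)"
definition "scaleR r q = Quat (r * qRe q) (r * qI q) (r * qJ q) (r * qK q)"

lemma quat_vector_sel [simp]:
  "qRe 0 = 0" "qI 0 = 0" "qJ 0 = 0" "qK 0 = 0"
  "qRe (p + q) = qRe p + qRe q" "qI (p + q) = qI p + qI q"
  "qJ (p + q) = qJ p + qJ q" "qK (p + q) = qK p + qK q"
  "qRe (p - q) = qRe p - qRe q" "qI (p - q) = qI p - qI q"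
  "qJ (p - q) = qJ p - qJ q" "qK (p - q) = qK p - qK q"
  "qRe (- q) = - qRe q" "qI (- q) = - qI q" "qJ (- q) = - qJ q" "qK (- q) = - qK q"
  "qRe (r *\<^sub>R q) = r * qRe q" "qI (r *\<^sub>R q) = r * qI q"
  "qJ (r *\<^sub>R q) = r * qJ q" "qK (r *\<^sub>R q) = r * qK q"
  by (simp_all add: zero_quat_def plus_quat_def minus_quat_def uminus_quat_def scaleR_quat_def)

instance
  by standard (simp_all add: quat_eq_iff algebra_simps)

end

instantiation quat :: real_inner
begin

definition "inner p q = qRe p * qRe q + qI p * qI q + qJ p * qJ q + qK p * qK q"
definition "norm q = sqrt (inner q (q :: quat))"
definition "sgn q = inverse (norm (q :: quat)) *\<^sub>R q"
definition "dist p q = norm (p - q :: quat)"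
definition
  "(uniformity :: (quat \<times> quat) filter) = (INF e\<in>{0<..}. principal {(x, y). dist x y < e})"
definition
  "open (U :: quat set) \<longleftrightarrow> (\<forall>x\<in>U. eventually (\<lambda>(x', y). x' = x \<longrightarrow> y \<in> U) uniformity)"

instance
proof
  fix x y z :: quat and r :: real and U :: "quat set"
  show "inner x y = inner y x"
    by (simp add: inner_quat_def algebra_simps)
  show "inner (x + y) z = inner x z + inner y z"
    by (simp add: inner_quat_def algebra_simps)
  show "inner (r *\<^sub>R x) y = r * inner x y"
    by (simp add: inner_quat_def algebra_simps)
  show "0 \<le> inner x x"
    by (simp add: inner_quat_def)
  show "inner x x = 0 \<longleftrightarrow> x = 0"
    by (simp add: inner_quat_def quat_eq_iff add_nonneg_eq_0_iff conj_assoc)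
qed (rule norm_quat_def sgn_quat_def dist_quat_def uniformity_quat_def open_quat_def)+

end

instantiation quat :: real_normed_div_algebra
begin

definition "1 = Quat 1 0 0 0"
definition "p * q = Quat
  (qRe p * qRe q - qI p * qI q - qJ p * qJ q - qK p * qK q)
  (qRe p * qI q + qI p * qRe q + qJ p * qK q - qK p * qJ q)
  (qRe p * qJ q - qI p * qK q + qJ p * qRe q + qK p * qI q)
  (qRe p * qK q + qI p * qJ q - qJ p * qI q + qK p * qRe q)"
definition "inverse q = inverse (inner q q) *\<^sub>R Quat (qRe q) (- qI q) (- qJ q) (- qK (q :: quat))"
definition "p div q = p * inverse (q :: quat)"

lemma quat_mult_sel [simp]:
  "qRe 1 = 1" "qI 1 = 0" "qJ 1 = 0" "qK 1 = 0"
  "qRe (p * q) = qRe p * qRe q - qI p * qI q - qJ p * qJ q - qK p * qK q"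
  "qI (p * q) = qRe p * qI q + qI p * qRe q + qJ p * qK q - qK p * qJ q"
  "qJ (p * q) = qRe p * qJ q - qI p * qK q + qJ p * qRe q + qK p * qI q"
  "qK (p * q) = qRe p * qK q + qI p * qJ q - qJ p * qI q + qK p * qRe q"
  by (simp_all add: one_quat_def times_quat_def)

instance
proof
  fix x y z :: quat and r :: real
  show "x * y * z = x * (y * z)"
    by (simp add: quat_eq_iff algebra_simps)
  show "(x + y) * z = x * z + y * z" "x * (y + z) = x * y + x * z"
    by (simp_all add: quat_eq_iff algebra_simps)
  show "1 * x = x" "x * 1 = x" "(0 :: quat) \<noteq> 1"
    by (simp_all add: quat_eq_iff)
  show "r *\<^sub>R x * y = r *\<^sub>R (x * y)" "x * r *\<^sub>R y = r *\<^sub>R (x * y)"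
    by (simp_all add: quat_eq_iff algebra_simps)
  show "inverse (0 :: quat) = 0"
    by (simp add: inverse_quat_def)
  show "x div y = x * inverse y"
    by (simp add: divide_quat_def)
  have *: "x * (s *\<^sub>R Quat (qRe x) (- qI x) (- qJ x) (- qK x)) = (s * inner x x) *\<^sub>R 1"
    "(s *\<^sub>R Quat (qRe x) (- qI x) (- qJ x) (- qK x)) * x = (s * inner x x) *\<^sub>R 1" for s
    by (simp_all add: quat_eq_iff inner_quat_def algebra_simps)
  show "x \<noteq> 0 \<Longrightarrow> inverse x * x = 1" "x \<noteq> 0 \<Longrightarrow> x * inverse x = 1"
    unfolding inverse_quat_def * by simp_all
  have "inner (x * y) (x * y) = inner x x * inner y y"
    unfolding inner_quat_def quat_mult_sel by algebra
  then show "norm (x * y) = norm x * norm y"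
    by (simp add: norm_quat_def real_sqrt_mult)
qed

end

instantiation quat :: euclidean_space
begin

definition "Basis = {Quat 1 0 0 0, Quat 0 1 0 0, Quat 0 0 1 0, Quat 0 0 0 1}"

instance
proof
  fix x u v :: quat
  show "finite (Basis :: quat set)" "(Basis :: quat set) \<noteq> {}"
    by (simp_all add: Basis_quat_def)
  show "u \<in> Basis \<Longrightarrow> v \<in> Basis \<Longrightarrow> inner u v = (if u = v then 1 else 0)"
    unfolding Basis_quat_def by (elim insertE emptyE) (simp_all add: inner_quat_def)
  show "(\<forall>u\<in>Basis. inner x u = 0) \<longleftrightarrow> x = 0"
    by (simp add: Basis_quat_def inner_quat_def quat_eq_iff[of x])
qed

end

definition qcnj :: "quat \<Rightarrow> quat" where
  "qcnj q = Quat (qRe q) (- qI q) (- qJ q) (- qK q)"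

definition qIm :: "quat \<Rightarrow> quat" where
  "qIm q = Quat 0 (qI q) (qJ q) (qK q)"

definition imag_units :: "quat set" where
  "imag_units = {I. I\<^sup>2 = -1}"

abbreviation unit_ball :: "quat set" where
  "unit_ball \<equiv> ball 0 1"


section \<open>Slice regular functions\<close>

text \<open>
  Functions on the ball are represented by total functions on the quaternions; only
  the values on the open unit ball are ever used.
\<close>

definition slice_pt :: "quat \<Rightarrow> real \<Rightarrow> real \<Rightarrow> quat" where
  "slice_pt I x y = of_real x + of_real y * I"

definition slice_function :: "(quat \<Rightarrow> quat) \<Rightarrow> bool" where
  "slice_function f \<longleftrightarrow>
    (\<forall>x y. \<forall>I\<in>imag_units. \<forall>J\<in>imag_units.
      slice_pt J x y \<in> unit_ball \<and> slice_pt I x y \<in> unit_ball \<and> slice_pt I x (- y) \<in> unit_ball \<longrightarrow>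
      f (slice_pt J x y) =
        1 / 2 * (f (slice_pt I x y) + f (slice_pt I x (- y)))
        + J * I / 2 * (f (slice_pt I x (- y)) - f (slice_pt I x y)))"

definition slice_regular :: "(quat \<Rightarrow> quat) \<Rightarrow> bool" where
  "slice_regular f \<longleftrightarrow> slice_function f \<and>
    (\<forall>I\<in>imag_units. \<exists>fx fy.
      continuous_on {(x, y). slice_pt I x y \<in> unit_ball} (\<lambda>(x, y). fx x y) \<and>
      continuous_on {(x, y). slice_pt I x y \<in> unit_ball} (\<lambda>(x, y). fy x y) \<and>
      (\<forall>x y. slice_pt I x y \<in> unit_ball \<longrightarrow>
        ((\<lambda>s. f (slice_pt I s y)) has_vector_derivative fx x y) (at x) \<and>
        ((\<lambda>s. f (slice_pt I x s)) has_vector_derivative fy x y) (at y) \<and>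
        1 / 2 * (fx x y + I * fy x y) = 0))"


section \<open>Regular product and reciprocal\<close>

text \<open>Coefficients of the (unique) power series expansion on the unit ball.\<close>

definition qcoeff :: "(quat \<Rightarrow> quat) \<Rightarrow> nat \<Rightarrow> quat" where
  "qcoeff f = (THE a. \<forall>q\<in>unit_ball. (\<lambda>n. q ^ n * a n) sums f q)"

definition star_prod :: "(quat \<Rightarrow> quat) \<Rightarrow> (quat \<Rightarrow> quat) \<Rightarrow> quat \<Rightarrow> quat" where
  "star_prod f g q = (\<Sum>n. q ^ n * (\<Sum>k=0..n. qcoeff f k * qcoeff g (n - k)))"

definition regular_conj :: "(quat \<Rightarrow> quat) \<Rightarrow> quat \<Rightarrow> quat" where
  "regular_conj f q = (\<Sum>n. q ^ n * qcnj (qcoeff f n))"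

definition symmetrization :: "(quat \<Rightarrow> quat) \<Rightarrow> quat \<Rightarrow> quat" where
  "symmetrization f = star_prod f (regular_conj f)"

definition regular_reciprocal :: "(quat \<Rightarrow> quat) \<Rightarrow> quat \<Rightarrow> quat" where
  "regular_reciprocal f q = 1 / symmetrization f q * regular_conj f q"


section \<open>The slice Hardy space\<close>

definition slice_hardy :: "(quat \<Rightarrow> quat) set" where
  "slice_hardy = {f. slice_regular f \<and>
    (\<exists>I\<in>imag_units.
      bdd_above ((\<lambda>r. 1 / (2 * pi) *
        integral {0..2 * pi} (\<lambda>t. (norm (f (of_real r * exp (I * of_real t))))\<^sup>2)) ` {0..<1}))}"

text \<open>
  Surface measure on the unit sphere, as a Borel measure on the whole space concentrated on the
  sphere: by integration in polar coordinates, the area of \<open>A\<close> is the dimension times the volume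
  of the cone of all \<open>x\<close> in the unit ball with \<open>x / norm x \<in> A\<close>
  (and \<open>sgn x = x / norm x\<close> for \<open>x \<noteq> 0\<close>).
\<close>

definition sphere_measure :: "'a::euclidean_space measure" where
  "sphere_measure =
    scale_measure (of_nat DIM('a)) (distr (restrict_space lborel (ball 0 1)) borel sgn)"

text \<open>
  At boundary points where the limit fails to exist (a null set for functions in the Hardy space)
  \<^const>\<open>Lim\<close> returns a fixed unspecified value.
\<close>

definition radial_limit :: "(quat \<Rightarrow> quat) \<Rightarrow> quat \<Rightarrow> quat" where
  "radial_limit f q = Lim (at_left 1) (\<lambda>r. f (of_real r * q))"

definition hardy_inner :: "(quat \<Rightarrow> quat) \<Rightarrow> (quat \<Rightarrow> quat) \<Rightarrow> quat" where
  "hardy_inner f g = (1 / (4 * pi\<^sup>2)) *\<^sub>R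
    (LINT q:sphere 0 1|sphere_measure.
      (1 / (norm (qIm q))\<^sup>2) *\<^sub>R (qcnj (radial_limit g q) * radial_limit f q))"

definition szego_kernel :: "quat \<Rightarrow> quat \<Rightarrow> quat" where
  "szego_kernel a q = sqrt (1 - (norm a)\<^sup>2) *\<^sub>R regular_reciprocal (\<lambda>p. 1 - p * qcnj a) q"

end

theory Submission
  imports Defs "HOL-Complex_Analysis.Cauchy_Integral_Formula"
begin

text \<open>
  If \<open>f(q) = \<Sum> q\<^sup>n a\<^sub>n\<close> lies in the Hardy space then \<open>\<Sum> |a\<^sub>n|\<^sup>2 < \<infinity>\<close>, and the normalized kernel
  \<open>e\<^sub>b(q) = sqrt (1 - |b|\<^sup>2) \<Sum> q\<^sup>n b'\<^sup>n\<close> (with \<open>b'\<close> the conjugate of \<open>b\<close>) reproduces values: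
  \<open>\<langle>f, e\<^sub>b\<rangle> = K sqrt (1 - |b|\<^sup>2) f(b)\<close> for a constant \<open>K \<ge> 0\<close>. So the quantity to be maximized is,
  up to a constant factor, \<open>sqrt (1 - |b|\<^sup>2) |f(b)|\<close>. It is continuous on the ball and tends to
  \<open>0\<close> at the boundary: splitting off a polynomial, which the weight kills, leaves a tail to which
  the Cauchy-Schwarz inequality applies. Hence it has a maximum.

  The work lies in the reproducing formula, because the inner product is an integral of radial
  limits over the three-sphere. Four facts carry it.

  \<^item> A slice regular function restricted to one slice is a pair of holomorphic functions of one
    complex variable, so it has a power series, and the slice identity spreads this series over the
    ball (\<open>slice_regular_power_series\<close>).

  \<^item> The measure with density \<open>1 / |Im q|\<^sup>2\<close> on the sphere gives every power \<open>q\<^sup>n\<close>, \<open>n > 0\<close>, the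
    integral \<open>0\<close>. This follows from Fubini in the coordinates \<open>(Re q, Im q)\<close>: the weighted measure
    is carried by the slope \<open>Re q / |Im q|\<close> to a multiple of \<open>ds / (1 + s\<^sup>2)\<close>, the image of the
    uniform distribution of the angle under the cotangent. Orthogonality of the powers is all that
    Parseval's identity needs, so one proof of it serves the circles in the slices
    and the sphere (\<open>orthogonal_powers.parseval\<close>).

  \<^item> Radial limits exist almost everywhere (\<open>fatou_radial_limit\<close>). On a circle the Poisson formula
    bounds the radial maximal function by the Hardy-Littlewood maximal function, the Vitali covering
    lemma bounds the latter, and the tails of the series have small norm. Two good angles
    \<open>t\<close> and \<open>-t\<close> in one slice make a whole two-sphere of good points, by the slice identity.

  \<^item> The dilates \<open>q \<mapsto> f(r q)\<close> are Cauchy in the mean as \<open>r \<rightarrow> 1\<close>, and by Fatou's lemma they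
    converge in the mean to their pointwise limit. For the dilates the formula is Parseval's identity
    (\<open>hardy_inner_szego_kernel\<close>).
\<close>


section \<open>Quaternion algebra\<close>

lemma qcnj_sel [simp]:
  "qRe (qcnj q) = qRe q" "qI (qcnj q) = - qI q" "qJ (qcnj q) = - qJ q" "qK (qcnj q) = - qK q"
  by (simp_all add: qcnj_def)

lemma quat_of_real_sel [simp]:
  "qRe (of_real x) = x" "qI (of_real x) = 0" "qJ (of_real x) = 0" "qK (of_real x) = 0"
  by (simp_all add: of_real_def)

lemma norm_quat_squared: "(norm q)\<^sup>2 = (qRe q)\<^sup>2 + (qI q)\<^sup>2 + (qJ q)\<^sup>2 + (qK q)\<^sup>2"
  by (simp add: norm_quat_def inner_quat_def power2_eq_square)

lemma qcnj_mult: "qcnj (p * q) = qcnj q * qcnj p"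
  by (simp add: quat_eq_iff)

lemma qcnj_qcnj [simp]: "qcnj (qcnj q) = q"
  by (simp add: quat_eq_iff)

lemma qcnj_of_real [simp]: "qcnj (of_real x) = of_real x"
  by (simp add: quat_eq_iff)

lemma qcnj_one [simp]: "qcnj 1 = 1"
  by (simp add: quat_eq_iff)

lemma qcnj_power: "qcnj (q ^ n) = qcnj q ^ n"
  by (induction n) (simp_all add: qcnj_mult power_commutes)

lemma qcnj_mult_self: "qcnj q * q = of_real ((norm q)\<^sup>2)"
  unfolding norm_quat_squared by (simp add: quat_eq_iff power2_eq_square algebra_simps del: of_real_add of_real_mult of_real_power)

lemma mult_qcnj_self: "q * qcnj q = of_real ((norm q)\<^sup>2)"
  unfolding norm_quat_squared by (simp add: quat_eq_iff power2_eq_square algebra_simps del: of_real_add of_real_mult of_real_power)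

lemma norm_qcnj [simp]: "norm (qcnj q) = norm q"
  by (simp add: norm_quat_def inner_quat_def)

lemma bounded_linear_qcnj: "bounded_linear qcnj"
  by (rule bounded_linear_intro[of _ 1]) (simp_all add: quat_eq_iff)

lemma bounded_linear_qRe: "bounded_linear qRe"
proof (rule bounded_linear_intro[of _ 1])
  show "norm (qRe q) \<le> norm q * 1" for q
    by (rule power2_le_imp_le) (simp_all add: norm_quat_squared)
qed simp_all

lemma bounded_linear_qIm: "bounded_linear qIm"
proof (rule bounded_linear_intro[of _ 1])
  show "norm (qIm q) \<le> norm q * 1" for q
    by (rule power2_le_imp_le) (simp_all add: norm_quat_squared qIm_def)
qed (simp_all add: quat_eq_iff qIm_def)

lemma continuous_on_qcnj [continuous_intros]:
  "continuous_on S f \<Longrightarrow> continuous_on S (\<lambda>x. qcnj (f x))"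
  by (rule bounded_linear.continuous_on[OF bounded_linear_qcnj])

lemma borel_measurable_qcnj [measurable]: "qcnj \<in> borel_measurable borel"
  by (intro borel_measurable_continuous_onI continuous_intros)

lemma borel_measurable_qRe [measurable]: "qRe \<in> borel_measurable borel"
  by (intro borel_measurable_continuous_onI bounded_linear.continuous_on[OF bounded_linear_qRe]
      continuous_intros)

lemma borel_measurable_qIm [measurable]: "qIm \<in> borel_measurable borel"
  by (intro borel_measurable_continuous_onI bounded_linear.continuous_on[OF bounded_linear_qIm]
      continuous_intros)

section \<open>Absolutely convergent quaternionic power series\<close>

definition qseries :: "(nat \<Rightarrow> quat) \<Rightarrow> quat \<Rightarrow> quat" where
  "qseries c q = (\<Sum>n. q ^ n * c n)"

lemma norm_qseries_term_le:
  fixes q :: quat assumes "norm q \<le> 1" shows "norm (q ^ n * c n) \<le> norm (c n)"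
  using assms by (simp add: norm_mult norm_power mult_left_le_one_le power_le_one)

lemma qseries_summable_norm:
  fixes q :: quat
  assumes "summable (\<lambda>n. norm (c n))" "norm q \<le> 1"
  shows "summable (\<lambda>n. norm (q ^ n * c n))"
  by (rule summable_comparison_test'[OF assms(1), of 0]) (use norm_qseries_term_le[OF assms(2)] in auto)

lemma qseries_sums:
  assumes "summable (\<lambda>n. norm (c n))" "norm q \<le> 1"
  shows "(\<lambda>n. q ^ n * c n) sums qseries c q"
  unfolding qseries_def using summable_norm_cancel[OF qseries_summable_norm[OF assms]] by (rule summable_sums)

lemma norm_qseries_le:
  assumes "summable (\<lambda>n. norm (c n))" "norm q \<le> 1"
  shows "norm (qseries c q) \<le> (\<Sum>n. norm (c n))"
proof -
  have "norm (qseries c q) \<le> (\<Sum>n. norm (q ^ n * c n))"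
    unfolding qseries_def by (rule summable_norm[OF qseries_summable_norm[OF assms]])
  also have "\<dots> \<le> (\<Sum>n. norm (c n))"
    by (intro suminf_le norm_qseries_term_le qseries_summable_norm assms)
  finally show ?thesis .
qed

text \<open>
  The Weierstrass test gives uniform convergence up to the boundary, so these series have radial
  limits everywhere. Dilates of Hardy functions are of this kind.
\<close>
lemma continuous_on_qseries:
  assumes "summable (\<lambda>n. norm (c n))"
  shows "continuous_on (cball 0 1) (qseries c)"
proof -
  have "uniform_limit (cball 0 1) (\<lambda>n q. \<Sum>i<n. q ^ i * c i) (\<lambda>q. \<Sum>i. q ^ i * c i) sequentially"
    by (rule Weierstrass_m_test[OF _ assms]) (simp add: norm_qseries_term_le)
  then have "continuous_on (cball 0 1) (\<lambda>q. \<Sum>i. q ^ i * c i)"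
    by (rule uniform_limit_theorem[rotated])
       (auto intro!: always_eventually continuous_intros)
  then show ?thesis unfolding qseries_def[abs_def] .
qed

lemma borel_measurable_qseries [measurable]: "qseries c \<in> borel_measurable borel"
  unfolding qseries_def[abs_def] by measurable

lemma qseries_dilate: "qseries c (of_real r * q) = qseries (\<lambda>n. of_real (r ^ n) * c n) q"
proof -
  have "(of_real r * q) ^ n = q ^ n * of_real (r ^ n)" for n
    using Real_Vector_Spaces.of_real_def
    by (induction n) (simp_all add: of_real_def power_commutes)
  then show ?thesis unfolding qseries_def by (simp add: mult.assoc)
qed

section \<open>Parseval identity for measures with orthogonal powers\<close>

text \<open>
  On the unit sphere \<open>cnj q = 1 / q\<close>, so the product \<open>cnj (q\<^sup>m) q\<^sup>n\<close> is a power of \<open>q\<close> or the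
  conjugate of one. Vanishing means of the positive powers are therefore exactly the orthonormality
  relations, up to the total mass. Arc length on the circle of a slice and the weighted measure on
  the three-sphere are the two instances.
\<close>
locale orthogonal_powers = finite_measure M for M :: "quat measure" +
  assumes sets_eq [measurable_cong]: "sets M = sets borel"
    and AE_norm_one: "AE q in M. norm q = 1"
    and integral_power: "n > 0 \<Longrightarrow> (\<integral>q. q ^ n \<partial>M) = 0"
begin

lemma integrable_bounded_unit:
  fixes f :: "quat \<Rightarrow> 'b :: {banach, second_countable_topology}"
  assumes [measurable]: "f \<in> borel_measurable borel" and "\<And>q. norm q = 1 \<Longrightarrow> norm (f q) \<le> B"
  shows "integrable M f"
proof (rule integrable_const_bound[of _ B])
  show "AE q in M. norm (f q) \<le> B" using AE_norm_one by eventually_elim (use assms in auto)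
qed (simp add: measurable_cong_sets[OF sets_eq refl])

lemma integral_qcnj:
  assumes "integrable M f" shows "(\<integral>q. qcnj (f q) \<partial>M) = qcnj (\<integral>q. f q \<partial>M)"
  by (rule integral_bounded_linear[OF bounded_linear_qcnj assms])

lemma integrable_power: "integrable M (\<lambda>q. q ^ n)"
  by (rule integrable_bounded_unit[of _ 1]) (auto simp: norm_power)

lemma integral_qcnj_power_mult_power:
  "(\<integral>q. qcnj (q ^ m) * q ^ n \<partial>M) = (if m = n then of_real (measure M (space M)) else 0)"
proof -
  have unit: "qcnj (q ^ k) * q ^ k = 1" if "norm q = 1" for q :: quat and k
    using that by (simp add: qcnj_mult_self norm_power)
  consider "m = n" | "m < n" | "n < m" by linarith
  then show ?thesis
  proof cases
    case 1
    have "(\<integral>q. qcnj (q ^ m) * q ^ n \<partial>M) = (\<integral>q. 1 \<partial>M)"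
      by (rule integral_cong_AE) (use AE_norm_one 1 unit in \<open>auto elim!: eventually_mono\<close>)
    with 1 show ?thesis by (simp add: scaleR_conv_of_real)
  next
    case 2
    have "qcnj (q ^ m) * q ^ n = q ^ (n - m)" if "norm q = 1" for q :: quat
    proof -
      have "q ^ n = q ^ m * q ^ (n - m)" using 2 by (simp flip: power_add)
      then show ?thesis using unit[OF that, of m] by (simp flip: mult.assoc)
    qed
    then have "(\<integral>q. qcnj (q ^ m) * q ^ n \<partial>M) = (\<integral>q. q ^ (n - m) \<partial>M)"
      by (intro integral_cong_AE) (use AE_norm_one in \<open>auto elim!: eventually_mono\<close>)
    with 2 show ?thesis using integral_power[of "n - m"] by simp
  next
    case 3
    have "qcnj (q ^ m) * q ^ n = qcnj (q ^ (m - n))" if "norm q = 1" for q :: quat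
    proof -
      have "q ^ m = q ^ n * q ^ (m - n)" using 3 by (simp flip: power_add)
      then show ?thesis using unit[OF that, of n] by (simp add: qcnj_mult mult.assoc)
    qed
    then have "(\<integral>q. qcnj (q ^ m) * q ^ n \<partial>M) = (\<integral>q. qcnj (q ^ (m - n)) \<partial>M)"
      by (intro integral_cong_AE) (use AE_norm_one in \<open>auto elim!: eventually_mono\<close>)
    with 3 show ?thesis
      using integral_power[of "m - n"] integral_qcnj[OF integrable_power, of "m - n"]
      by (simp add: quat_eq_iff)
  qed
qed

text \<open>
  Coefficients stand to the right of the powers of \<open>q\<close>, so in the integrand those of \<open>d\<close> come out
  on the left and those of \<open>c\<close> on the right. Since multiplication does not commute, the two series
  are exchanged with the integral one after the other.
\<close>
lemma parseval:
  assumes c: "summable (\<lambda>n. norm (c n))" and d: "summable (\<lambda>n. norm (d n))"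
  shows "(\<integral>q. qcnj (qseries d q) * qseries c q \<partial>M) =
    measure M (space M) *\<^sub>R (\<Sum>n. qcnj (d n) * c n)"
proof -
  define D where "D = (\<Sum>n. norm (d n))"
  have D: "norm (qseries d q) \<le> D" if "norm q = 1" for q
    using norm_qseries_le[OF d, of q] that by (simp add: D_def)
  let ?\<kappa> = "measure M (space M)"
  have inner: "(\<integral>q. qcnj (qseries d q) * q ^ n \<partial>M) = of_real ?\<kappa> * qcnj (d n)" for n
  proof -
    let ?f = "\<lambda>m q. qcnj (d m) * (qcnj (q ^ m) * q ^ n)"
    have swap: "(\<lambda>m. \<integral>q. ?f m q \<partial>M) sums (\<integral>q. (\<Sum>m. ?f m q) \<partial>M)"
    proof (rule sums_integral)
      show int: "integrable M (?f m)" for m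
        by (rule integrable_bounded_unit[of _ "norm (d m)"]) (auto simp: norm_mult norm_power)
      have nf: "norm (?f m q) = norm (d m)" if "norm q = 1" for m q
        using that by (simp add: norm_mult norm_power)
      show "AE q in M. summable (\<lambda>m. norm (?f m q))"
        using AE_norm_one by eventually_elim (use nf d in simp)
      have "(\<integral>q. norm (?f m q) \<partial>M) = (\<integral>q. norm (d m) \<partial>M)" for m
        by (rule integral_cong_AE) (use AE_norm_one nf in \<open>auto elim!: eventually_mono\<close>)
      then show "summable (\<lambda>m. \<integral>q. norm (?f m q) \<partial>M)"
        using d by (simp add: summable_mult)
    qed
    have each: "(\<lambda>m. \<integral>q. ?f m q \<partial>M) = (\<lambda>m. if m = n then qcnj (d n) * of_real ?\<kappa> else 0)"
    proof
      fix m
      have "integrable M (\<lambda>q. qcnj (q ^ m) * q ^ n)"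
        by (rule integrable_bounded_unit[of _ 1]) (auto simp: norm_mult norm_power)
      then show "(\<integral>q. ?f m q \<partial>M) = (if m = n then qcnj (d n) * of_real ?\<kappa> else 0)"
        by (simp add: integral_qcnj_power_mult_power)
    qed
    have lim: "(\<integral>q. (\<Sum>m. ?f m q) \<partial>M) = (\<integral>q. qcnj (qseries d q) * q ^ n \<partial>M)"
    proof (rule integral_cong_AE)
      show "AE q in M. (\<Sum>m. ?f m q) = qcnj (qseries d q) * q ^ n"
        using AE_norm_one
      proof eventually_elim
        case (elim q)
        have "(\<lambda>m. q ^ m * d m) sums qseries d q" using qseries_sums[OF d] elim by simp
        from bounded_linear.sums[OF bounded_linear_qcnj this]
        have "(\<lambda>m. qcnj (d m) * qcnj (q ^ m)) sums qcnj (qseries d q)" by (simp add: qcnj_mult)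
        from sums_mult2[OF this, of "q ^ n"] show ?case by (simp add: mult.assoc sums_iff)
      qed
    qed simp_all
    have "(\<integral>q. qcnj (qseries d q) * q ^ n \<partial>M) = qcnj (d n) * of_real ?\<kappa>"
      using swap[unfolded each lim] sums_single[of n "\<lambda>m. qcnj (d n) * of_real ?\<kappa>"] by (rule sums_unique2)
    then show ?thesis by (simp add: of_real_def)
  qed
  let ?g = "\<lambda>n q. qcnj (qseries d q) * (q ^ n * c n)"
  have ng: "norm (?g n q) \<le> D * norm (c n)" if "norm q = 1" for n q
    using that D[OF that] by (simp add: norm_mult norm_power mult_right_mono)
  have "(\<lambda>n. \<integral>q. ?g n q \<partial>M) sums (\<integral>q. (\<Sum>n. ?g n q) \<partial>M)"
  proof (rule sums_integral)
    show int: "integrable M (?g n)" for n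
      by (rule integrable_bounded_unit[of _ "D * norm (c n)"]) (use ng in auto)
    show "AE q in M. summable (\<lambda>n. norm (?g n q))"
      using AE_norm_one
    proof eventually_elim
      case (elim q)
      show ?case
        by (rule summable_comparison_test'[OF summable_mult[OF c, of D], of 0]) (use ng[OF elim] in auto)
    qed
    have "norm (\<integral>q. norm (?g n q) \<partial>M) \<le> (?\<kappa> * D) * norm (c n)" for n
    proof -
      have "(\<integral>q. norm (?g n q) \<partial>M) \<le> (\<integral>q. D * norm (c n) \<partial>M)"
        by (rule integral_mono_AE) (use int ng AE_norm_one in \<open>auto elim!: eventually_mono\<close>)
      then show ?thesis by simp
    qed
    then show "summable (\<lambda>n. \<integral>q. norm (?g n q) \<partial>M)"
      by (intro summable_comparison_test'[OF summable_mult[OF c, of "?\<kappa> * D"], of 0]) auto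
  qed
  moreover have "(\<integral>q. ?g n q \<partial>M) = ?\<kappa> *\<^sub>R (qcnj (d n) * c n)" for n
  proof -
    have "integrable M (\<lambda>q. qcnj (qseries d q) * q ^ n)"
      by (rule integrable_bounded_unit[of _ D]) (use D in \<open>auto simp: norm_mult norm_power\<close>)
    then have "(\<integral>q. ?g n q \<partial>M) = (\<integral>q. qcnj (qseries d q) * q ^ n \<partial>M) * c n"
      by (simp flip: mult.assoc)
    then show ?thesis by (simp add: inner of_real_def)
  qed
  moreover have "(\<integral>q. (\<Sum>n. ?g n q) \<partial>M) = (\<integral>q. qcnj (qseries d q) * qseries c q \<partial>M)"
  proof (rule integral_cong_AE)
    show "AE q in M. (\<Sum>n. ?g n q) = qcnj (qseries d q) * qseries c q"
      using AE_norm_one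
    proof eventually_elim
      case (elim q)
      have "(\<lambda>n. q ^ n * c n) sums qseries c q" using qseries_sums[OF c] elim by simp
      from sums_mult[OF this, of "qcnj (qseries d q)"] show ?case by (simp add: sums_iff)
    qed
  qed simp_all
  moreover have "summable (\<lambda>n. qcnj (d n) * c n)"
  proof (rule summable_comparison_test'[OF summable_mult[OF c, of D], of 0])
    fix n :: nat
    have "norm (d n) \<le> D" using sum_le_suminf[OF d, of "{n}"] by (simp add: D_def)
    then show "norm (qcnj (d n) * c n) \<le> D * norm (c n)" by (simp add: norm_mult mult_right_mono)
  qed
  ultimately show ?thesis by (simp add: sums_iff suminf_scaleR_right)
qed

lemma parseval_norm:
  assumes c: "summable (\<lambda>n. norm (c n))"
  shows "(\<integral>q. (norm (qseries c q))\<^sup>2 \<partial>M) = measure M (space M) * (\<Sum>n. (norm (c n))\<^sup>2)"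
    and "summable (\<lambda>n. (norm (c n))\<^sup>2)"
proof -
  define D where "D = (\<Sum>n. norm (c n))"
  show sq: "summable (\<lambda>n. (norm (c n))\<^sup>2)"
  proof (rule summable_comparison_test'[OF summable_mult[OF c, of D], of 0])
    fix n :: nat
    have "norm (c n) \<le> D" using sum_le_suminf[OF c, of "{n}"] by (simp add: D_def)
    then show "norm ((norm (c n))\<^sup>2) \<le> D * norm (c n)"
      by (simp add: power2_eq_square mult_right_mono)
  qed
  have "integrable M (\<lambda>q. (norm (qseries c q))\<^sup>2)"
    by (rule integrable_bounded_unit[of _ "D\<^sup>2"])
       (use norm_qseries_le[OF c] in \<open>auto simp: D_def intro!: power_mono\<close>)
  then have "of_real (\<integral>q. (norm (qseries c q))\<^sup>2 \<partial>M) = (\<integral>q. qcnj (qseries c q) * qseries c q \<partial>M)"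
    by (simp only: qcnj_mult_self integral_of_real)
  also have "\<dots> = measure M (space M) *\<^sub>R (\<Sum>n. of_real ((norm (c n))\<^sup>2))"
    using parseval[OF c c] by (simp only: qcnj_mult_self)
  also have "\<dots> = of_real (measure M (space M) * (\<Sum>n. (norm (c n))\<^sup>2))"
    using sq by (simp add: suminf_of_real scaleR_conv_of_real)
  finally show "(\<integral>q. (norm (qseries c q))\<^sup>2 \<partial>M) = measure M (space M) * (\<Sum>n. (norm (c n))\<^sup>2)"
    by (simp only: of_real_eq_iff)
qed

end

section \<open>Slices and the circles in them\<close>

text \<open>
  The ring embedding of the complex numbers onto the slice of \<open>I\<close>.
\<close>
definition slice_embed :: "quat \<Rightarrow> complex \<Rightarrow> quat" where
  "slice_embed I z = slice_pt I (Re z) (Im z)"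

lemma imag_units_square: "I \<in> imag_units \<Longrightarrow> I * I = -1"
  by (simp add: imag_units_def power2_eq_square)

lemma imag_units_norm: "I \<in> imag_units \<Longrightarrow> norm I = 1"
  by (metis imag_units_square norm_minus_cancel norm_mult norm_one norm_ge_zero
      power2_eq_square power2_eq_iff_nonneg power_one zero_le_one)

lemma imag_units_qRe: assumes "I \<in> imag_units" shows "qRe I = 0"
proof (rule ccontr)
  assume "qRe I \<noteq> 0"
  moreover have "qRe I * qI I = 0" "qRe I * qJ I = 0" "qRe I * qK I = 0"
    and re: "qRe I * qRe I - qI I * qI I - qJ I * qJ I - qK I * qK I = -1"
    using imag_units_square[OF assms] by (auto simp: quat_eq_iff)
  ultimately have "qRe I * qRe I = -1" by simp
  then show False using zero_le_square[of "qRe I"] by linarith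
qed

lemma imag_unitsI:
  assumes "qRe I = 0" "norm I = 1" shows "I \<in> imag_units"
proof -
  have "(qI I)\<^sup>2 + (qJ I)\<^sup>2 + (qK I)\<^sup>2 = 1" using assms norm_quat_squared[of I] by simp
  then show ?thesis using assms(1)
    by (simp add: imag_units_def quat_eq_iff power2_eq_square)
qed

definition unit_i :: quat where "unit_i = Quat 0 1 0 0"

lemma unit_i_imag: "unit_i \<in> imag_units"
  unfolding unit_i_def by (rule imag_unitsI) (simp_all add: norm_quat_def inner_quat_def)

lemma slice_embed_of_real [simp]: "slice_embed I (of_real x) = of_real x"
  by (simp add: slice_embed_def slice_pt_def)

lemma slice_embed_1 [simp]: "slice_embed I 1 = 1"
  by (simp add: slice_embed_def slice_pt_def)

lemma slice_embed_i [simp]: "slice_embed I \<i> = I"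
  by (simp add: slice_embed_def slice_pt_def)

lemma linear_slice_embed: "linear (slice_embed I)"
  by (rule linearI)
     (simp_all add: slice_embed_def slice_pt_def of_real_def algebra_simps)

lemma bounded_linear_slice_embed: "bounded_linear (slice_embed I)"
  by (rule linear_conv_bounded_linear[THEN iffD1, OF linear_slice_embed])

context
  fixes I assumes I: "I \<in> imag_units"
begin

lemma slice_embed_mult: "slice_embed I (z * w) = slice_embed I z * slice_embed I w"
proof -
  have "of_real x * I * (of_real y * I) = of_real (- (x * y))" for x y
    using imag_units_square[OF I] by (simp add: of_real_def)
  then show ?thesis
    by (simp add: slice_embed_def slice_pt_def algebra_simps of_real_def)
qed

lemma slice_embed_power: "slice_embed I (z ^ n) = slice_embed I z ^ n"
  by (induction n) (simp_all add: slice_embed_mult)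

lemma norm_slice_embed: "norm (slice_embed I z) = norm z"
proof (rule power2_eq_imp_eq)
  have "(qI I)\<^sup>2 + (qJ I)\<^sup>2 + (qK I)\<^sup>2 = 1"
    using imag_units_norm[OF I] imag_units_qRe[OF I] norm_quat_squared[of I] by simp
  then have "(Im z)\<^sup>2 * ((qI I)\<^sup>2 + (qJ I)\<^sup>2 + (qK I)\<^sup>2) = (Im z)\<^sup>2" by simp
  then show "(norm (slice_embed I z))\<^sup>2 = (norm z)\<^sup>2"
    unfolding norm_quat_squared cmod_power2
    by (simp add: slice_embed_def slice_pt_def imag_units_qRe[OF I] power_mult_distrib algebra_simps)
qed simp_all

lemma slice_embed_exp: "slice_embed I (exp z) = exp (slice_embed I z)"
proof -
  have "(\<lambda>n. z ^ n /\<^sub>R fact n) sums exp z" by (rule exp_converges)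
  from bounded_linear.sums[OF bounded_linear_slice_embed this, of I]
  have "(\<lambda>n. slice_embed I z ^ n /\<^sub>R fact n) sums slice_embed I (exp z)"
    by (simp add: linear_cmul[OF linear_slice_embed] slice_embed_power)
  then show ?thesis using exp_converges sums_unique2 by blast
qed

lemma exp_imag_unit: "exp (I * of_real t) = slice_embed I (cis t)"
proof -
  have "I * of_real t = slice_embed I (\<i> * of_real t)"
    by (simp add: slice_embed_mult)
  then show ?thesis by (simp only: cis_conv_exp slice_embed_exp)
qed

end

text \<open>
  The interval has length \<open>2 \<pi>\<close> but a free starting point: the Poisson kernel is symmetric about
  \<open>0\<close>, whereas the Hardy space condition integrates from \<open>0\<close>.
\<close>
definition circle_measure :: "real \<Rightarrow> quat \<Rightarrow> quat measure" where
  "circle_measure a I =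
    distr (restrict_space lborel {a..a + 2 * pi}) borel (\<lambda>t. slice_embed I (cis t))"

lemma slice_embed_cis_continuous: "continuous_on S (\<lambda>t. slice_embed I (cis t))"
  by (intro bounded_linear.continuous_on[OF bounded_linear_slice_embed] continuous_intros)

lemma slice_embed_cis_measurable [measurable]:
  "(\<lambda>t. slice_embed I (cis t)) \<in> borel_measurable borel"
  by (intro borel_measurable_continuous_onI slice_embed_cis_continuous)

lemma integral_circle_measure:
  fixes f :: "quat \<Rightarrow> 'b :: {banach, second_countable_topology}"
  assumes [measurable]: "f \<in> borel_measurable borel"
  shows "(\<integral>q. f q \<partial>circle_measure a I) =
    (LINT t:{a..a + 2 * pi}|lborel. f (slice_embed I (cis t)))"
proof -
  have "(\<lambda>t. slice_embed I (cis t)) \<in> measurable (restrict_space lborel {a..a + 2 * pi}) borel"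
    by (rule measurable_restrict_space1) simp
  then show ?thesis
    unfolding circle_measure_def
    by (simp add: integral_distr integral_restrict_space set_lebesgue_integral_def)
qed

lemma emeasure_circle_measure: "emeasure (circle_measure a I) (space (circle_measure a I)) = 2 * pi"
proof -
  have "(\<lambda>t. slice_embed I (cis t)) \<in> measurable (restrict_space lborel {a..a + 2 * pi}) borel"
    by (rule measurable_restrict_space1) simp
  then show ?thesis
    unfolding circle_measure_def
    by (simp add: emeasure_distr emeasure_restrict_space space_restrict_space)
qed

lemma orthogonal_powers_circle_measure:
  assumes I: "I \<in> imag_units"
  shows "orthogonal_powers (circle_measure a I)"
proof (intro orthogonal_powers.intro orthogonal_powers_axioms.intro finite_measureI)
  let ?C = "circle_measure a I"
  have meas: "(\<lambda>t. slice_embed I (cis t)) \<in> measurable (restrict_space lborel {a..a + 2 * pi}) borel"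
    by (rule measurable_restrict_space1) simp
  show "emeasure ?C (space ?C) \<noteq> \<infinity>" by (simp add: emeasure_circle_measure)
  show "sets ?C = sets borel" by (simp add: circle_measure_def)
  show "AE q in ?C. norm q = 1"
    unfolding circle_measure_def
    by (subst AE_distr_iff[OF meas]) (auto simp: norm_slice_embed[OF I])
  show "(\<integral>q. q ^ n \<partial>?C) = 0" if "n > 0" for n
  proof -
    let ?F = "\<lambda>t. cis (real n * t) / (\<i> * of_nat n)"
    have "(\<integral>q. q ^ n \<partial>?C) = (LINT t:{a..a + 2 * pi}|lborel. slice_embed I (cis (real n * t)))"
      by (subst integral_circle_measure)
         (simp_all add: slice_embed_power[OF I] flip: Complex.DeMoivre)
    also have "\<dots> = slice_embed I (?F (a + 2 * pi)) - slice_embed I (?F a)"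
      unfolding set_lebesgue_integral_def
    proof (rule integral_FTC_atLeastAtMost)
      show "((\<lambda>t. slice_embed I (?F t)) has_vector_derivative slice_embed I (cis (real n * x)))
          (at x within {a..a + 2 * pi})" for x
      proof (rule bounded_linear.has_vector_derivative[OF bounded_linear_slice_embed])
        have "((\<lambda>z. exp (\<i> * of_nat n * z) / (\<i> * of_nat n)) has_field_derivative
            exp (\<i> * of_nat n * of_real x)) (at (of_real x))"
          using that by (auto intro!: derivative_eq_intros)
        from has_vector_derivative_real_field[OF this]
        show "(?F has_vector_derivative cis (real n * x)) (at x within {a..a + 2 * pi})"
          by (simp add: cis_conv_exp mult_ac)
      qed
      show "continuous_on {a..a + 2 * pi} (\<lambda>t. slice_embed I (cis (real n * t)))"
        by (intro bounded_linear.continuous_on[OF bounded_linear_slice_embed] continuous_intros)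
    qed simp
    also have "cis (real n * (a + 2 * pi)) = cis (real n * a)"
      using cis_multiple_2pi[of "real n"] by (simp add: distrib_left mult_ac flip: cis_mult)
    finally show ?thesis by simp
  qed
qed

lemma circle_parseval_norm:
  assumes I: "I \<in> imag_units" and c: "summable (\<lambda>n. norm (c n))"
  shows "(LINT t:{a..a + 2 * pi}|lborel. (norm (qseries c (slice_embed I (cis t))))\<^sup>2) =
    2 * pi * (\<Sum>n. (norm (c n))\<^sup>2)"
proof -
  interpret orthogonal_powers "circle_measure a I" by (rule orthogonal_powers_circle_measure[OF I])
  show ?thesis using parseval_norm(1)[OF c]
    by (simp add: integral_circle_measure measure_def emeasure_circle_measure)
qed

section \<open>Uniqueness of power series coefficients\<close>

text \<open>
  Parseval's identity on a single circle shows that the sum of the squared coefficients is zero.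
\<close>
lemma qseries_eq_zero_imp:
  assumes c: "summable (\<lambda>n. norm (c n))" and 0: "\<And>q. norm q = 1 \<Longrightarrow> qseries c q = 0"
  shows "c n = 0"
proof -
  interpret orthogonal_powers "circle_measure 0 unit_i"
    by (rule orthogonal_powers_circle_measure[OF unit_i_imag])
  have "2 * pi * (\<Sum>n. (norm (c n))\<^sup>2) = 0"
    using circle_parseval_norm[OF unit_i_imag c, of 0] 0 norm_slice_embed[OF unit_i_imag]
    by (simp add: set_lebesgue_integral_def)
  then have "(\<Sum>n. (norm (c n))\<^sup>2) = 0" by simp
  then have "(norm (c n))\<^sup>2 = 0" for n
    using suminf_eq_zero_iff[OF parseval_norm(2)[OF c]] by simp
  then show ?thesis by simp
qed

lemma power_series_sums_imp_summable_norm: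
  fixes c :: "nat \<Rightarrow> quat"
  assumes "\<And>q. q \<in> unit_ball \<Longrightarrow> summable (\<lambda>n. q ^ n * c n)" "0 \<le> r" "r < 1"
  shows "summable (\<lambda>n. norm (of_real (r ^ n) * c n))"
proof -
  define s :: real where "s = (1 + r) / 2"
  have s: "0 < s" "s < 1" "r < s" using assms by (auto simp: s_def)
  have "summable (\<lambda>n. of_real s ^ n * c n)" by (rule assms) (use s in simp)
  then have "(\<lambda>n. of_real s ^ n * c n) \<longlonglongrightarrow> 0" by (rule summable_LIMSEQ_zero)
  then obtain B where B: "\<And>n. norm (of_real s ^ n * c n) \<le> B"
    using Bseq_def[THEN iffD1, OF convergent_imp_Bseq, OF convergentI] by blast
  have le: "norm (of_real (r ^ n) * c n) \<le> B * (r / s) ^ n" for n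
  proof -
    have "norm (of_real (r ^ n) * c n) = norm (of_real s ^ n * c n) * (r / s) ^ n"
      using s assms by (simp add: norm_mult norm_power power_divide)
    also have "\<dots> \<le> B * (r / s) ^ n"
      using s assms by (intro mult_right_mono B) auto
    finally show ?thesis .
  qed
  have "summable (\<lambda>n. B * (r / s) ^ n)"
    using s assms by (intro summable_mult summable_geometric) auto
  then show ?thesis
    by (rule summable_comparison_test'[of _ 0]) (simp only: real_norm_def abs_norm_cancel le)
qed

text \<open>
  Shrinking to radius \<open>1/2\<close> turns two expansions on the open ball into absolutely convergent series
  on the closed ball, where uniqueness is available.
\<close>
lemma qcoeff_eqI:
  assumes "\<And>q. q \<in> unit_ball \<Longrightarrow> (\<lambda>n. q ^ n * a n) sums f q"
  shows "qcoeff f = a"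
  unfolding qcoeff_def
proof (rule the_equality)
  show "\<forall>q\<in>unit_ball. (\<lambda>n. q ^ n * a n) sums f q" using assms by blast
next
  fix b assume b: "\<forall>q\<in>unit_ball. (\<lambda>n. q ^ n * b n) sums f q"
  define c where "c n = of_real ((1/2) ^ n) * (b n - a n)" for n
  have diff: "(\<lambda>n. q ^ n * (b n - a n)) sums 0" if "q \<in> unit_ball" for q
    using sums_diff[OF bspec[OF b that] assms[OF that]] by (simp add: right_diff_distrib)
  have c: "summable (\<lambda>n. norm (c n))"
    unfolding c_def by (rule power_series_sums_imp_summable_norm) (use diff in \<open>auto simp: sums_iff\<close>)
  have "c n = 0" for n
  proof (rule qseries_eq_zero_imp[OF c])
    fix q :: quat assume "norm q = 1"
    then have "(\<Sum>n. (of_real (1/2) * q) ^ n * (b n - a n)) = 0"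
      by (intro sums_unique[symmetric] diff) (simp add: norm_mult del: of_real_divide)
    then show "qseries c q = 0"
      unfolding c_def[abs_def] qseries_dilate[symmetric] qseries_def .
  qed
  then show "b = a" by (auto simp: c_def)
qed

section \<open>The Poisson formula on a circle\<close>

definition poisson_kernel :: "real \<Rightarrow> real \<Rightarrow> real" where
  "poisson_kernel r s = (1 - r\<^sup>2) / (1 - 2 * r * cos s + r\<^sup>2)"

lemma poisson_denominator_pos:
  fixes r s :: real
  assumes "0 \<le> r" "r < 1" shows "0 < 1 - 2 * r * cos s + r\<^sup>2"
proof -
  have "r * cos s \<le> r * 1" by (rule mult_left_mono[OF cos_le_one assms(1)])
  moreover have "0 < (1 - r)\<^sup>2" using assms by simp
  ultimately show ?thesis by (simp add: power2_eq_square algebra_simps)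
qed

lemma poisson_kernel_pos:
  assumes "0 \<le> r" "r < 1" shows "0 < poisson_kernel r s"
  using poisson_denominator_pos[OF assms] assms
  by (simp add: poisson_kernel_def power_less_one_iff abs_square_less_1)

lemma continuous_on_poisson_kernel:
  assumes "0 \<le> r" "r < 1" shows "continuous_on S (poisson_kernel r)"
  unfolding poisson_kernel_def[abs_def]
  using poisson_denominator_pos[OF assms]
  by (intro continuous_intros) (metis less_irrefl)

lemma suminf_geometric_noncommutative:
  fixes x :: "'a :: {real_normed_div_algebra, banach}"
  assumes "norm x < 1" shows "(\<Sum>n. x ^ n) = inverse (1 - x)"
proof -
  have sum: "summable (\<lambda>n. x ^ n)" using assms by (rule complete_algebra_summable_geometric)
  have "(\<Sum>n. x ^ n) = 1 + x * (\<Sum>n. x ^ n)"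
    using suminf_split_head[OF sum] suminf_mult[OF sum, of x] by (simp add: algebra_simps)
  then have "(1 - x) * (\<Sum>n. x ^ n) = 1"
    unfolding left_diff_distrib mult_1_left diff_eq_eq .
  then show ?thesis by (metis inverse_unique)
qed

lemma qseries_geometric:
  fixes q :: quat
  assumes "\<bar>r\<bar> < 1" "norm q \<le> 1"
  shows "summable (\<lambda>n. norm (of_real (r ^ n) :: quat))"
    and "qseries (\<lambda>n. of_real (r ^ n)) q = inverse (1 - of_real r * q)"
proof -
  show "summable (\<lambda>n. norm (of_real (r ^ n) :: quat))"
    using assms by (simp add: norm_power summable_geometric)
  have "norm (of_real r * q) < 1"
    using assms mult_left_le[of "norm q" "\<bar>r\<bar>"] by (simp add: norm_mult)
  then have "(\<Sum>n. (of_real r * q) ^ n) = inverse (1 - of_real r * q)"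
    by (rule suminf_geometric_noncommutative)
  moreover have "(of_real r * q) ^ n * 1 = q ^ n * of_real (r ^ n)" for n
    by (induction n) (simp_all add: of_real_def power_commutes)
  ultimately show "qseries (\<lambda>n. of_real (r ^ n)) q = inverse (1 - of_real r * q)"
    by (simp add: qseries_def)
qed

lemma power_mult_commuting:
  fixes x y :: "'a :: monoid_mult"
  assumes "x * y = y * x" shows "(x * y) ^ n = x ^ n * y ^ n"
proof (induction n)
  case (Suc n)
  have "x * y * (x ^ n * y ^ n) = x * (y * x ^ n) * y ^ n" by (simp add: mult.assoc)
  also have "y * x ^ n = x ^ n * y" using power_commuting_commutes[OF assms, of n] by simp
  finally show ?case using Suc by (simp add: mult.assoc)
qed simp

text \<open>
  With the geometric series \<open>k(q) = 1 / (1 - r q)\<close> the Poisson kernel is \<open>(1 - r\<^sup>2) |k|\<^sup>2\<close>. Hence,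
  up to the factor \<open>1 - r\<^sup>2\<close>, the integral of the kernel against \<open>f\<close> is the pairing of \<open>k f\<close> with \<open>k\<close>, which by Parseval's
  identity is the value of \<open>k f\<close> at \<open>r\<close>, namely \<open>f(r) / (1 - r\<^sup>2)\<close>. The coefficients of \<open>k\<close> are
  real, so \<open>k f\<close> is given by a Cauchy product although quaternions do not commute. The rotation by
  \<open>t\<close> stays in the slice and is absorbed into the coefficients.
\<close>
lemma poisson_formula:
  assumes I: "I \<in> imag_units" and c: "summable (\<lambda>n. norm (c n))" and r: "0 \<le> r" "r < 1"
  shows "qseries c (of_real r * slice_embed I (cis t)) = (1 / (2 * pi)) *\<^sub>R
    (LINT s:{-pi..pi}|lborel. poisson_kernel r s *\<^sub>R qseries c (slice_embed I (cis (s + t))))"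
proof -
  define e where "e t = slice_embed I (cis t)" for t
  have e_mult: "e s * e t = e (s + t)" for s t
    by (simp add: e_def cis_mult flip: slice_embed_mult[OF I])
  have norm_e: "norm (e t) = 1" for t by (simp add: e_def norm_slice_embed[OF I])
  define k where "k n = (of_real (r ^ n) :: quat)" for n
  define c' where "c' n = e t ^ n * c n" for n
  define h where "h n = (\<Sum>i\<le>n. k i * c' (n - i))" for n
  have k: "summable (\<lambda>n. norm (k n))"
    unfolding k_def using qseries_geometric(1)[of r 0] r by simp
  have kq: "qseries k q = inverse (1 - of_real r * q)" if "norm q \<le> 1" for q
    unfolding k_def[abs_def] using qseries_geometric(2)[OF _ that] r by simp
  have c': "summable (\<lambda>n. norm (c' n))"
    using c by (simp add: c'_def norm_mult norm_power norm_e)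
  have h: "summable (\<lambda>n. norm (h n))"
  proof (rule summable_comparison_test'[of _ 0])
    show "summable (\<lambda>n. \<Sum>i\<le>n. norm (k i) * norm (c' (n - i)))"
      by (rule summable_Cauchy_product) (use k c' in simp_all)
    show "norm (norm (h n)) \<le> (\<Sum>i\<le>n. norm (k i) * norm (c' (n - i)))" for n
      unfolding h_def norm_mult[symmetric] by (simp only: real_norm_def abs_norm_cancel norm_sum)
  qed
  \<comment> \<open>The powers of \<open>r\<close> are real, so the factors in each term of the Cauchy product can be reordered.\<close>
  have hq: "qseries h q = qseries k q * qseries c' q" if "norm q \<le> 1" for q
  proof -
    have "(\<lambda>n. \<Sum>i\<le>n. (q ^ i * k i) * (q ^ (n - i) * c' (n - i))) sums (qseries k q * qseries c' q)"
      unfolding qseries_def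
      by (rule Cauchy_product_sums) (use qseries_summable_norm[OF _ that] k c' in auto)
    moreover have "(\<Sum>i\<le>n. (q ^ i * k i) * (q ^ (n - i) * c' (n - i))) = q ^ n * h n" for n
      unfolding h_def sum_distrib_left
    proof (rule sum.cong[OF refl])
      fix i assume "i \<in> {..n}"
      then have "q ^ n = q ^ i * q ^ (n - i)" by (simp flip: power_add)
      then show "(q ^ i * k i) * (q ^ (n - i) * c' (n - i)) = q ^ n * (k i * c' (n - i))"
        by (simp add: k_def of_real_def mult.assoc)
    qed
    ultimately show ?thesis by (simp add: qseries_def sums_iff)
  qed
  have qc': "qseries c' q = qseries c (q * e t)" if "q * e t = e t * q" for q
  proof -
    have "(q * e t) ^ n = q ^ n * e t ^ n" for n
      by (rule power_mult_commuting[OF that])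
    then show ?thesis by (simp add: qseries_def c'_def mult.assoc)
  qed
  have r2: "0 < 1 - r\<^sup>2" using r by (simp add: abs_square_less_1)
  interpret orthogonal_powers "circle_measure (-pi) I"
    by (rule orthogonal_powers_circle_measure[OF I])
  have "(\<integral>q. qcnj (qseries k q) * qseries h q \<partial>circle_measure (-pi) I) =
      (2 * pi) *\<^sub>R (\<Sum>n. qcnj (k n) * h n)"
    using parseval[OF h k] by (simp add: measure_def emeasure_circle_measure)
  also have "(\<Sum>n. qcnj (k n) * h n) = qseries h (of_real r)"
    by (simp add: k_def qseries_def qcnj_power)
  also have "\<dots> = inverse (1 - of_real (r\<^sup>2)) * qseries c (of_real r * e t)"
    using r kq[of "of_real r"] qc'[of "of_real r"]
    by (subst hq) (simp_all add: power2_eq_square of_real_def)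
  also have "inverse (1 - of_real (r\<^sup>2)) = (of_real (inverse (1 - r\<^sup>2)) :: quat)" by simp
  finally have 1: "(\<integral>q. qcnj (qseries k q) * qseries h q \<partial>circle_measure (-pi) I) =
      (2 * pi * inverse (1 - r\<^sup>2)) *\<^sub>R qseries c (of_real r * e t)"
    by (simp add: of_real_def)
  have "(\<integral>q. qcnj (qseries k q) * qseries h q \<partial>circle_measure (-pi) I) =
      (LINT s:{-pi..pi}|lborel. qcnj (qseries k (e s)) * qseries h (e s))"
    by (simp add: integral_circle_measure e_def)
  also have "\<dots> = (LINT s:{-pi..pi}|lborel. inverse (1 - r\<^sup>2) *\<^sub>R poisson_kernel r s *\<^sub>R qseries c (e (s + t)))"
  proof -
    have "qcnj (qseries k (e s)) * qseries h (e s) =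
      inverse (1 - r\<^sup>2) *\<^sub>R poisson_kernel r s *\<^sub>R qseries c (e (s + t))" for s
    proof -
      have "qcnj (qseries k (e s)) * qseries h (e s) =
          of_real ((norm (qseries k (e s)))\<^sup>2) * qseries c (e (s + t))"
        using e_mult[of s t] e_mult[of t s]
        by (simp add: hq norm_e qc' add.commute qcnj_mult_self flip: mult.assoc)
      also have "(norm (qseries k (e s)))\<^sup>2 = inverse ((norm (1 - of_real r * cis s))\<^sup>2)"
      proof -
        have "1 - of_real r * e s = slice_embed I (1 - of_real r * cis s)"
          by (simp add: linear_diff[OF linear_slice_embed] slice_embed_mult[OF I] e_def)
        then show ?thesis by (simp add: kq norm_e norm_inverse norm_slice_embed[OF I] power_inverse)
      qed
      also have "(norm (1 - of_real r * cis s))\<^sup>2 = 1 - 2 * r * cos s + r\<^sup>2"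
      proof -
        have "(1 - r * cos s)\<^sup>2 + (r * sin s)\<^sup>2 = 1 - 2 * r * cos s + r\<^sup>2 * ((sin s)\<^sup>2 + (cos s)\<^sup>2)"
          by algebra
        then show ?thesis by (simp add: cmod_power2)
      qed
      finally show ?thesis using r2 by (simp add: poisson_kernel_def of_real_def divide_inverse)
    qed
    then show ?thesis by simp
  qed
  also have "\<dots> = inverse (1 - r\<^sup>2) *\<^sub>R
      (LINT s:{-pi..pi}|lborel. poisson_kernel r s *\<^sub>R qseries c (e (s + t)))"
    by (rule set_integral_scaleR_right)
  finally have "(2 * pi * inverse (1 - r\<^sup>2)) *\<^sub>R qseries c (of_real r * e t) = inverse (1 - r\<^sup>2) *\<^sub>R
      (LINT s:{-pi..pi}|lborel. poisson_kernel r s *\<^sub>R qseries c (e (s + t)))"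
    using 1 by simp
  then have "(LINT s:{-pi..pi}|lborel. poisson_kernel r s *\<^sub>R qseries c (e (s + t))) =
      (2 * pi) *\<^sub>R qseries c (of_real r * e t)"
    using r2 by (metis (no_types, lifting) inverse_nonzero_iff_nonzero less_irrefl mult.commute scaleR_left_imp_eq scaleR_scaleR)
  then show ?thesis by (simp add: e_def)
qed

section \<open>Poisson averages and interval averages\<close>

text \<open>
  The Poisson formula for the constant function \<open>1\<close>.
\<close>
lemma integral_poisson_kernel:
  assumes "0 \<le> r" "r < 1"
  shows "integral {-pi..pi} (poisson_kernel r) = 2 * pi"
proof -
  let ?c = "\<lambda>n::nat. if n = 0 then 1 else (0::quat)"
  have "summable (\<lambda>n. norm (?c n))" by (rule summable_finite[of "{0}"]) auto
  moreover have "qseries ?c q = 1" for q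
  proof -
    have "qseries ?c q = (\<Sum>n\<in>{0}. q ^ n * ?c n)"
      unfolding qseries_def by (rule suminf_finite) auto
    then show ?thesis by simp
  qed
  ultimately have "(1::quat) = (1 / (2 * pi)) *\<^sub>R (LINT s:{-pi..pi}|lborel. poisson_kernel r s *\<^sub>R 1)"
    using poisson_formula[OF unit_i_imag, of ?c r 0] assms by simp
  moreover have int: "set_integrable lborel {-pi..pi} (poisson_kernel r)"
    by (intro borel_integrable_atLeastAtMost' continuous_on_poisson_kernel assms)
  then have "(LINT s:{-pi..pi}|lborel. poisson_kernel r s *\<^sub>R (1::quat)) =
      (LINT s:{-pi..pi}|lborel. poisson_kernel r s) *\<^sub>R 1"
    unfolding set_lebesgue_integral_def set_integrable_def scaleR_scaleR[symmetric] real_scaleR_def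
    by (simp flip: integral_scaleR_left)
  ultimately have "(1::quat) = ((1 / (2 * pi)) * (LINT s:{-pi..pi}|lborel. poisson_kernel r s)) *\<^sub>R 1"
    by simp
  then have "qRe 1 = qRe (((1 / (2 * pi)) * (LINT s:{-pi..pi}|lborel. poisson_kernel r s)) *\<^sub>R 1)"
    by (rule arg_cong)
  then show ?thesis using set_borel_integral_eq_integral(2)[OF int] by (simp add: field_simps)
qed

text \<open>
  A symmetric kernel that decreases away from \<open>0\<close> is a superposition of averages over centred
  intervals. Integration by parts expresses this: \<open>H\<close> measures how far the integral of \<open>g\<close> over
  \<open>[-s, s]\<close> stays below its bound, and the kernel has a nonpositive derivative.
\<close>
lemma poisson_average_le:
  fixes g :: "real \<Rightarrow> real"
  assumes r: "0 \<le> r" "r < 1" and g: "continuous_on UNIV g"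
    and avg: "\<And>\<sigma>. 0 < \<sigma> \<Longrightarrow> \<sigma> \<le> pi \<Longrightarrow> integral {-\<sigma>..\<sigma>} g \<le> 2 * \<sigma> * L"
  shows "integral {-pi..pi} (\<lambda>s. poisson_kernel r s * g s) \<le> 2 * pi * L"
proof -
  let ?P = "poisson_kernel r"
  define P' where "P' s = - ((1 - r\<^sup>2) * (2 * r * sin s)) / (1 - 2 * r * cos s + r\<^sup>2)\<^sup>2" for s
  note den = poisson_denominator_pos[OF r]
  have gI: "continuous_on S g" for S by (rule continuous_on_subset[OF g]) simp
  have gm: "continuous_on S (\<lambda>s. g (- s))" for S
    by (rule continuous_on_compose2[OF g]) (auto intro: continuous_intros)
  have Pc: "continuous_on S ?P" for S by (rule continuous_on_poisson_kernel[OF r])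
  have P'c: "continuous_on S P'" for S
    unfolding P'_def using den by (intro continuous_intros) (metis less_irrefl zero_eq_power2)
  have Pd: "(?P has_real_derivative P' s) (at s within S)" for s S
    unfolding poisson_kernel_def[abs_def] P'_def
    by (rule derivative_eq_intros refl | use den[of s] in \<open>force simp: power2_eq_square\<close>)+
  \<comment> \<open>Nonnegative by the hypothesis on the averages, and zero at the origin.\<close>
  define H where "H s = 2 * L * s - integral {-s..s} g" for s
  have Hd: "(H has_real_derivative (2 * L - g s - g (- s))) (at s within {0..pi})" if s: "s \<in> {0..pi}" for s
  proof -
    have split: "integral {-u..u} g = integral {0..u} (\<lambda>v. g (- v)) + integral {0..u} g"
      if "u \<in> {0..pi}" for u
    proof -
      have "integral {-u..0} g + integral {0..u} g = integral {-u..u} g"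
        by (rule Henstock_Kurzweil_Integration.integral_combine)
           (use that in \<open>auto intro!: integrable_continuous_real gI\<close>)
      moreover have "integral {-u..0} g = integral {0..u} (\<lambda>v. g (- v))"
        using Henstock_Kurzweil_Integration.integral_reflect_real[of u 0 "\<lambda>v. g (- v)"] by simp
      ultimately show ?thesis by simp
    qed
    have deriv: "((\<lambda>u. 2 * L * u - (integral {0..u} (\<lambda>v. g (- v)) + integral {0..u} g)) has_real_derivative
        (2 * L - (g (- s) + g s))) (at s within {0..pi})"
      by (rule derivative_eq_intros integral_has_real_derivative[OF gI s]
          integral_has_real_derivative[OF gm s] refl | simp)+
    have "(H has_real_derivative (2 * L - (g (- s) + g s))) (at s within {0..pi})"
      by (rule has_field_derivative_transform_within[OF deriv zero_less_one s])
         (use split in \<open>simp add: H_def\<close>)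
    then show ?thesis by (simp add: algebra_simps)
  qed
  have Hc: "continuous_on {0..pi} H"
    by (rule DERIV_continuous_on) (rule Hd)
  have H0: "0 \<le> H s" if "s \<in> {0..pi}" for s
    using avg[of s] that by (cases "s = 0") (auto simp: H_def mult_ac)
  have "((\<lambda>s. P' s * H s + (2 * L - g s - g (- s)) * ?P s) has_integral (?P pi * H pi - ?P 0 * H 0)) {0..pi}"
    by (rule fundamental_theorem_of_calculus)
       (auto simp flip: has_real_derivative_iff_has_vector_derivative intro!: DERIV_mult Pd Hd)
  then have "integral {0..pi} (\<lambda>s. P' s * H s + (2 * L - g s - g (- s)) * ?P s) = ?P pi * H pi"
    by (simp add: integral_unique H_def)
  also have "integral {0..pi} (\<lambda>s. P' s * H s + (2 * L - g s - g (- s)) * ?P s) =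
      integral {0..pi} (\<lambda>s. P' s * H s) + integral {0..pi} (\<lambda>s. (2 * L - g s - g (- s)) * ?P s)"
    by (intro integral_add integrable_continuous_real continuous_intros P'c Hc Pc gI gm)
  \<comment> \<open>Integration by parts; the boundary term at the origin vanishes.\<close>
  finally have parts: "integral {0..pi} (\<lambda>s. (2 * L - g s - g (- s)) * ?P s) =
      ?P pi * H pi - integral {0..pi} (\<lambda>s. P' s * H s)" by simp
  have "integral {0..pi} (\<lambda>s. P' s * H s) \<le> integral {0..pi} (\<lambda>s. 0)"
  proof (intro integral_le integrable_continuous_real continuous_intros P'c Hc)
    fix s assume s: "s \<in> {0..pi}"
    have "0 \<le> (1 - r\<^sup>2) * (2 * r * sin s)"
      using r s by (intro mult_nonneg_nonneg sin_ge_zero) (auto simp: abs_square_le_1)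
    then have "P' s \<le> 0" unfolding P'_def by (intro divide_nonpos_nonneg) auto
    then show "P' s * H s \<le> 0" using H0[OF s] by (rule mult_nonpos_nonneg)
  qed
  moreover have "0 \<le> ?P pi * H pi"
    using poisson_kernel_pos[OF r, of pi] H0[of pi] by simp
  ultimately have "0 \<le> integral {0..pi} (\<lambda>s. (2 * L - g s - g (- s)) * ?P s)"
    unfolding parts by simp
  also have "\<dots> = integral {0..pi} (\<lambda>s. 2 * L * ?P s - (?P s * g s + ?P s * g (- s)))"
    by (simp add: algebra_simps)
  also have "\<dots> = integral {0..pi} (\<lambda>s. 2 * L * ?P s) - integral {0..pi} (\<lambda>s. ?P s * g s + ?P s * g (- s))"
    by (intro integral_diff integrable_continuous_real continuous_intros Pc gI gm)
  also have "integral {0..pi} (\<lambda>s. 2 * L * ?P s) = 2 * L * integral {0..pi} ?P" by simp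
  also have even: "integral {0..pi} (\<lambda>s. ?P s * h s + ?P s * h (- s)) = integral {-pi..pi} (\<lambda>s. ?P s * h s)"
    if h: "continuous_on UNIV h" for h
  proof -
    have hI: "continuous_on S h" for S by (rule continuous_on_subset[OF h]) simp
    have hm: "continuous_on S (\<lambda>s. h (- s))" for S
      by (rule continuous_on_compose2[OF h]) (auto intro: continuous_intros)
    have "integral {-pi..pi} (\<lambda>s. ?P s * h s) =
        integral {-pi..0} (\<lambda>s. ?P s * h s) + integral {0..pi} (\<lambda>s. ?P s * h s)"
      by (rule Henstock_Kurzweil_Integration.integral_combine[symmetric])
         (auto intro!: integrable_continuous_real continuous_intros Pc hI)
    also have "integral {-pi..0} (\<lambda>s. ?P s * h s) = integral {0..pi} (\<lambda>s. ?P s * h (- s))"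
      using Henstock_Kurzweil_Integration.integral_reflect_real[of pi 0 "\<lambda>s. ?P s * h (- s)"] by (simp add: poisson_kernel_def)
    also have "integral {0..pi} (\<lambda>s. ?P s * h (- s)) + integral {0..pi} (\<lambda>s. ?P s * h s) =
        integral {0..pi} (\<lambda>s. ?P s * h s + ?P s * h (- s))"
      by (subst integral_add) (auto intro!: integrable_continuous_real continuous_intros Pc hI hm)
    finally show ?thesis by simp
  qed
  note even[OF g]
  also have "integral {0..pi} ?P = pi"
    using even[of "\<lambda>_. 1"] integral_poisson_kernel[OF r]
    by (simp add: integral_mult_right flip: mult_2)
  finally show ?thesis by (simp add: mult_ac)
qed

section \<open>Radial limits on a slice\<close>

lemma set_integral_mono_nonneg_subset:
  fixes g :: "'a \<Rightarrow> real"
  assumes "A \<subseteq> B" "A \<in> sets M" "set_integrable M B g" "\<And>x. 0 \<le> g x"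
  shows "(LINT x:A|M. g x) \<le> (LINT x:B|M. g x)"
  using set_integrable_subset[OF assms(3,2,1)] assms(3)
  unfolding set_lebesgue_integral_def set_integrable_def
  by (rule integral_mono) (use assms in \<open>auto simp: indicator_def\<close>)

lemma emeasure_countable_UN_le:
  assumes C: "countable C" and B: "\<And>i. i \<in> C \<Longrightarrow> B i \<in> sets M"
    and le: "\<And>F. finite F \<Longrightarrow> F \<subseteq> C \<Longrightarrow> emeasure M (\<Union>i\<in>F. B i) \<le> K"
  shows "emeasure M (\<Union>i\<in>C. B i) \<le> K"
proof (cases "C = {}")
  case False
  define U where "U n = (\<Union>i\<in>from_nat_into C ` {..<n}. B i)" for n
  have sub: "from_nat_into C ` {..<n} \<subseteq> C" for n using from_nat_into[OF False] by auto
  have "(\<Union>i\<in>C. B i) = (\<Union>n. U n)"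
  proof (intro subset_antisym UN_least)
    fix i assume "i \<in> C"
    then obtain n where "i = from_nat_into C n" by (metis C from_nat_into_surj)
    then have "B i \<subseteq> U (Suc n)" by (auto simp: U_def)
    then show "B i \<subseteq> (\<Union>n. U n)" by blast
  next
    show "U n \<subseteq> (\<Union>i\<in>C. B i)" for n using sub[of n] unfolding U_def by blast
  qed
  moreover have "range U \<subseteq> sets M"
    unfolding U_def using sub B by (fastforce intro!: sets.finite_UN)
  moreover have "incseq U" unfolding U_def by (intro incseq_SucI UN_mono image_mono) auto
  ultimately have "emeasure M (\<Union>i\<in>C. B i) = (SUP n. emeasure M (U n))"
    by (simp add: SUP_emeasure_incseq)
  also have "\<dots> \<le> K" unfolding U_def by (intro SUP_least le sub) auto
  finally show ?thesis .
qed (use le[of "{}"] in simp)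

definition radius_seq :: "nat \<Rightarrow> real" where
  "radius_seq n = 1 - 1 / real (n + 2)"

lemma radius_seq_bounds: "0 < radius_seq n" "radius_seq n < 1"
  by (simp_all add: radius_seq_def)

lemma radius_seq_mono: "m \<le> n \<Longrightarrow> radius_seq m \<le> radius_seq n"
  unfolding radius_seq_def by (intro diff_left_mono divide_left_mono) auto

lemma radius_seq_LIMSEQ: "radius_seq \<longlonglongrightarrow> 1"
proof -
  have "(\<lambda>n. 1 / real (n + 2)) \<longlonglongrightarrow> 0"
    using LIMSEQ_ignore_initial_segment[OF lim_1_over_n, of 2] by simp
  then have "radius_seq \<longlonglongrightarrow> 1 - 0" unfolding radius_seq_def by (intro tendsto_intros)
  then show ?thesis by simp
qed

lemma filterlim_radius_seq: "filterlim radius_seq (at_left 1) sequentially"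
  unfolding filterlim_at using radius_seq_LIMSEQ radius_seq_bounds
  by (auto intro!: always_eventually simp: less_imp_neq)

lemma le_half_square_add:
  fixes x t :: real
  assumes "0 < t" shows "x \<le> x\<^sup>2 / (2 * t) + t / 2"
proof -
  have "0 \<le> (x - t)\<^sup>2" by simp
  then show ?thesis using assms by (simp add: field_simps power2_eq_square)
qed

text \<open>
  The arithmetic-geometric mean inequality, termwise, replaces the Cauchy-Schwarz inequality.
\<close>
lemma summable_dilate:
  fixes c :: "nat \<Rightarrow> quat"
  assumes c: "summable (\<lambda>n. (norm (c n))\<^sup>2)" and r: "0 \<le> r" "r < 1"
  shows "summable (\<lambda>n. norm (of_real (r ^ n) * c n))"
proof (rule summable_comparison_test'[of _ 0])
  have "r\<^sup>2 < 1" using r by (simp add: abs_square_less_1)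
  then show "summable (\<lambda>n. ((r\<^sup>2) ^ n + (norm (c n))\<^sup>2) / 2)"
    by (intro summable_divide summable_add c summable_geometric) auto
  show "norm (norm (of_real (r ^ n) * c n)) \<le> ((r\<^sup>2) ^ n + (norm (c n))\<^sup>2) / 2" for n
  proof -
    have "0 \<le> (r ^ n - norm (c n))\<^sup>2" by simp
    then have "r ^ n * norm (c n) \<le> ((r ^ n)\<^sup>2 + (norm (c n))\<^sup>2) / 2"
      by (simp add: power2_diff)
    also have "(r ^ n)\<^sup>2 = (r\<^sup>2) ^ n" by (simp flip: power_mult add: mult.commute)
    finally show ?thesis using r by (simp add: norm_mult norm_power)
  qed
qed

text \<open>
  The Cauchy criterion for a one-sided limit.
\<close>
lemma convergent_at_left_oneI:
  fixes F :: "real \<Rightarrow> 'a :: complete_space"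
  assumes cauchy: "\<And>\<epsilon>. 0 < \<epsilon> \<Longrightarrow> \<exists>\<delta><1. \<forall>r\<in>{\<delta><..<1}. \<forall>s\<in>{\<delta><..<1}. dist (F r) (F s) < \<epsilon>"
  shows "\<exists>l. (F \<longlongrightarrow> l) (at_left 1)"
proof -
  let ?u = radius_seq
  have ev: "eventually (\<lambda>n. ?u n \<in> {\<delta><..<1}) sequentially" if "\<delta> < 1" for \<delta>
    using eventually_at_left_real[OF that] filterlim_radius_seq by (rule eventually_compose_filterlim)
  have "Cauchy (\<lambda>n. F (?u n))"
  proof (rule metric_CauchyI)
    fix \<epsilon> :: real assume "0 < \<epsilon>"
    from cauchy[OF this] obtain \<delta> where \<delta>: "\<delta> < 1"
      "\<And>r s. r \<in> {\<delta><..<1} \<Longrightarrow> s \<in> {\<delta><..<1} \<Longrightarrow> dist (F r) (F s) < \<epsilon>" by blast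
    from ev[OF \<delta>(1)] obtain M where "\<And>n. M \<le> n \<Longrightarrow> ?u n \<in> {\<delta><..<1}"
      by (auto simp: eventually_sequentially)
    then show "\<exists>M. \<forall>m\<ge>M. \<forall>n\<ge>M. dist (F (?u m)) (F (?u n)) < \<epsilon>" using \<delta>(2) by blast
  qed
  then obtain l where l: "(\<lambda>n. F (?u n)) \<longlonglongrightarrow> l" using Cauchy_convergent convergent_def by blast
  have "(F \<longlongrightarrow> l) (at_left 1)"
  proof (rule tendstoI)
    fix \<epsilon> :: real assume "0 < \<epsilon>"
    then obtain \<delta> where \<delta>: "\<delta> < 1"
      "\<And>r s. r \<in> {\<delta><..<1} \<Longrightarrow> s \<in> {\<delta><..<1} \<Longrightarrow> dist (F r) (F s) < \<epsilon> / 2"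
      using cauchy[of "\<epsilon> / 2"] by auto
    have "dist (F r) l < \<epsilon>" if r: "r \<in> {\<delta><..<1}" for r
    proof -
      have "dist (F r) l \<le> \<epsilon> / 2"
      proof (rule tendsto_upperbound)
        show "(\<lambda>n. dist (F r) (F (?u n))) \<longlonglongrightarrow> dist (F r) l" by (intro tendsto_intros l)
        show "eventually (\<lambda>n. dist (F r) (F (?u n)) \<le> \<epsilon> / 2) sequentially"
          using ev[OF \<delta>(1)] by eventually_elim (use \<delta>(2)[OF r] in \<open>simp add: less_imp_le\<close>)
      qed simp
      with \<open>0 < \<epsilon>\<close> show ?thesis by simp
    qed
    moreover have "eventually (\<lambda>r. r \<in> {\<delta><..<1}) (at_left 1)"
      using \<delta>(1) by (rule eventually_at_left_real)
    ultimately show "eventually (\<lambda>r. dist (F r) l < \<epsilon>) (at_left 1)"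
      by (auto elim: eventually_mono)
  qed
  then show ?thesis ..
qed

context
  fixes I :: quat assumes I: "I \<in> imag_units"
begin

text \<open>
  A superlevel set of the radial maximal function.
\<close>
definition radial_exceeds :: "(nat \<Rightarrow> quat) \<Rightarrow> real \<Rightarrow> real \<Rightarrow> real set" where
  "radial_exceeds c R L =
    {t \<in> {-pi..pi}. \<exists>r\<in>{0..<R}. L < norm (qseries c (of_real r * slice_embed I (cis t)))}"

lemma radial_exceeds_measurable:
  assumes c: "\<And>r. 0 \<le> r \<Longrightarrow> r < R \<Longrightarrow> summable (\<lambda>n. norm (of_real (r ^ n) * c n))"
  shows "radial_exceeds c R L \<in> sets borel"
proof -
  have "open {t. L < norm (qseries c (of_real r * slice_embed I (cis t)))}" if r: "r \<in> {0..<R}" for r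
    unfolding qseries_dilate
    by (intro open_Collect_less continuous_intros continuous_on_compose2[OF continuous_on_qseries]
        slice_embed_cis_continuous c)
       (use r in \<open>auto simp: norm_slice_embed[OF I]\<close>)
  then have "open (\<Union>r\<in>{0..<R}. {t. L < norm (qseries c (of_real r * slice_embed I (cis t)))})"
    by blast
  then have "{-pi..pi} \<inter> (\<Union>r\<in>{0..<R}. {t. L < norm (qseries c (of_real r * slice_embed I (cis t)))}) \<in> sets borel"
    by (intro sets.Int[OF _ borel_open]) auto
  also have "{-pi..pi} \<inter> (\<Union>r\<in>{0..<R}. {t. L < norm (qseries c (of_real r * slice_embed I (cis t)))}) =
      radial_exceeds c R L"
    by (auto simp: radial_exceeds_def)
  finally show ?thesis .
qed

text \<open>
  Cauchy-Schwarz on the circle, in the form \<open>x \<le> x\<^sup>2 / (2 N) + N / 2\<close>; this is why \<open>N\<close> is a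
  positive bound instead of the norm itself.
\<close>
lemma integral_norm_qseries_circle_le:
  assumes c: "summable (\<lambda>n. norm (c n))" and N: "0 < N" "(\<Sum>n. (norm (c n))\<^sup>2) \<le> N\<^sup>2"
  shows "(LINT t:{a..a + 2 * pi}|lborel. norm (qseries c (slice_embed I (cis t)))) \<le> 2 * pi * N"
proof -
  let ?g = "\<lambda>t. norm (qseries c (slice_embed I (cis t)))"
  have gc: "continuous_on S ?g" for S
    by (intro continuous_intros continuous_on_compose2[OF continuous_on_qseries[OF c]]
        slice_embed_cis_continuous) (auto simp: norm_slice_embed[OF I])
  have int: "set_integrable lborel {a..a + 2 * pi} ?g"
    "set_integrable lborel {a..a + 2 * pi} (\<lambda>t. (?g t)\<^sup>2 / (2 * N) + N / 2)"
    "set_integrable lborel {a..a + 2 * pi} (\<lambda>t. (?g t)\<^sup>2 / (2 * N))"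
    "set_integrable lborel {a..a + 2 * pi} (\<lambda>t. N / 2)"
    using N by (auto intro!: borel_integrable_atLeastAtMost' continuous_intros gc)
  have "(LINT t:{a..a + 2 * pi}|lborel. ?g t) \<le>
      (LINT t:{a..a + 2 * pi}|lborel. (?g t)\<^sup>2 / (2 * N) + N / 2)"
    by (intro set_integral_mono int le_half_square_add N)
  also have "\<dots> = (LINT t:{a..a + 2 * pi}|lborel. (?g t)\<^sup>2) / (2 * N) + 2 * pi * (N / 2)"
    by (subst set_integral_add) (use int in \<open>auto simp: set_lebesgue_integral_def\<close>)
  also have "(LINT t:{a..a + 2 * pi}|lborel. (?g t)\<^sup>2) = 2 * pi * (\<Sum>n. (norm (c n))\<^sup>2)"
    by (rule circle_parseval_norm[OF I c])
  also have "2 * pi * (\<Sum>n. (norm (c n))\<^sup>2) / (2 * N) + 2 * pi * (N / 2) \<le>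
      2 * pi * N\<^sup>2 / (2 * N) + 2 * pi * (N / 2)"
    using N by (intro add_right_mono divide_right_mono mult_left_mono) auto
  also have "\<dots> = 2 * pi * N" using N by (simp add: field_simps power2_eq_square)
  finally show ?thesis .
qed

text \<open>
  The weak-type inequality. If the radial maximal function exceeds \<open>L\<close> at \<open>t\<close>, then so does the
  average of \<open>|f|\<close> over some interval centred at \<open>t\<close>, by the previous bound on Poisson averages. The
  Vitali lemma selects disjoint intervals of this kind whose fivefold enlargements still
  cover, and the integrals of \<open>|f|\<close> over them add up to at most its integral over \<open>[-2 \<pi>, 2 \<pi>]\<close>,
  two full circles.
\<close>
lemma maximal_inequality_closed_disc:
  assumes c: "summable (\<lambda>n. norm (c n))" and N: "0 < N" "(\<Sum>n. (norm (c n))\<^sup>2) \<le> N\<^sup>2" and L: "0 < L"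
  shows "emeasure lborel (radial_exceeds c 1 L) \<le> ennreal (20 * pi * N / L)"
proof -
  let ?g = "\<lambda>t. norm (qseries c (slice_embed I (cis t)))"
  let ?A = "radial_exceeds c 1 L"
  have fc: "continuous_on S (\<lambda>t. qseries c (slice_embed I (cis t)))" for S
    by (intro continuous_on_compose2[OF continuous_on_qseries[OF c]]
        slice_embed_cis_continuous) (auto simp: norm_slice_embed[OF I])
  have gc: "continuous_on S ?g" for S by (intro continuous_intros fc)
  have gint: "set_integrable lborel {a..b} ?g" for a b
    by (intro borel_integrable_atLeastAtMost' gc)
  have fsc: "continuous_on S (\<lambda>s. qseries c (slice_embed I (cis (s + t))))" for S t
    by (rule continuous_on_compose2[OF fc[of UNIV]]) (auto intro!: continuous_intros)
  have gsc: "continuous_on S (\<lambda>s. ?g (s + t))" for S t by (intro continuous_intros fsc)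
  have "\<exists>\<sigma>. 0 < \<sigma> \<and> \<sigma> \<le> pi \<and> 2 * \<sigma> * L < (LINT s:{t - \<sigma>..t + \<sigma>}|lborel. ?g s)" if "t \<in> ?A" for t
  proof (rule ccontr)
    assume neg: "\<not> ?thesis"
    from that obtain r where r: "0 \<le> r" "r < 1"
      and big: "L < norm (qseries c (of_real r * slice_embed I (cis t)))"
      by (auto simp: radial_exceeds_def)
    have avg: "integral {-\<sigma>..\<sigma>} (\<lambda>s. ?g (s + t)) \<le> 2 * \<sigma> * L" if "0 < \<sigma>" "\<sigma> \<le> pi" for \<sigma>
    proof -
      have "integral {-\<sigma>..\<sigma>} (\<lambda>s. ?g (s + t)) = integral {t - \<sigma>..t + \<sigma>} ?g"
        using integral_shift_real_ivl[of "t - \<sigma>" t "t + \<sigma>" ?g] by simp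
      also have "\<dots> = (LINT s:{t - \<sigma>..t + \<sigma>}|lborel. ?g s)"
        by (rule set_borel_integral_eq_integral(2)[OF gint, symmetric])
      also have "\<dots> \<le> 2 * \<sigma> * L" using neg that by (meson not_less)
      finally show ?thesis .
    qed
    let ?F = "\<lambda>s. poisson_kernel r s *\<^sub>R qseries c (slice_embed I (cis (s + t)))"
    have Fc: "continuous_on S ?F" for S
      by (intro continuous_intros fsc continuous_on_poisson_kernel r)
    have Fint: "set_integrable lborel {-pi..pi} ?F"
      by (intro borel_integrable_atLeastAtMost' Fc)
    have "norm (LINT s:{-pi..pi}|lborel. ?F s) = norm (integral {-pi..pi} ?F)"
      by (simp add: set_borel_integral_eq_integral(2)[OF Fint])
    also have "\<dots> \<le> integral {-pi..pi} (\<lambda>s. poisson_kernel r s * ?g (s + t))"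
      using poisson_kernel_pos[OF r]
      by (intro integral_norm_bound_integral integrable_continuous_real Fc continuous_intros gsc
          continuous_on_poisson_kernel r) (auto simp: less_imp_le)
    also have "\<dots> \<le> 2 * pi * L"
      by (rule poisson_average_le[OF r gsc avg])
    finally have "norm (qseries c (of_real r * slice_embed I (cis t))) \<le> L"
      unfolding poisson_formula[OF I c r] by (simp add: field_simps)
    with big show False by simp
  qed
  then have "\<exists>\<sigma>. \<forall>t\<in>?A. 0 < \<sigma> t \<and> \<sigma> t \<le> pi \<and> 2 * \<sigma> t * L < (LINT s:{t - \<sigma> t..t + \<sigma> t}|lborel. ?g s)"
    by (intro bchoice) blast
  then obtain \<sigma> where \<sigma>: "\<And>t. t \<in> ?A \<Longrightarrow> 0 < \<sigma> t \<and> \<sigma> t \<le> pi"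
    and large: "\<And>t. t \<in> ?A \<Longrightarrow> 2 * \<sigma> t * L < (LINT s:{t - \<sigma> t..t + \<sigma> t}|lborel. ?g s)"
    by blast
  have self: "?A \<subseteq> (\<Union>t\<in>?A. cball t (\<sigma> t))"
  proof
    fix t assume t: "t \<in> ?A"
    then have "t \<in> cball t (\<sigma> t)" using \<sigma>[of t] by simp
    with t show "t \<in> (\<Union>t\<in>?A. cball t (\<sigma> t))" by blast
  qed
  obtain C where C: "countable C" "C \<subseteq> ?A"
    and disj: "pairwise (\<lambda>i j. disjnt (cball i (\<sigma> i)) (cball j (\<sigma> j))) C"
    and cover: "?A \<subseteq> (\<Union>i\<in>C. cball i (5 * \<sigma> i))"
    by (rule Vitali_covering_lemma_cballs[where S = ?A and K = ?A and a = "\<lambda>t. t" and r = \<sigma> and B = pi,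
          OF self \<sigma>]) assumption
  have "emeasure lborel ?A \<le> emeasure lborel (\<Union>i\<in>C. cball i (5 * \<sigma> i))"
    by (rule emeasure_mono[OF cover]) (use C in \<open>auto intro!: sets.countable_UN'\<close>)
  also have "\<dots> \<le> ennreal (20 * pi * N / L)"
  proof (rule emeasure_countable_UN_le[OF C(1)])
    fix F assume F: "finite F" "F \<subseteq> C"
    have FA: "i \<in> ?A" if "i \<in> F" for i using F C that by blast
    have disjF: "disjoint_family_on (\<lambda>i. {i - \<sigma> i..i + \<sigma> i}) F"
      unfolding disjoint_family_on_def
      using disj F by (auto simp: pairwise_def disjnt_def cball_eq_atLeastAtMost subset_iff)
    have "emeasure lborel (\<Union>i\<in>F. cball i (5 * \<sigma> i)) \<le> (\<Sum>i\<in>F. emeasure lborel (cball i (5 * \<sigma> i)))"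
      by (rule emeasure_subadditive_finite) (use F in auto)
    also have "\<dots> = (\<Sum>i\<in>F. ennreal (10 * \<sigma> i))"
    proof (rule sum.cong[OF refl])
      fix i assume "i \<in> F"
      then have "0 < \<sigma> i" using \<sigma>[OF FA] by blast
      then show "emeasure lborel (cball i (5 * \<sigma> i)) = ennreal (10 * \<sigma> i)"
        by (simp add: cball_eq_atLeastAtMost)
    qed
    also have "\<dots> = ennreal (\<Sum>i\<in>F. 10 * \<sigma> i)"
      using \<sigma>[OF FA] by (intro sum_ennreal) (auto simp: less_imp_le)
    also have "\<dots> \<le> ennreal (20 * pi * N / L)"
    proof (rule ennreal_leI)
      have "(\<Sum>i\<in>F. 10 * \<sigma> i) * L = 5 * (\<Sum>i\<in>F. 2 * \<sigma> i * L)"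
        by (simp add: sum_distrib_left sum_distrib_right mult_ac)
      also have "\<dots> \<le> 5 * (\<Sum>i\<in>F. LINT s:{i - \<sigma> i..i + \<sigma> i}|lborel. ?g s)"
        using large[OF FA] by (intro mult_left_mono sum_mono) (auto simp: less_imp_le)
      also have "(\<Sum>i\<in>F. LINT s:{i - \<sigma> i..i + \<sigma> i}|lborel. ?g s) =
          (LINT s:(\<Union>i\<in>F. {i - \<sigma> i..i + \<sigma> i})|lborel. ?g s)"
        using F disjF gint by (intro set_integral_finite_Union[symmetric]) auto
      also have "\<dots> \<le> (LINT s:{-2 * pi..2 * pi}|lborel. ?g s)"
      proof (rule set_integral_mono_nonneg_subset)
        show "(\<Union>i\<in>F. {i - \<sigma> i..i + \<sigma> i}) \<subseteq> {-2 * pi..2 * pi}"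
        proof (rule UN_least)
          fix i assume "i \<in> F"
          then show "{i - \<sigma> i..i + \<sigma> i} \<subseteq> {-2 * pi..2 * pi}"
            using \<sigma>[OF FA, of i] FA[of i] by (auto simp: radial_exceeds_def)
        qed
      qed (use F gint in auto)
      also have "\<dots> = (LINT s:{-2 * pi..-2 * pi + 2 * pi}|lborel. ?g s) + (LINT s:{0..0 + 2 * pi}|lborel. ?g s)"
        unfolding set_borel_integral_eq_integral(2)[OF gint]
        using Henstock_Kurzweil_Integration.integral_combine[of "-2 * pi" 0 "2 * pi" ?g]
        by (simp add: integrable_continuous_real gc)
      also have "\<dots> \<le> 2 * pi * N + 2 * pi * N"
        by (intro add_mono integral_norm_qseries_circle_le c N)
      finally show "(\<Sum>i\<in>F. 10 * \<sigma> i) \<le> 20 * pi * N / L"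
        using L by (simp add: field_simps)
    qed
    finally show "emeasure lborel (\<Union>i\<in>F. cball i (5 * \<sigma> i)) \<le> ennreal (20 * pi * N / L)" .
  qed auto
  finally show ?thesis .
qed

text \<open>
  The bound for dilates does not depend on the radius, so it survives the increasing union over
  radii tending to \<open>1\<close>.
\<close>
lemma maximal_inequality:
  assumes c: "summable (\<lambda>n. (norm (c n))\<^sup>2)" and N: "0 < N" "(\<Sum>n. (norm (c n))\<^sup>2) \<le> N\<^sup>2" and L: "0 < L"
  shows "emeasure lborel (radial_exceeds c 1 L) \<le> ennreal (20 * pi * N / L)"
proof -
  let ?R = radius_seq
  have R: "0 \<le> ?R k" "?R k < 1" for k using radius_seq_bounds[of k] by simp_all
  have sub: "radial_exceeds c (?R k) L \<subseteq> radial_exceeds (\<lambda>n. of_real (?R k ^ n) * c n) 1 L" for k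
  proof
    fix t assume "t \<in> radial_exceeds c (?R k) L"
    then obtain r where t: "t \<in> {-pi..pi}" and r: "0 \<le> r" "r < ?R k"
      and big: "L < norm (qseries c (of_real r * slice_embed I (cis t)))"
      by (auto simp: radial_exceeds_def)
    have "qseries (\<lambda>n. of_real (?R k ^ n) * c n) (of_real (r / ?R k) * slice_embed I (cis t)) =
        qseries c (of_real (?R k) * (of_real (r / ?R k) * slice_embed I (cis t)))"
      by (rule qseries_dilate[symmetric])
    also have "of_real (?R k) * (of_real (r / ?R k) * slice_embed I (cis t)) =
        of_real (?R k * (r / ?R k)) * slice_embed I (cis t)"
      by (simp only: of_real_mult mult.assoc)
    also have "?R k * (r / ?R k) = r" using r by simp
    finally have "qseries c (of_real r * slice_embed I (cis t)) =
        qseries (\<lambda>n. of_real (?R k ^ n) * c n) (of_real (r / ?R k) * slice_embed I (cis t))" ..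
    with big r t show "t \<in> radial_exceeds (\<lambda>n. of_real (?R k ^ n) * c n) 1 L"
      by (auto simp: radial_exceeds_def intro!: bexI[of _ "r / ?R k"])
  qed
  have "radial_exceeds c 1 L = (\<Union>k. radial_exceeds c (?R k) L)"
  proof (intro subset_antisym UN_least subsetI)
    fix t assume "t \<in> radial_exceeds c 1 L"
    then obtain r where t: "t \<in> {-pi..pi}" and r: "0 \<le> r" "r < 1"
      and big: "L < norm (qseries c (of_real r * slice_embed I (cis t)))"
      by (auto simp: radial_exceeds_def)
    obtain k where "r < ?R k"
      using order_tendstoD(1)[OF radius_seq_LIMSEQ r(2)] by (auto simp: eventually_sequentially)
    with t r big show "t \<in> (\<Union>k. radial_exceeds c (?R k) L)"
      by (auto simp: radial_exceeds_def intro!: exI[of _ k] bexI[of _ r])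
  next
    fix k t assume "t \<in> radial_exceeds c (?R k) L"
    then show "t \<in> radial_exceeds c 1 L"
      using R(2)[of k] by (auto simp: radial_exceeds_def intro: less_trans)
  qed
  moreover have "range (\<lambda>k. radial_exceeds c (?R k) L) \<subseteq> sets lborel"
    using R by (auto intro!: radial_exceeds_measurable summable_dilate[OF c] intro: less_trans)
  moreover have "incseq (\<lambda>k. radial_exceeds c (?R k) L)"
    using radius_seq_mono by (fastforce simp: incseq_def radial_exceeds_def)
  ultimately have "emeasure lborel (radial_exceeds c 1 L) = (SUP k. emeasure lborel (radial_exceeds c (?R k) L))"
    by (simp add: SUP_emeasure_incseq)
  also have "\<dots> \<le> ennreal (20 * pi * N / L)"
  proof (rule SUP_least)
    fix k
    have sR: "summable (\<lambda>n. norm (of_real (?R k ^ n) * c n))" by (rule summable_dilate[OF c R])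
    have le: "(norm (of_real (?R k ^ n) * c n))\<^sup>2 \<le> (norm (c n))\<^sup>2" for n
      using R[of k] by (intro power_mono) (simp_all add: norm_mult norm_power mult_left_le_one_le power_le_one)
    have sq: "summable (\<lambda>n. (norm (of_real (?R k ^ n) * c n))\<^sup>2)"
      by (rule summable_comparison_test'[OF c, of 0]) (use le in simp)
    have "(\<Sum>n. (norm (of_real (?R k ^ n) * c n))\<^sup>2) \<le> (\<Sum>n. (norm (c n))\<^sup>2)"
      by (intro suminf_le le c sq)
    with N(2) have "(\<Sum>n. (norm (of_real (?R k ^ n) * c n))\<^sup>2) \<le> N\<^sup>2" by simp
    from maximal_inequality_closed_disc[OF sR N(1) this L]
    have "emeasure lborel (radial_exceeds (\<lambda>n. of_real (?R k ^ n) * c n) 1 L) \<le> ennreal (20 * pi * N / L)" .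
    moreover have "radial_exceeds (\<lambda>n. of_real (?R k ^ n) * c n) 1 L \<in> sets lborel"
      unfolding sets_lborel by (rule radial_exceeds_measurable) (rule summable_dilate[OF sq])
    ultimately show "emeasure lborel (radial_exceeds c (?R k) L) \<le> ennreal (20 * pi * N / L)"
      by (intro order_trans[OF emeasure_mono[OF sub]])
  qed
  finally show ?thesis .
qed

text \<open>
  Where the limit fails to exist, the oscillation near radius \<open>1\<close> exceeds some \<open>1 / (k + 1)\<close>. A
  polynomial has no oscillation in the limit, so the radial maximal function of every tail of the
  series is at least comparable to this number there. The maximal inequality bounds the measure of
  such a set by a multiple of the norm of the tail, which tends to \<open>0\<close>.
\<close>
lemma fatou_radial_limit:
  assumes c: "summable (\<lambda>n. (norm (c n))\<^sup>2)"
  shows "AE t in lborel. t \<in> {-pi..pi} \<longrightarrow>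
    (\<exists>l. ((\<lambda>r. qseries c (of_real r * slice_embed I (cis t))) \<longlongrightarrow> l) (at_left 1))"
proof -
  \<comment> \<open>Shifting indices would change the powers, so the tail keeps its place and is padded with zeros.\<close>
  define tail where "tail N n = (if n < N then 0 else c n)" for N n
  have tail: "summable (\<lambda>n. (norm (tail N n))\<^sup>2)" for N
    by (rule summable_comparison_test'[OF c, of 0]) (simp add: tail_def)
  have tail_sum: "(\<Sum>n. (norm (tail N n))\<^sup>2) = (\<Sum>n. (norm (c (n + N)))\<^sup>2)" for N
  proof -
    have "(\<Sum>n. (norm (tail N n))\<^sup>2) = (\<Sum>n. (norm (tail N (n + N)))\<^sup>2) + (\<Sum>n<N. (norm (tail N n))\<^sup>2)"
      by (rule suminf_split_initial_segment[OF tail])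
    then show ?thesis by (simp add: tail_def)
  qed
  have tail_lim: "(\<lambda>N. \<Sum>n. (norm (tail N n))\<^sup>2) \<longlonglongrightarrow> 0"
    unfolding tail_sum by (rule suminf_exist_split2[OF c])
  define A where "A N k = radial_exceeds (tail N) 1 (1 / real (Suc k))" for N k
  have A: "A N k \<in> sets lborel" for N k
    unfolding A_def sets_lborel by (rule radial_exceeds_measurable) (rule summable_dilate[OF tail])
  have null: "(\<Inter>N. A N k) \<in> null_sets lborel" for k
  proof (rule null_setsI)
    show "(\<Inter>N. A N k) \<in> sets lborel" using A by (intro sets.countable_INT) auto
    have "emeasure lborel (\<Inter>N. A N k) \<le> 0 + ennreal \<epsilon>" if "0 < \<epsilon>" for \<epsilon>
    proof -
      \<comment> \<open>Chosen so that the maximal inequality gives exactly \<open>\<epsilon>\<close>.\<close>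
      define \<delta> where "\<delta> = \<epsilon> / (20 * pi * real (Suc k))"
      have \<delta>: "0 < \<delta>" using that by (simp add: \<delta>_def)
      have "eventually (\<lambda>N. (\<Sum>n. (norm (tail N n))\<^sup>2) < \<delta>\<^sup>2) sequentially"
        by (rule order_tendstoD[OF tail_lim]) (use \<delta> in simp)
      then obtain N where "(\<Sum>n. (norm (tail N n))\<^sup>2) < \<delta>\<^sup>2"
        by (auto simp: eventually_sequentially)
      then have N: "(\<Sum>n. (norm (tail N n))\<^sup>2) \<le> \<delta>\<^sup>2" by simp
      have "emeasure lborel (\<Inter>N. A N k) \<le> emeasure lborel (A N k)"
        by (rule emeasure_mono) (use A in auto)
      also have "\<dots> \<le> ennreal (20 * pi * \<delta> / (1 / real (Suc k)))"
        unfolding A_def by (rule maximal_inequality[OF tail \<delta> N]) simp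
      also have "20 * pi * \<delta> / (1 / real (Suc k)) = \<epsilon>" by (simp add: \<delta>_def)
      finally show ?thesis by simp
    qed
    then have "emeasure lborel (\<Inter>N. A N k) \<le> 0" by (rule ennreal_le_epsilon)
    then show "emeasure lborel (\<Inter>N. A N k) = 0" by simp
  qed
  then have "AE t in lborel. \<forall>k. t \<notin> (\<Inter>N. A N k)"
    unfolding AE_all_countable by (blast intro: AE_not_in)
  then show ?thesis
  proof eventually_elim
    case (elim t)
    show ?case
    proof (intro impI convergent_at_left_oneI)
      fix \<epsilon> :: real assume t: "t \<in> {-pi..pi}" and "0 < \<epsilon>"
      then obtain k where k: "1 / real (Suc k) < \<epsilon> / 4"
        using reals_Archimedean[of "\<epsilon> / 4"] by (auto simp: inverse_eq_divide)
      from elim obtain N where "t \<notin> A N k" by blast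
      then have small: "norm (qseries (tail N) (of_real r * slice_embed I (cis t))) < \<epsilon> / 4"
        if "0 \<le> r" "r < 1" for r
        using t that k unfolding A_def radial_exceeds_def
        by (metis (no_types, lifting) atLeastLessThan_iff le_less_trans mem_Collect_eq not_less)
      define p where "p r = (\<Sum>n<N. (of_real r * slice_embed I (cis t)) ^ n * c n)" for r
      have split: "qseries c (of_real r * slice_embed I (cis t)) =
          p r + qseries (tail N) (of_real r * slice_embed I (cis t))" if "0 \<le> r" "r < 1" for r
      proof -
        let ?q = "of_real r * slice_embed I (cis t)"
        have "(\<lambda>n. ?q ^ n * c n) sums qseries c ?q"
        proof -
          have "(\<lambda>n. slice_embed I (cis t) ^ n * (of_real (r ^ n) * c n)) sums qseries (\<lambda>n. of_real (r ^ n) * c n) (slice_embed I (cis t))"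
            by (rule qseries_sums) (use summable_dilate[OF c that] norm_slice_embed[OF I] in auto)
          moreover have "?q ^ n * c n = slice_embed I (cis t) ^ n * (of_real (r ^ n) * c n)" for n
            by (simp add: power_mult_commuting of_real_def)
          ultimately show ?thesis by (simp add: qseries_dilate)
        qed
        moreover have "(\<lambda>n. if n \<in> {..<N} then ?q ^ n * c n else 0) sums p r"
          unfolding p_def by (rule sums_If_finite_set) simp
        ultimately have "(\<lambda>n. ?q ^ n * c n - (if n \<in> {..<N} then ?q ^ n * c n else 0)) sums (qseries c ?q - p r)"
          by (rule sums_diff)
        moreover have "?q ^ n * c n - (if n \<in> {..<N} then ?q ^ n * c n else 0) = ?q ^ n * tail N n" for n
          by (simp add: tail_def)
        ultimately have "qseries (tail N) ?q = qseries c ?q - p r"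
          unfolding qseries_def by (simp add: sums_iff)
        then show ?thesis by simp
      qed
      have "isCont p 1" unfolding p_def by (intro continuous_intros)
      then obtain d where d: "0 < d" "\<And>r. dist r 1 < d \<Longrightarrow> dist (p r) (p 1) < \<epsilon> / 4"
        using \<open>0 < \<epsilon>\<close> unfolding continuous_at_eps_delta by (metis divide_pos_pos zero_less_numeral)
      show "\<exists>\<delta><1. \<forall>r\<in>{\<delta><..<1}. \<forall>s\<in>{\<delta><..<1}.
          dist (qseries c (of_real r * slice_embed I (cis t))) (qseries c (of_real s * slice_embed I (cis t))) < \<epsilon>"
      proof (intro exI[of _ "max 0 (1 - d)"] conjI ballI)
        show "max 0 (1 - d) < 1" using d by simp
        fix r s assume rs: "r \<in> {max 0 (1 - d)<..<1}" "s \<in> {max 0 (1 - d)<..<1}"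
        have "dist (p r) (p 1) < \<epsilon> / 4" "dist (p s) (p 1) < \<epsilon> / 4"
          by (rule d(2); use rs in \<open>simp add: dist_real_def\<close>)+
        moreover have "norm (qseries (tail N) (of_real r * slice_embed I (cis t))) < \<epsilon> / 4"
          "norm (qseries (tail N) (of_real s * slice_embed I (cis t))) < \<epsilon> / 4"
          by (rule small; use rs in simp)+
        moreover have "dist (p r + x) (p s + y) \<le> dist (p r) (p 1) + dist (p s) (p 1) + norm x + norm y" for x y
          by norm
        ultimately show "dist (qseries c (of_real r * slice_embed I (cis t)))
            (qseries c (of_real s * slice_embed I (cis t))) < \<epsilon>"
          using rs by (simp add: split) (smt (verit))
      qed
    qed
  qed
qed

end

section \<open>The weighted sphere in the slope coordinate\<close>

definition quat_of_coords :: "real \<times> (real \<times> real \<times> real) \<Rightarrow> quat" where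
  "quat_of_coords = (\<lambda>(x, a, b, c). Quat x a b c)"

lemma quat_of_coords_sel [simp]:
  "qRe (quat_of_coords (x, v)) = x" "qI (quat_of_coords (x, v)) = fst v"
  "qJ (quat_of_coords (x, v)) = fst (snd v)" "qK (quat_of_coords (x, v)) = snd (snd v)"
  by (simp_all add: quat_of_coords_def split: prod.split)

lemma linear_quat_of_coords: "linear quat_of_coords"
  by (rule linearI) (auto simp: quat_of_coords_def quat_eq_iff)

lemma quat_of_coords_measurable [measurable]: "quat_of_coords \<in> borel_measurable borel"
  by (intro borel_measurable_continuous_onI linear_continuous_on
      linear_conv_bounded_linear[THEN iffD1] linear_quat_of_coords)

lemma norm_qIm_quat_of_coords: "norm (qIm (quat_of_coords (x, v))) = norm v"
  by (cases v) (simp add: norm_quat_def inner_quat_def qIm_def norm_prod_def power2_eq_square add.assoc)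

lemma norm_quat_Re_Im: "(norm q)\<^sup>2 = (qRe q)\<^sup>2 + (norm (qIm q))\<^sup>2"
  by (simp add: norm_quat_squared qIm_def)

lemma prod_Basis_quat:
  fixes f :: "quat \<Rightarrow> 'a :: comm_monoid_mult"
  shows "prod f Basis = f (Quat 1 0 0 0) * f (Quat 0 1 0 0) * f (Quat 0 0 1 0) * f (Quat 0 0 0 1)"
  by (simp add: Basis_quat_def mult.assoc)

lemma mem_box_quat:
  "q \<in> box l u \<longleftrightarrow> qRe q \<in> {qRe l<..<qRe u} \<and> qI q \<in> {qI l<..<qI u} \<and>
    qJ q \<in> {qJ l<..<qJ u} \<and> qK q \<in> {qK l<..<qK u}"
  by (auto simp: mem_box Basis_quat_def inner_quat_def)

lemma emeasure_lborel_box_quat: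
  assumes "qRe l \<le> qRe u" "qI l \<le> qI u" "qJ l \<le> qJ u" "qK l \<le> qK u"
  shows "emeasure lborel (box l u) =
    ennreal ((qRe u - qRe l) * (qI u - qI l) * (qJ u - qJ l) * (qK u - qK l))"
proof -
  have "\<And>b. b \<in> Basis \<Longrightarrow> l \<bullet> b \<le> u \<bullet> b"
    using assms by (auto simp: Basis_quat_def inner_quat_def)
  then have "emeasure lborel (box l u) = ennreal (\<Prod>b\<in>Basis. (u - l) \<bullet> b)"
    by (rule emeasure_lborel_box)
  then show ?thesis by (simp only: prod_Basis_quat) (simp add: inner_quat_def)
qed

lemma quat_Basis_le_iff:
  "(\<forall>b\<in>Basis. l \<bullet> b \<le> u \<bullet> b) \<longleftrightarrow> qRe l \<le> qRe u \<and> qI l \<le> qI u \<and> qJ l \<le> qJ u \<and> qK l \<le> qK u"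
  by (auto simp: Basis_quat_def inner_quat_def)

lemma emeasure_lborel_Times:
  fixes A :: "'a :: euclidean_space set" and B :: "'b :: euclidean_space set"
  assumes "A \<in> sets borel" "B \<in> sets borel"
  shows "emeasure lborel (A \<times> B) = emeasure lborel A * emeasure lborel B"
  unfolding lborel_prod[symmetric] using assms by (simp add: lborel.emeasure_pair_measure_Times)

lemma lborel_quat_of_coords: "distr lborel borel quat_of_coords = lborel"
proof (rule lborel_eqI[symmetric])
  fix l u :: quat assume "\<And>b. b \<in> Basis \<Longrightarrow> l \<bullet> b \<le> u \<bullet> b"
  then have le: "qRe l \<le> qRe u" "qI l \<le> qI u" "qJ l \<le> qJ u" "qK l \<le> qK u"
    using quat_Basis_le_iff[of l u] by auto
  have "quat_of_coords -` box l u =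
      {qRe l<..<qRe u} \<times> {qI l<..<qI u} \<times> {qJ l<..<qJ u} \<times> {qK l<..<qK u}"
    by (auto simp: mem_box_quat)
  then have "emeasure (distr lborel borel quat_of_coords) (box l u) =
      emeasure lborel ({qRe l<..<qRe u} \<times> {qI l<..<qI u} \<times> {qJ l<..<qJ u} \<times> {qK l<..<qK u})"
    by (simp add: emeasure_distr)
  also have "\<dots> = ennreal (qRe u - qRe l) * (ennreal (qI u - qI l) * (ennreal (qJ u - qJ l) * ennreal (qK u - qK l)))"
    using le by (simp add: emeasure_lborel_Times borel_open open_Times)
  also have "\<dots> = ennreal (\<Prod>b\<in>Basis. (u - l) \<bullet> b)"
    using le by (simp only: prod_Basis_quat) (simp add: inner_quat_def mult.assoc flip: ennreal_mult)
  finally show "emeasure (distr lborel borel quat_of_coords) (box l u) = ennreal (\<Prod>b\<in>Basis. (u - l) \<bullet> b)" .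
qed simp

lemma lborel_qcnj: "distr lborel borel qcnj = lborel"
proof (rule lborel_eqI[symmetric])
  fix l u :: quat assume "\<And>b. b \<in> Basis \<Longrightarrow> l \<bullet> b \<le> u \<bullet> b"
  then have le: "qRe l \<le> qRe u" "qI l \<le> qI u" "qJ l \<le> qJ u" "qK l \<le> qK u"
    using quat_Basis_le_iff[of l u] by auto
  have "qcnj -` box l u = box (Quat (qRe l) (- qI u) (- qJ u) (- qK u)) (Quat (qRe u) (- qI l) (- qJ l) (- qK l))"
    by (auto simp: mem_box_quat)
  then have "emeasure (distr lborel borel qcnj) (box l u) =
      ennreal ((qRe u - qRe l) * (qI u - qI l) * (qJ u - qJ l) * (qK u - qK l))"
    using le by (simp add: emeasure_distr emeasure_lborel_box_quat)
  then show "emeasure (distr lborel borel qcnj) (box l u) = ennreal (\<Prod>b\<in>Basis. (u - l) \<bullet> b)"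
    by (simp only: prod_Basis_quat) (simp add: inner_quat_def)
qed simp

text \<open>
  The cotangent of the angle \<open>t\<close> in \<open>q = |q| (cos t + J sin t)\<close>, \<open>0 < t < \<pi>\<close>. It is constant on rays, so
  it does not distinguish a point of the solid ball from its projection to the sphere.
\<close>
definition slope :: "quat \<Rightarrow> real" where
  "slope q = qRe q / norm (qIm q)"

lemma ball_sphere_measurable [measurable]:
  "ball (x :: 'a :: real_normed_vector) r \<in> sets borel" "sphere x r \<in> sets borel"
  by (simp_all flip: cball_diff_eq_sphere)

lemma slope_measurable [measurable]: "slope \<in> borel_measurable borel"
  unfolding slope_def[abs_def] by measurable

text \<open>
  At the two real points of the sphere the division by zero gives the value \<open>0\<close>, which removes them
  from the weighted measure.
\<close>
definition slice_weight :: "quat \<Rightarrow> real" where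
  "slice_weight q = indicator (sphere 0 1) q / (norm (qIm q))\<^sup>2"

lemma slice_weight_measurable [measurable]: "slice_weight \<in> borel_measurable borel"
  unfolding slice_weight_def[abs_def] by measurable

lemma slice_weight_nonneg [simp]: "0 \<le> slice_weight q"
  by (simp add: slice_weight_def)

definition slice_measure :: "quat measure" where
  "slice_measure = density sphere_measure slice_weight"

lemma sets_sphere_measure [simp, measurable_cong]:
  "sets (sphere_measure :: 'a :: euclidean_space measure) = sets borel"
  by (simp add: sphere_measure_def)

lemma sets_slice_measure [simp, measurable_cong]: "sets slice_measure = sets borel"
  by (simp add: slice_measure_def)

lemma sgn_measurable [measurable]: "(sgn :: quat \<Rightarrow> quat) \<in> borel_measurable borel"
  unfolding sgn_div_norm[abs_def] by measurable

lemma DIM_quat: "DIM(quat) = 4"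
  by (simp add: Basis_quat_def)

lemma nn_integral_slice_measure:
  assumes [measurable]: "F \<in> borel_measurable borel"
  shows "(\<integral>\<^sup>+q. F q \<partial>slice_measure) =
    4 * (\<integral>\<^sup>+x. ennreal (slice_weight (sgn x)) * F (sgn x) * indicator (ball 0 1) x \<partial>lborel)"
proof -
  have m: "(sgn :: quat \<Rightarrow> quat) \<in> measurable (restrict_space lborel (ball 0 1)) borel"
    by (rule measurable_restrict_space1) simp
  have "(\<integral>\<^sup>+q. F q \<partial>slice_measure) = (\<integral>\<^sup>+q. slice_weight q * F q \<partial>sphere_measure)"
    unfolding slice_measure_def by (rule nn_integral_density) measurable
  also have "\<dots> = 4 * (\<integral>\<^sup>+q. slice_weight q * F q
      \<partial>distr (restrict_space lborel (ball 0 1)) borel sgn)"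
    unfolding sphere_measure_def DIM_quat by (subst nn_integral_scale_measure) auto
  also have "(\<integral>\<^sup>+q. slice_weight q * F q \<partial>distr (restrict_space lborel (ball 0 1)) borel sgn) =
      (\<integral>\<^sup>+x. slice_weight (sgn x) * F (sgn x) \<partial>restrict_space lborel (ball 0 1))"
    by (subst nn_integral_distr[OF m]) auto
  also have "\<dots> = (\<integral>\<^sup>+x. ennreal (slice_weight (sgn x)) * F (sgn x) * indicator (ball 0 1) x \<partial>lborel)"
    by (rule nn_integral_restrict_space) auto
  finally show ?thesis .
qed

text \<open>
  Conjugation preserves volume, and it commutes with the projection to the sphere. This makes the
  means of the powers of \<open>q\<close> real.
\<close>
lemma distr_slice_measure_qcnj: "distr slice_measure borel qcnj = slice_measure"
proof (rule measure_eqI)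
  fix A assume "A \<in> sets (distr slice_measure borel qcnj)"
  then have A [measurable]: "A \<in> sets borel" by simp
  let ?H = "\<lambda>x. ennreal (slice_weight (sgn x)) * indicator A (sgn x) * indicator (ball 0 1) x"
  have "emeasure (distr slice_measure borel qcnj) A = (\<integral>\<^sup>+q. indicator A (qcnj q) \<partial>slice_measure)"
    by (simp add: nn_integral_distr flip: nn_integral_indicator)
  also have "\<dots> = 4 * (\<integral>\<^sup>+x. ?H (qcnj x) \<partial>lborel)"
  proof -
    have "sgn (qcnj x) = qcnj (sgn x)" for x
      by (simp add: sgn_div_norm quat_eq_iff)
    moreover have "slice_weight (qcnj x) = slice_weight x" for x
    proof -
      have "norm (qIm (qcnj x)) = norm (qIm x)" by (simp add: qIm_def norm_quat_def inner_quat_def)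
      then show ?thesis by (simp add: slice_weight_def indicator_def)
    qed
    ultimately show ?thesis
      by (subst nn_integral_slice_measure) (simp_all add: indicator_def)
  qed
  also have "(\<integral>\<^sup>+x. ?H (qcnj x) \<partial>lborel) = (\<integral>\<^sup>+x. ?H x \<partial>distr lborel borel qcnj)"
    by (subst nn_integral_distr) auto
  also have "4 * \<dots> = emeasure slice_measure A"
    unfolding lborel_qcnj by (simp add: nn_integral_slice_measure flip: nn_integral_indicator)
  finally show "emeasure (distr slice_measure borel qcnj) A = emeasure slice_measure A" .
qed simp

text \<open>
  What remains of the integration over imaginary parts after scaling. Its finiteness makes the weighted sphere a
  finite measure space.
\<close>
definition solid_moment :: ennreal where
  "solid_moment = (\<integral>\<^sup>+v. ennreal (norm v) * indicator (ball 0 1) v \<partial>(lborel :: (real \<times> real \<times> real) measure))"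

lemma solid_moment_finite: "solid_moment < \<infinity>"
proof -
  have "solid_moment \<le> (\<integral>\<^sup>+v. indicator (ball 0 1) v \<partial>(lborel :: (real \<times> real \<times> real) measure))"
    unfolding solid_moment_def
    by (rule nn_integral_mono) (auto simp: indicator_def)
  also have "\<dots> = emeasure lborel (ball 0 1 :: (real \<times> real \<times> real) set)" by simp
  also have "\<dots> < \<infinity>" using emeasure_lborel_ball_finite by simp
  finally show ?thesis .
qed

lemma solid_moment_scale:
  assumes "0 < \<rho>"
  shows "(\<integral>\<^sup>+v. ennreal (norm v) * indicator (ball 0 \<rho>) v \<partial>(lborel :: (real \<times> real \<times> real) measure)) =
    ennreal (\<rho> ^ 4) * solid_moment"
proof -
  let ?F = "\<lambda>v :: real \<times> real \<times> real. ennreal (norm v) * indicator (ball 0 \<rho>) v"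
  have affine: "(lborel :: (real \<times> real \<times> real) measure) =
      density (distr lborel borel (\<lambda>v. 0 + \<rho> *\<^sub>R v)) (\<lambda>_. ennreal (\<bar>\<rho>\<bar> ^ DIM(real \<times> real \<times> real)))"
    by (rule lborel_affine) (use assms in simp)
  have "nn_integral lborel ?F = nn_integral
      (density (distr lborel borel (\<lambda>v. 0 + \<rho> *\<^sub>R v)) (\<lambda>_. ennreal (\<bar>\<rho>\<bar> ^ DIM(real \<times> real \<times> real)))) ?F"
    by (rule arg_cong[where f = "\<lambda>M. nn_integral M ?F", OF affine])
  also have "\<dots> = (\<integral>\<^sup>+v. ennreal (\<rho> ^ 3) * (ennreal (norm (\<rho> *\<^sub>R v)) * indicator (ball 0 \<rho>) (\<rho> *\<^sub>R v))
      \<partial>(lborel :: (real \<times> real \<times> real) measure))"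
    using assms by (simp add: nn_integral_density nn_integral_distr power3_eq_cube mult.assoc)
  also have "\<dots> = (\<integral>\<^sup>+v. ennreal (\<rho> ^ 4) * (ennreal (norm v) * indicator (ball 0 1) v)
      \<partial>(lborel :: (real \<times> real \<times> real) measure))"
  proof (rule nn_integral_cong)
    fix v :: "real \<times> real \<times> real"
    have "indicator (ball 0 \<rho>) (\<rho> *\<^sub>R v) = (indicator (ball 0 1) v :: ennreal)"
      using assms by (simp add: indicator_def)
    moreover have "ennreal (\<rho> ^ 3) * ennreal (norm (\<rho> *\<^sub>R v)) = ennreal (\<rho> ^ 4) * ennreal (norm v)"
      using assms by (simp add: power4_eq_xxxx power3_eq_cube mult_ac flip: ennreal_mult)
    ultimately show "ennreal (\<rho> ^ 3) * (ennreal (norm (\<rho> *\<^sub>R v)) * indicator (ball 0 \<rho>) (\<rho> *\<^sub>R v)) =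
        ennreal (\<rho> ^ 4) * (ennreal (norm v) * indicator (ball 0 1) v)"
      by (metis mult.assoc)
  qed
  also have "\<dots> = ennreal (\<rho> ^ 4) * solid_moment"
    unfolding solid_moment_def by (rule nn_integral_cmult) measurable
  finally show ?thesis .
qed

text \<open>
  Write a point of the solid ball as \<open>(x, v)\<close> with \<open>v\<close> in \<open>\<real>\<^sup>3\<close>. For fixed \<open>v\<close> substitute
  \<open>x = |v| s\<close>, where \<open>s\<close> is the slope; the weight becomes \<open>1 + s\<^sup>2\<close> and the ball becomes
  \<open>|v| < (1 + s\<^sup>2) powr (- 1/2)\<close>. Exchanging the integrals and scaling \<open>v\<close>, where \<open>|v| dv\<close> is
  homogeneous of degree \<open>4\<close>, leaves the factor \<open>(1 + s\<^sup>2) (1 + s\<^sup>2)\<^sup>-\<^sup>2\<close>.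
\<close>
lemma nn_integral_slice_measure_slope:
  assumes [measurable]: "h \<in> borel_measurable borel"
  shows "(\<integral>\<^sup>+q. h (slope q) \<partial>slice_measure) =
    4 * solid_moment * (\<integral>\<^sup>+s. ennreal (1 / (1 + s\<^sup>2)) * h s \<partial>lborel)"
proof -
  let ?F = "\<lambda>x. ennreal (slice_weight (sgn x)) * h (slope (sgn x)) * indicator (ball 0 1) x"
  let ?G = "\<lambda>s v. ennreal (norm (v :: real \<times> real \<times> real)) * indicator (ball 0 1) ((1 + s\<^sup>2) powr (1/2) *\<^sub>R v) *
      (ennreal (1 + s\<^sup>2) * h s)"
  have inner: "(\<integral>\<^sup>+x. ?F (quat_of_coords (x, v)) \<partial>lborel) = (\<integral>\<^sup>+s. ?G s v \<partial>lborel)" if v: "v \<noteq> 0" for v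
  proof -
    have "(\<integral>\<^sup>+x. ?F (quat_of_coords (x, v)) \<partial>lborel) =
        ennreal \<bar>norm v\<bar> * (\<integral>\<^sup>+s. ?F (quat_of_coords (0 + norm v * s, v)) \<partial>lborel)"
      by (rule nn_integral_real_affine) (use v in simp_all)
    also have "\<dots> = (\<integral>\<^sup>+s. ennreal (norm v) * ?F (quat_of_coords (norm v * s, v)) \<partial>lborel)"
      by (subst nn_integral_cmult) simp_all
    also have "\<dots> = (\<integral>\<^sup>+s. ?G s v \<partial>lborel)"
    proof (rule nn_integral_cong)
      fix s
      let ?q = "quat_of_coords (norm v * s, v)"
      have nv: "0 < norm v" using v by simp
      have im: "norm (qIm ?q) = norm v" by (rule norm_qIm_quat_of_coords)
      have nq2: "(norm ?q)\<^sup>2 = (norm v)\<^sup>2 * (1 + s\<^sup>2)"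
        unfolding norm_quat_Re_Im im by (simp add: algebra_simps power_mult_distrib)
      have pos: "0 < 1 + s\<^sup>2" by (simp add: add_pos_nonneg)
      have nq: "norm ?q = norm ((1 + s\<^sup>2) powr (1/2) *\<^sub>R v)"
      proof (rule power2_eq_imp_eq)
        show "(norm ?q)\<^sup>2 = (norm ((1 + s\<^sup>2) powr (1/2) *\<^sub>R v))\<^sup>2"
          unfolding nq2 using pos by (simp add: power_mult_distrib powr_half_sqrt mult.commute)
      qed simp_all
      have q0: "?q \<noteq> 0" using nq2 nv pos by (metis mult_eq_0_iff norm_zero power2_eq_square less_irrefl zero_eq_power2)
      \<comment> \<open>Since \<open>|q|\<^sup>2 = |v|\<^sup>2 (1 + s\<^sup>2)\<close>, the weight of the projected point is \<open>1 + s\<^sup>2\<close>.\<close>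
      have imsgn: "qIm (sgn ?q) = (1 / norm ?q) *\<^sub>R qIm ?q"
        by (simp add: sgn_div_norm quat_eq_iff qIm_def inverse_eq_divide)
      have "slice_weight (sgn ?q) = (norm ?q)\<^sup>2 / (norm v)\<^sup>2"
        unfolding slice_weight_def imsgn using q0 im by (simp add: norm_sgn power_divide)
      then have w: "slice_weight (sgn ?q) = 1 + s\<^sup>2" unfolding nq2 using nv by simp
      have "slope (sgn ?q) = slope ?q"
        unfolding slope_def imsgn using q0 by (simp add: sgn_div_norm inverse_eq_divide)
      also have "\<dots> = s" using nv by (simp add: slope_def im)
      finally have sl: "slope (sgn ?q) = s" .
      show "ennreal (norm v) * ?F ?q = ?G s v"
        unfolding w sl by (simp add: nq indicator_def)
    qed
    finally show ?thesis .
  qed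
  have "(\<integral>\<^sup>+q. h (slope q) \<partial>slice_measure) = 4 * (\<integral>\<^sup>+x. ?F x \<partial>lborel)"
    by (rule nn_integral_slice_measure) measurable
  also have "(\<integral>\<^sup>+x. ?F x \<partial>lborel) = (\<integral>\<^sup>+x. ?F x \<partial>distr lborel borel quat_of_coords)"
    by (simp only: lborel_quat_of_coords)
  also have "\<dots> = (\<integral>\<^sup>+p. ?F (quat_of_coords p) \<partial>lborel)"
    by (subst nn_integral_distr) auto
  also have "\<dots> = (\<integral>\<^sup>+v. \<integral>\<^sup>+x. ?F (quat_of_coords (x, v)) \<partial>lborel \<partial>lborel)"
    by (subst lborel_prod[symmetric], rule lborel_pair.nn_integral_snd[symmetric])
       (simp add: lborel_prod)
  also have "\<dots> = (\<integral>\<^sup>+v. \<integral>\<^sup>+s. ?G s v \<partial>lborel \<partial>lborel)"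
    by (rule nn_integral_cong_AE) (use AE_lborel_singleton[of 0] inner in \<open>auto elim!: eventually_mono\<close>)
  also have "\<dots> = (\<integral>\<^sup>+s. \<integral>\<^sup>+v. ?G s v \<partial>lborel \<partial>lborel)"
    by (rule lborel_pair.Fubini') measurable
  also have "\<dots> = (\<integral>\<^sup>+s. solid_moment * (ennreal (1 / (1 + s\<^sup>2)) * h s) \<partial>lborel)"
  proof (rule nn_integral_cong)
    fix s :: real
    define \<rho> where "\<rho> = (1 + s\<^sup>2) powr (- 1/2)"
    have pos: "0 < 1 + s\<^sup>2" by (simp add: add_pos_nonneg)
    then have \<rho>: "0 < \<rho>" by (simp add: \<rho>_def)
    have inv: "(1 + s\<^sup>2) powr (1/2) = inverse \<rho>"
      by (simp add: \<rho>_def powr_minus)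
    have ind: "indicator (ball 0 1) ((1 + s\<^sup>2) powr (1/2) *\<^sub>R v) = (indicator (ball 0 \<rho>) v :: ennreal)"
      for v :: "real \<times> real \<times> real"
      unfolding inv using \<rho> by (simp add: indicator_def field_simps)
    have \<rho>4: "\<rho> ^ 4 * (1 + s\<^sup>2) = 1 / (1 + s\<^sup>2)"
    proof -
      have "\<rho>\<^sup>2 = inverse (1 + s\<^sup>2)"
        using pos by (simp add: \<rho>_def powr_minus powr_half_sqrt power_inverse)
      then have "\<rho> ^ 4 = inverse (1 + s\<^sup>2) * inverse (1 + s\<^sup>2)"
        by (metis mult_2_right numeral_Bit0 power_add)
      then show ?thesis using pos by (simp add: divide_inverse)
    qed
    have "(\<integral>\<^sup>+v. ?G s v \<partial>lborel) =
        (\<integral>\<^sup>+v. ennreal (norm v) * indicator (ball 0 \<rho>) v \<partial>(lborel :: (real \<times> real \<times> real) measure)) * (ennreal (1 + s\<^sup>2) * h s)"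
      unfolding ind by (rule nn_integral_multc) measurable
    also have "\<dots> = solid_moment * (ennreal (\<rho> ^ 4 * (1 + s\<^sup>2)) * h s)"
      unfolding solid_moment_scale[OF \<rho>] using \<rho> pos by (simp add: ennreal_mult mult_ac)
    finally show "(\<integral>\<^sup>+v. ?G s v \<partial>lborel) = solid_moment * (ennreal (1 / (1 + s\<^sup>2)) * h s)"
      unfolding \<rho>4 .
  qed
  also have "\<dots> = solid_moment * (\<integral>\<^sup>+s. ennreal (1 / (1 + s\<^sup>2)) * h s \<partial>lborel)"
    by (rule nn_integral_cmult) measurable
  finally show ?thesis by (simp add: mult.assoc)
qed

lemma AE_slice_measure_slope:
  assumes "AE s in lborel. P s"
  shows "AE q in slice_measure. P (slope q)"
proof -
  from assms obtain N where N: "{s. \<not> P s} \<subseteq> N" "N \<in> sets borel" "emeasure lborel N = 0"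
    by (auto elim: AE_E)
  have [measurable]: "N \<in> sets borel" by fact
  have "emeasure slice_measure {q \<in> space slice_measure. slope q \<in> N} =
      (\<integral>\<^sup>+q. indicator {q \<in> space slice_measure. slope q \<in> N} q \<partial>slice_measure)"
    by (rule nn_integral_indicator[symmetric]) measurable
  also have "\<dots> = (\<integral>\<^sup>+q. indicator N (slope q) \<partial>slice_measure)"
    by (rule nn_integral_cong) (simp add: indicator_def)
  also have "\<dots> = 4 * solid_moment * (\<integral>\<^sup>+s. ennreal (1 / (1 + s\<^sup>2)) * indicator N s \<partial>lborel)"
    by (rule nn_integral_slice_measure_slope) measurable
  also have "(\<integral>\<^sup>+s. ennreal (1 / (1 + s\<^sup>2)) * indicator N s \<partial>lborel) = (\<integral>\<^sup>+s. 0 \<partial>(lborel :: real measure))"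
  proof (rule nn_integral_cong_AE)
    have "AE s in lborel. s \<notin> N" using N by (intro AE_not_in) (auto simp: null_sets_def)
    then show "AE s in lborel. ennreal (1 / (1 + s\<^sup>2)) * indicator N s = 0"
      by eventually_elim simp
  qed
  finally have "{q \<in> space slice_measure. slope q \<in> N} \<in> null_sets slice_measure"
    by (auto simp: null_sets_def)
  then have "AE q in slice_measure. q \<notin> {q \<in> space slice_measure. slope q \<in> N}"
    by (rule AE_not_in)
  then show ?thesis
    using N(1) sets_eq_imp_space_eq[OF sets_slice_measure] by (auto elim!: eventually_mono)
qed

lemma AE_slice_measure: "AE q in slice_measure. norm q = 1 \<and> qIm q \<noteq> 0"
proof -
  have "0 < ennreal (slice_weight q) \<longrightarrow> norm q = 1 \<and> qIm q \<noteq> 0" for q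
    by (auto simp: slice_weight_def indicator_def)
  then show ?thesis unfolding slice_measure_def by (subst AE_density) auto
qed

lemma integrable_inverse_one_plus_square: "integrable lborel (\<lambda>s::real. 1 / (1 + s\<^sup>2))"
proof -
  have "set_integrable lborel (einterval (-\<infinity>) \<infinity>) (\<lambda>s::real. 1 / (1 + s\<^sup>2))"
  proof (rule interval_integral_FTC_nonneg(1))
    show "(arctan has_real_derivative 1 / (1 + x\<^sup>2)) (at x)" for x
      using DERIV_arctan[of x] by (simp add: inverse_eq_divide)
    show "isCont (\<lambda>s::real. 1 / (1 + s\<^sup>2)) x" for x
      by (intro continuous_intros) (simp add: add_nonneg_eq_0_iff)
    show "((arctan \<circ> real_of_ereal) \<longlongrightarrow> - (pi / 2)) (at_right (-\<infinity>))"
      "((arctan \<circ> real_of_ereal) \<longlongrightarrow> pi / 2) (at_left \<infinity>)"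
      by (simp_all add: ereal_tendsto_simps tendsto_arctan_at_bot tendsto_arctan_at_top)
  qed auto
  then show ?thesis by (simp add: set_integrable_def)
qed

lemma finite_slice_measure: "emeasure slice_measure (space slice_measure) < \<infinity>"
proof -
  have "emeasure slice_measure (space slice_measure) = (\<integral>\<^sup>+q. 1 \<partial>slice_measure)" by simp
  also have "\<dots> = 4 * solid_moment * (\<integral>\<^sup>+s. ennreal (1 / (1 + s\<^sup>2)) \<partial>lborel)"
    using nn_integral_slice_measure_slope[of "\<lambda>_. 1"] by simp
  also have "\<dots> < \<infinity>"
    using solid_moment_finite integrableD(2)[OF integrable_inverse_one_plus_square]
    by (simp add: ennreal_mult_less_top top.not_eq_extremum)
  finally show ?thesis .
qed

lemma distr_slice_measure_slope:
  "distr slice_measure borel slope =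
    density lborel (\<lambda>s. ennreal (4 * enn2real solid_moment * (1 / (1 + s\<^sup>2))))"
proof (rule measure_eqI)
  fix A assume "A \<in> sets (distr slice_measure borel slope)"
  then have [measurable]: "A \<in> sets borel" by simp
  have sm: "ennreal (enn2real solid_moment) = solid_moment"
    using solid_moment_finite by simp
  have dens: "4 * solid_moment * ennreal x = ennreal (4 * enn2real solid_moment * x)" if "0 \<le> x" for x
    using that by (simp add: ennreal_mult sm)
  have "emeasure (distr slice_measure borel slope) A = (\<integral>\<^sup>+q. indicator A (slope q) \<partial>slice_measure)"
    by (simp add: nn_integral_distr flip: nn_integral_indicator)
  also have "\<dots> = 4 * solid_moment * (\<integral>\<^sup>+s. ennreal (1 / (1 + s\<^sup>2)) * indicator A s \<partial>lborel)"
    by (rule nn_integral_slice_measure_slope) measurable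
  also have "\<dots> = (\<integral>\<^sup>+s. 4 * solid_moment * (ennreal (1 / (1 + s\<^sup>2)) * indicator A s) \<partial>lborel)"
    by (rule nn_integral_cmult[symmetric]) measurable
  also have "\<dots> = emeasure (density lborel (\<lambda>s. ennreal (4 * enn2real solid_moment * (1 / (1 + s\<^sup>2))))) A"
    by (subst emeasure_density) (auto simp: dens simp flip: mult.assoc intro!: nn_integral_cong)
  finally show "emeasure (distr slice_measure borel slope) A =
    emeasure (density lborel (\<lambda>s. ennreal (4 * enn2real solid_moment * (1 / (1 + s\<^sup>2))))) A" .
qed simp

lemma unit_quat_polar:
  assumes "norm q = 1" "qIm q \<noteq> 0"
  shows "\<exists>J\<in>imag_units. q = slice_embed J (cis (pi / 2 - arctan (slope q)))"
proof -
  define J where "J = (1 / norm (qIm q)) *\<^sub>R qIm q"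
  let ?n = "norm (qIm q)"
  have n: "0 < ?n" using assms by simp
  have J: "J \<in> imag_units"
    by (rule imag_unitsI) (use n in \<open>simp_all add: J_def qIm_def\<close>)
  have one: "(qRe q)\<^sup>2 + ?n\<^sup>2 = 1" using assms norm_quat_Re_Im[of q] by simp
  have "1 + (slope q)\<^sup>2 = ((qRe q)\<^sup>2 + ?n\<^sup>2) / ?n\<^sup>2"
    using n by (simp add: slope_def power_divide field_simps)
  then have "1 + (slope q)\<^sup>2 = 1 / ?n\<^sup>2" unfolding one .
  then have root: "sqrt (1 + (slope q)\<^sup>2) = 1 / ?n" using n by (simp add: real_sqrt_divide)
  have "cos (pi / 2 - arctan (slope q)) = slope q / sqrt (1 + (slope q)\<^sup>2)"
    by (simp add: cos_diff sin_arctan)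
  then have c: "cos (pi / 2 - arctan (slope q)) = qRe q"
    unfolding root using n by (simp add: slope_def)
  have s: "sin (pi / 2 - arctan (slope q)) = ?n"
    by (simp add: sin_diff cos_arctan root)
  have "q = of_real (qRe q) + of_real ?n * J"
    using n by (simp add: J_def quat_eq_iff qIm_def of_real_def)
  then have "q = slice_embed J (cis (pi / 2 - arctan (slope q)))"
    by (simp add: slice_embed_def slice_pt_def c s)
  with J show ?thesis by blast
qed

text \<open>
  By symmetry only the real part \<open>cos (n t)\<close> of \<open>q\<^sup>n\<close> contributes. In the slope coordinate
  \<open>t = \<pi>/2 - arctan s\<close>, so \<open>cos (n t) / (1 + s\<^sup>2)\<close> is the derivative of \<open>- sin (n t) / n\<close>, which
  vanishes at both ends \<open>t = 0\<close> and \<open>t = \<pi>\<close>.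
\<close>
lemma orthogonal_powers_slice_measure: "orthogonal_powers slice_measure"
proof (intro orthogonal_powers.intro orthogonal_powers_axioms.intro finite_measureI)
  show "emeasure slice_measure (space slice_measure) \<noteq> \<infinity>" using finite_slice_measure by simp
  show "sets slice_measure = sets borel" by simp
  show one: "AE q in slice_measure. norm q = 1" using AE_slice_measure by (auto elim!: eventually_mono)
  interpret finite_measure slice_measure
    by (rule finite_measureI) (use finite_slice_measure in simp)
  fix n :: nat assume n: "n > 0"
  let ?c = "\<lambda>s. cos (real n * (pi / 2 - arctan s))"
  have int: "integrable slice_measure (\<lambda>q. q ^ n)"
    by (rule integrable_const_bound[of _ 1]) (use one in \<open>auto simp: norm_power elim!: eventually_mono\<close>)
  have "(\<integral>q. q ^ n \<partial>slice_measure) = (\<integral>q. q ^ n \<partial>distr slice_measure borel qcnj)"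
    by (simp only: distr_slice_measure_qcnj)
  also have "\<dots> = (\<integral>q. qcnj (q ^ n) \<partial>slice_measure)"
    by (subst integral_distr) (auto simp: qcnj_power)
  also have "\<dots> = qcnj (\<integral>q. q ^ n \<partial>slice_measure)"
    by (rule integral_bounded_linear[OF bounded_linear_qcnj int])
  finally have real: "qIm (\<integral>q. q ^ n \<partial>slice_measure) = 0" by (simp add: quat_eq_iff qIm_def)
  have "qRe (\<integral>q. q ^ n \<partial>slice_measure) = (\<integral>q. qRe (q ^ n) \<partial>slice_measure)"
    by (rule integral_bounded_linear[OF bounded_linear_qRe int, symmetric])
  also have "\<dots> = (\<integral>q. ?c (slope q) \<partial>slice_measure)"
  proof (rule integral_cong_AE)
    show "AE q in slice_measure. qRe (q ^ n) = ?c (slope q)"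
      using AE_slice_measure
    proof eventually_elim
      case (elim q)
      then obtain J where J: "J \<in> imag_units" "q = slice_embed J (cis (pi / 2 - arctan (slope q)))"
        using unit_quat_polar by blast
      then have "q ^ n = slice_embed J (cis (real n * (pi / 2 - arctan (slope q))))"
        by (metis Complex.DeMoivre slice_embed_power)
      then show ?case using imag_units_qRe[OF J(1)] by (simp add: slice_embed_def slice_pt_def)
    qed
  qed measurable
  also have "\<dots> = (\<integral>s. ?c s \<partial>distr slice_measure borel slope)"
    by (subst integral_distr) auto
  also have "\<dots> = (\<integral>s. (4 * enn2real solid_moment * (1 / (1 + s\<^sup>2))) *\<^sub>R ?c s \<partial>lborel)"
    unfolding distr_slice_measure_slope by (rule integral_density) (auto intro!: divide_nonneg_nonneg mult_nonneg_nonneg)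
  also have "\<dots> = 4 * enn2real solid_moment * (\<integral>s. 1 / (1 + s\<^sup>2) * ?c s \<partial>lborel)"
    by (simp add: mult.assoc flip: integral_mult_right_zero)
  also have "(\<integral>s. 1 / (1 + s\<^sup>2) * ?c s \<partial>lborel) = (LBINT s=-\<infinity>..\<infinity>. 1 / (1 + s\<^sup>2) * ?c s)"
    by (simp add: interval_lebesgue_integral_def set_lebesgue_integral_def)
  also have "\<dots> = - sin (real n * (pi / 2 - pi / 2)) / real n - (- sin (real n * (pi / 2 - - (pi / 2))) / real n)"
  proof (rule interval_integral_FTC_integrable[where F = "\<lambda>s. - sin (real n * (pi / 2 - arctan s)) / real n"])
    show "((\<lambda>s. - sin (real n * (pi / 2 - arctan s)) / real n) has_vector_derivative 1 / (1 + x\<^sup>2) * ?c x) (at x)" for x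
      unfolding has_real_derivative_iff_has_vector_derivative[symmetric]
      using n by (auto intro!: derivative_eq_intros simp: inverse_eq_divide)
    show "isCont (\<lambda>s. 1 / (1 + s\<^sup>2) * ?c s) x" for x
      by (intro continuous_intros) (simp add: add_nonneg_eq_0_iff)
    show "set_integrable lborel (einterval (-\<infinity>) \<infinity>) (\<lambda>s. 1 / (1 + s\<^sup>2) * ?c s)"
      unfolding set_integrable_def
      by (rule Bochner_Integration.integrable_bound[OF integrable_inverse_one_plus_square])
         (auto simp: abs_mult intro!: divide_right_mono)
    show "(((\<lambda>s. - sin (real n * (pi / 2 - arctan s)) / real n) \<circ> real_of_ereal) \<longlongrightarrow>
        - sin (real n * (pi / 2 - - (pi / 2))) / real n) (at_right (-\<infinity>))"
      "(((\<lambda>s. - sin (real n * (pi / 2 - arctan s)) / real n) \<circ> real_of_ereal) \<longlongrightarrow>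
        - sin (real n * (pi / 2 - pi / 2)) / real n) (at_left \<infinity>)"
      unfolding ereal_tendsto_simps
      by (use n in \<open>intro tendsto_intros tendsto_arctan_at_bot tendsto_arctan_at_top; simp\<close>)+
  qed simp
  also have "\<dots> = 0" by simp
  finally have "qRe (\<integral>q. q ^ n \<partial>slice_measure) = 0" by simp
  with real show "(\<integral>q. q ^ n \<partial>slice_measure) = 0" by (simp add: quat_eq_iff qIm_def)
qed

section \<open>Power series of slice regular functions\<close>

text \<open>
  A continuous partial derivative in one variable and mere existence of the other give total
  differentiability, and the Cauchy-Riemann equation makes the derivative complex linear.
\<close>
lemma holomorphic_on_disc_if_partials:
  fixes h hx hy :: "real \<Rightarrow> real \<Rightarrow> complex"
  assumes hy_cont: "continuous_on {(x, y). norm (Complex x y) < 1} (\<lambda>(x, y). hy x y)"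
    and dx: "\<And>x y. norm (Complex x y) < 1 \<Longrightarrow> ((\<lambda>s. h s y) has_vector_derivative hx x y) (at x)"
    and dy: "\<And>x y. norm (Complex x y) < 1 \<Longrightarrow> ((\<lambda>s. h x s) has_vector_derivative hy x y) (at y)"
    and cr: "\<And>x y. norm (Complex x y) < 1 \<Longrightarrow> hx x y + \<i> * hy x y = 0"
  shows "(\<lambda>z. h (Re z) (Im z)) holomorphic_on ball 0 1"
proof (rule holomorphic_onI, rule field_differentiable_at_within)
  fix z :: complex assume "z \<in> ball 0 1"
  define D where "D = {(x, y). norm (Complex x y) < 1}"
  define x y where "x = Re z" and "y = Im z"
  have zxy: "Complex x y = z" by (simp add: x_def y_def)
  have "open D"
    unfolding D_def case_prod_beta complex_norm
    by (intro open_Collect_less continuous_intros)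
  moreover have xy: "(x, y) \<in> D" using \<open>z \<in> ball 0 1\<close> by (simp add: D_def zxy)
  ultimately obtain X B where XB: "open X" "open B" "(x, y) \<in> X \<times> B" "X \<times> B \<subseteq> D"
    by (rule open_prod_elim)
  then have "y \<in> B" by blast
  then obtain e where e: "0 < e" "ball y e \<subseteq> B" by (rule openE[OF XB(2)])
  define Y where "Y = ball y e"
  have Y: "open Y" "convex Y" "y \<in> Y" "X \<times> Y \<subseteq> D" using XB e by (auto simp: Y_def)
  have mem: "norm (Complex x' y') < 1" if "x' \<in> X" "y' \<in> Y" for x' y'
    using that Y(4) by (auto simp: D_def)
  have m: "norm (Complex x y) < 1" using xy by (simp add: D_def)
  have "((\<lambda>(x, y). h x y) has_derivative (\<lambda>(tx, ty). tx *\<^sub>R hx x y + blinfun_scaleR_left (hy x y) ty))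
      (at (x, y) within X \<times> Y)"
  proof (rule has_derivative_partialsI[where f = h and x = x and y = y and X = X and Y = Y and
        fx = "\<lambda>t. t *\<^sub>R hx x y" and fy = "\<lambda>x y. blinfun_scaleR_left (hy x y)"])
    show "((\<lambda>x. h x y) has_derivative (\<lambda>t. t *\<^sub>R hx x y)) (at x within X)"
      by (rule has_derivative_at_withinI[OF dx[OF m, unfolded has_vector_derivative_def]])
    show "((\<lambda>y. h x' y) has_derivative blinfun_apply (blinfun_scaleR_left (hy x' y'))) (at y' within Y)"
      if "x' \<in> X" "y' \<in> Y" for x' y'
      unfolding blinfun_scaleR_left.rep_eq
      by (rule has_derivative_at_withinI[OF dy[OF mem[OF that], unfolded has_vector_derivative_def]])
    have "continuous_on D (\<lambda>(x, y). blinfun_scaleR_left (hy x y))"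
      using bounded_linear.continuous_on[OF bounded_linear_blinfun_scaleR_left hy_cont[folded D_def]]
      by (simp add: case_prod_beta)
    then have "continuous_on (X \<times> Y) (\<lambda>(x, y). blinfun_scaleR_left (hy x y))"
      using Y(4) by (rule continuous_on_subset)
    then show "continuous (at (x, y) within X \<times> Y) (\<lambda>(x, y). blinfun_scaleR_left (hy x y))"
      using XB Y by (auto simp: continuous_on_eq_continuous_within)
  qed (use Y in auto)
  moreover have "at (x, y) within X \<times> Y = at (x, y)"
    using XB Y by (intro at_within_open) (auto intro: open_Times)
  ultimately have D: "((\<lambda>(x, y). h x y) has_derivative (\<lambda>(tx, ty). tx *\<^sub>R hx x y + ty *\<^sub>R hy x y)) (at (x, y))"
    by simp
  have "((\<lambda>z. (Re z, Im z)) has_derivative (\<lambda>t. (Re t, Im t))) (at z)"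
    by (intro derivative_intros)
  moreover have "((\<lambda>(x, y). h x y) has_derivative (\<lambda>(tx, ty). tx *\<^sub>R hx x y + ty *\<^sub>R hy x y))
      (at (Re z, Im z))"
    using D by (simp only: x_def y_def)
  ultimately have "((\<lambda>z. (\<lambda>(x, y). h x y) (Re z, Im z)) has_derivative
      (\<lambda>t. (\<lambda>(tx, ty). tx *\<^sub>R hx x y + ty *\<^sub>R hy x y) (Re t, Im t))) (at z)"
    by (rule has_derivative_compose)
  then have "((\<lambda>z. h (Re z) (Im z)) has_derivative (\<lambda>t. Re t *\<^sub>R hx x y + Im t *\<^sub>R hy x y)) (at z)"
    by simp
  moreover have hy: "hy x y = \<i> * hx x y"
  proof -
    have "\<i> * (hx x y + \<i> * hy x y) = 0" using cr[of x y] xy by (simp add: D_def)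
    then show ?thesis by (simp add: algebra_simps)
  qed
  have "Re t *\<^sub>R hx x y + Im t *\<^sub>R hy x y = hx x y * t" for t
  proof -
    have "hx x y * t = hx x y * (of_real (Re t) + \<i> * of_real (Im t))" by (simp only: complex_eq[symmetric])
    then show ?thesis unfolding hy by (simp add: scaleR_conv_of_real algebra_simps)
  qed
  ultimately have "((\<lambda>z. h (Re z) (Im z)) has_field_derivative hx x y) (at z)"
    by (simp add: has_field_derivative_def)
  then show "(\<lambda>z. h (Re z) (Im z)) field_differentiable at z"
    unfolding field_differentiable_def ..
qed

definition unit_j :: quat where "unit_j = Quat 0 0 1 0"

definition first_part :: "quat \<Rightarrow> complex" where "first_part q = Complex (qRe q) (qI q)"
definition second_part :: "quat \<Rightarrow> complex" where "second_part q = Complex (qJ q) (qK q)"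

text \<open>
  Left multiplication by \<open>i\<close> acts on both complex parts as the complex unit, which is what turns
  the slice Cauchy-Riemann equation into two ordinary ones.
\<close>
lemma quat_splitting: "q = slice_embed unit_i (first_part q) + slice_embed unit_i (second_part q) * unit_j"
  by (simp add: quat_eq_iff slice_embed_def slice_pt_def unit_i_def unit_j_def first_part_def second_part_def)

lemma parts_unit_i_mult:
  "first_part (unit_i * q) = \<i> * first_part q" "second_part (unit_i * q) = \<i> * second_part q"
  by (simp_all add: complex_eq_iff unit_i_def first_part_def second_part_def)

lemma bounded_linear_parts: "bounded_linear first_part" "bounded_linear second_part"
  by (rule linear_conv_bounded_linear[THEN iffD1], rule linearI,
      simp_all add: first_part_def second_part_def complex_eq_iff)+

lemma slice_pt_eq_embed: "slice_pt I x y = slice_embed I (Complex x y)"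
  by (simp add: slice_embed_def)

lemma quat_mem_slice: "\<exists>J\<in>imag_units. q = slice_pt J (qRe q) (norm (qIm q))"
proof (cases "qIm q = 0")
  case True
  then have "q = slice_pt unit_i (qRe q) (norm (qIm q))"
    by (simp add: slice_pt_def quat_eq_iff qIm_def)
  then show ?thesis using unit_i_imag by blast
next
  case False
  define J where "J = (1 / norm (qIm q)) *\<^sub>R qIm q"
  have "J \<in> imag_units"
    by (rule imag_unitsI) (use False in \<open>simp_all add: J_def qIm_def\<close>)
  moreover have "q = slice_pt J (qRe q) (norm (qIm q))"
    using False by (simp add: J_def slice_pt_def quat_eq_iff qIm_def of_real_def)
  ultimately show ?thesis by blast
qed

lemma slice_regular_part_holomorphic:
  assumes f: "slice_regular f" and L: "bounded_linear L" and Li: "\<And>q. L (unit_i * q) = \<i> * (L q :: complex)"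
  shows "(\<lambda>z. L (f (slice_embed unit_i z))) holomorphic_on ball 0 1"
proof -
  have dom: "slice_pt unit_i x y \<in> unit_ball \<longleftrightarrow> norm (Complex x y) < 1" for x y
    by (simp add: slice_pt_eq_embed norm_slice_embed[OF unit_i_imag])
  have "\<exists>fx fy. continuous_on {(x, y). slice_pt unit_i x y \<in> unit_ball} (\<lambda>(x, y). fy x y) \<and>
      (\<forall>x y. slice_pt unit_i x y \<in> unit_ball \<longrightarrow>
        ((\<lambda>s. f (slice_pt unit_i s y)) has_vector_derivative fx x y) (at x) \<and>
        ((\<lambda>s. f (slice_pt unit_i x s)) has_vector_derivative fy x y) (at y) \<and>
        1 / 2 * (fx x y + unit_i * fy x y) = 0)"
    using f unit_i_imag unfolding slice_regular_def by blast
  then obtain fx fy where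
    fy: "continuous_on {(x, y). norm (Complex x y) < 1} (\<lambda>(x, y). fy x y)"
    and d: "\<And>x y. norm (Complex x y) < 1 \<Longrightarrow>
        ((\<lambda>s. f (slice_pt unit_i s y)) has_vector_derivative fx x y) (at x) \<and>
        ((\<lambda>s. f (slice_pt unit_i x s)) has_vector_derivative fy x y) (at y) \<and>
        1 / 2 * (fx x y + unit_i * fy x y) = 0"
    unfolding dom by blast
  have "(\<lambda>z. L (f (slice_pt unit_i (Re z) (Im z)))) holomorphic_on ball 0 1"
  proof (rule holomorphic_on_disc_if_partials)
    show "continuous_on {(x, y). norm (Complex x y) < 1} (\<lambda>(x, y). L (fy x y))"
      using bounded_linear.continuous_on[OF L fy] by (simp add: case_prod_beta)
    fix x y assume xy: "norm (Complex x y) < 1"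
    show "((\<lambda>s. L (f (slice_pt unit_i s y))) has_vector_derivative L (fx x y)) (at x)"
      "((\<lambda>s. L (f (slice_pt unit_i x s))) has_vector_derivative L (fy x y)) (at y)"
      using d[OF xy] by (auto intro: bounded_linear.has_vector_derivative[OF L])
    have "fx x y + unit_i * fy x y = 0" using d[OF xy] by simp
    then have "L (fx x y + unit_i * fy x y) = 0" using L by (simp add: linear_simps)
    then show "L (fx x y) + \<i> * L (fy x y) = 0"
      using L by (simp add: linear_simps Li)
  qed
  then show ?thesis by (simp add: slice_embed_def)
qed

text \<open>
  The identity that defines slice functions, for the identity function. Applied to powers of \<open>z\<close> it
  extends a power series from one slice to all.
\<close>
lemma slice_formula:
  assumes J: "J \<in> imag_units" and I: "I \<in> imag_units"
  shows "slice_embed J z = 1 / 2 * (slice_embed I z + slice_embed I (cnj z)) +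
    J * I / 2 * (slice_embed I (cnj z) - slice_embed I z)"
proof -
  have half: "b / 2 * (2 * c) = b * c" for b c :: quat
  proof -
    have "b / 2 * (2 * c) = b * (inverse 2 * 2) * c" by (simp only: divide_inverse mult.assoc)
    also have "inverse 2 * 2 = (1 :: quat)" by (rule left_inverse) simp
    finally show ?thesis by simp
  qed
  have sum: "slice_embed I z + slice_embed I (cnj z) = 2 * of_real (Re z)"
    unfolding mult_2 by (simp add: slice_embed_def slice_pt_def)
  have diff: "slice_embed I (cnj z) - slice_embed I z = 2 * (- (of_real (Im z) * I))"
    unfolding mult_2 by (simp add: slice_embed_def slice_pt_def)
  have "J * I * - (of_real (Im z) * I) = of_real (Im z) * J"
    using imag_units_square[OF I] by (simp add: of_real_def mult.assoc)
  then show ?thesis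
    unfolding sum diff half by (simp add: slice_embed_def slice_pt_def)
qed

proposition slice_regular_power_series:
  assumes f: "slice_regular f"
  obtains a where "\<And>q. q \<in> unit_ball \<Longrightarrow> (\<lambda>n. q ^ n * a n) sums f q"
proof -
  let ?e = "slice_embed unit_i"
  note [simp] = norm_slice_embed[OF unit_i_imag]
  have "\<exists>c. \<forall>z\<in>ball 0 1. (\<lambda>n. z ^ n * c n) sums L (f (?e z))"
    if "bounded_linear L" "\<And>q. L (unit_i * q) = \<i> * (L q :: complex)" for L
  proof -
    have "(\<lambda>n. (deriv ^^ n) (\<lambda>z. L (f (?e z))) 0 / fact n * (z - 0) ^ n) sums L (f (?e z))"
      if "z \<in> ball 0 1" for z
      by (rule holomorphic_power_series[OF slice_regular_part_holomorphic]) fact+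
    then show ?thesis
      by (intro exI[of _ "\<lambda>n. (deriv ^^ n) (\<lambda>z. L (f (?e z))) 0 / fact n"]) (simp add: mult.commute)
  qed
  from this[OF bounded_linear_parts(1)] this[OF bounded_linear_parts(2)] obtain c d where
    c: "\<And>z. z \<in> ball 0 1 \<Longrightarrow> (\<lambda>n. z ^ n * c n) sums first_part (f (?e z))" and
    d: "\<And>z. z \<in> ball 0 1 \<Longrightarrow> (\<lambda>n. z ^ n * d n) sums second_part (f (?e z))"
    using parts_unit_i_mult by blast
  define a where "a n = ?e (c n) + ?e (d n) * unit_j" for n
  have slice: "(\<lambda>n. ?e z ^ n * a n) sums f (?e z)" if z: "z \<in> ball 0 1" for z
  proof -
    have "(\<lambda>n. ?e (z ^ n * c n) + ?e (z ^ n * d n) * unit_j) sums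
        (?e (first_part (f (?e z))) + ?e (second_part (f (?e z))) * unit_j)"
      by (intro sums_add sums_mult2 bounded_linear.sums[OF bounded_linear_slice_embed] c d z)
    then show ?thesis
      unfolding quat_splitting[of "f (?e z)", symmetric]
      by (simp add: a_def slice_embed_mult[OF unit_i_imag] slice_embed_power[OF unit_i_imag]
          distrib_left mult.assoc)
  qed
  have "(\<lambda>n. q ^ n * a n) sums f q" if q: "q \<in> unit_ball" for q
  proof -
    obtain J where J: "J \<in> imag_units" and qJ: "q = slice_pt J (qRe q) (norm (qIm q))"
      using quat_mem_slice by blast
    define z where "z = Complex (qRe q) (norm (qIm q))"
    have qz: "q = slice_embed J z" unfolding z_def using qJ by (simp only: slice_pt_eq_embed)
    then have z: "z \<in> ball 0 1" "cnj z \<in> ball 0 1" using q by (simp_all add: norm_slice_embed[OF J])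
    have "f (slice_pt J (Re z) (Im z)) =
        1 / 2 * (f (slice_pt unit_i (Re z) (Im z)) + f (slice_pt unit_i (Re z) (- Im z)))
        + J * unit_i / 2 * (f (slice_pt unit_i (Re z) (- Im z)) - f (slice_pt unit_i (Re z) (Im z)))"
    proof -
      have "slice_pt J (Re z) (Im z) \<in> unit_ball \<and> slice_pt unit_i (Re z) (Im z) \<in> unit_ball \<and>
          slice_pt unit_i (Re z) (- Im z) \<in> unit_ball"
        using z by (simp add: slice_pt_eq_embed norm_slice_embed[OF J] flip: complex_cnj)
      then show ?thesis
        using f J unit_i_imag unfolding slice_regular_def slice_function_def by blast
    qed
    then have fq: "f q = 1 / 2 * (f (?e z) + f (?e (cnj z))) + J * unit_i / 2 * (f (?e (cnj z)) - f (?e z))"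
      by (simp add: qz slice_embed_def)
    have "(\<lambda>n. 1 / 2 * (?e z ^ n * a n + ?e (cnj z) ^ n * a n) +
        J * unit_i / 2 * (?e (cnj z) ^ n * a n - ?e z ^ n * a n)) sums f q"
      unfolding fq by (intro sums_add sums_diff sums_mult slice z)
    moreover have "1 / 2 * (?e z ^ n * a n + ?e (cnj z) ^ n * a n) +
        J * unit_i / 2 * (?e (cnj z) ^ n * a n - ?e z ^ n * a n) = q ^ n * a n" for n
    proof -
      have "q ^ n = slice_embed J (z ^ n)" by (simp add: qz slice_embed_power[OF J])
      also have "\<dots> = 1 / 2 * (?e z ^ n + ?e (cnj z) ^ n) + J * unit_i / 2 * (?e (cnj z) ^ n - ?e z ^ n)"
        unfolding slice_formula[OF J unit_i_imag] by (simp add: slice_embed_power[OF unit_i_imag])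
      finally show ?thesis
        by (simp only: distrib_right left_diff_distrib mult.assoc)
    qed
    ultimately show ?thesis by simp
  qed
  then show ?thesis by (rule that)
qed

text \<open>
  The mean square over the circle of radius \<open>r\<close> is \<open>\<Sum> r\<^sup>2\<^sup>n |a\<^sub>n|\<^sup>2\<close> by Parseval's identity; in every
  partial sum \<open>r\<close> may tend to \<open>1\<close>.
\<close>
proposition slice_hardy_power_series:
  assumes "f \<in> slice_hardy"
  obtains a where "summable (\<lambda>n. (norm (a n))\<^sup>2)" "\<And>q. q \<in> unit_ball \<Longrightarrow> (\<lambda>n. q ^ n * a n) sums f q"
proof -
  from assms have "slice_regular f" by (simp add: slice_hardy_def)
  then obtain a where a: "\<And>q. q \<in> unit_ball \<Longrightarrow> (\<lambda>n. q ^ n * a n) sums f q"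
    using slice_regular_power_series by blast
  from assms obtain I where I: "I \<in> imag_units" and bdd: "bdd_above ((\<lambda>r. 1 / (2 * pi) *
        integral {0..2 * pi} (\<lambda>t. (norm (f (of_real r * exp (I * of_real t))))\<^sup>2)) ` {0..<1})"
    by (auto simp: slice_hardy_def)
  then obtain B where B: "\<And>r. r \<in> {0..<1} \<Longrightarrow> 1 / (2 * pi) *
        integral {0..2 * pi} (\<lambda>t. (norm (f (of_real r * exp (I * of_real t))))\<^sup>2) \<le> B"
    unfolding bdd_above_def by blast
  have mean: "(\<Sum>n. (norm (of_real (r ^ n) * a n))\<^sup>2) \<le> B" and
    sum: "summable (\<lambda>n. (norm (of_real (r ^ n) * a n))\<^sup>2)" if r: "r \<in> {0..<1}" for r
  proof -
    let ?g = "\<lambda>t. (norm (qseries (\<lambda>n. of_real (r ^ n) * a n) (slice_embed I (cis t))))\<^sup>2"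
    have s: "summable (\<lambda>n. norm (of_real (r ^ n) * a n))"
      by (rule power_series_sums_imp_summable_norm) (use r a in \<open>auto simp: sums_iff\<close>)
    have fg: "(norm (f (of_real r * exp (I * of_real t))))\<^sup>2 = ?g t" for t
    proof -
      have "of_real r * slice_embed I (cis t) \<in> unit_ball"
        using r by (simp add: norm_mult norm_slice_embed[OF I])
      from a[OF this] have "f (of_real r * slice_embed I (cis t)) = qseries a (of_real r * slice_embed I (cis t))"
        by (simp add: qseries_def sums_iff)
      then show ?thesis unfolding exp_imag_unit[OF I] qseries_dilate by (rule arg_cong)
    qed
    have "continuous_on {0..2 * pi} ?g"
      by (intro continuous_intros continuous_on_compose2[OF continuous_on_qseries[OF s]]
          slice_embed_cis_continuous) (auto simp: norm_slice_embed[OF I])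
    then have "integral {0..2 * pi} ?g = (LINT t:{0..2 * pi}|lborel. ?g t)"
      by (intro set_borel_integral_eq_integral(2)[symmetric] borel_integrable_atLeastAtMost')
    also have "\<dots> = 2 * pi * (\<Sum>n. (norm (of_real (r ^ n) * a n))\<^sup>2)"
      using circle_parseval_norm[OF I s, of 0] by simp
    finally show "(\<Sum>n. (norm (of_real (r ^ n) * a n))\<^sup>2) \<le> B"
      using B[OF r] unfolding fg by simp
    interpret orthogonal_powers "circle_measure 0 I" by (rule orthogonal_powers_circle_measure[OF I])
    show "summable (\<lambda>n. (norm (of_real (r ^ n) * a n))\<^sup>2)" by (rule parseval_norm(2)[OF s])
  qed
  have "summable (\<lambda>n. (norm (a n))\<^sup>2)"
  proof (rule summableI_nonneg_bounded)
    fix N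
    have "((\<lambda>r. \<Sum>n<N. (norm (of_real (r ^ n) * a n))\<^sup>2) \<longlongrightarrow> (\<Sum>n<N. (norm (of_real (1 ^ n) * a n))\<^sup>2)) (at_left 1)"
      by (intro tendsto_intros)
    moreover have "eventually (\<lambda>r. (\<Sum>n<N. (norm (of_real (r ^ n) * a n))\<^sup>2) \<le> B) (at_left 1)"
    proof -
      have "(\<Sum>n<N. (norm (of_real (r ^ n) * a n))\<^sup>2) \<le> B" if "r \<in> {0<..<1}" for r
      proof -
        have r: "r \<in> {0..<1}" using that by simp
        have "(\<Sum>n<N. (norm (of_real (r ^ n) * a n))\<^sup>2) \<le> (\<Sum>n. (norm (of_real (r ^ n) * a n))\<^sup>2)"
          by (rule sum_le_suminf[OF sum[OF r]]) auto
        then show ?thesis using mean[OF r] by simp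
      qed
      then show ?thesis using eventually_at_left_real[of 0 1] by (auto elim: eventually_mono)
    qed
    ultimately have "(\<Sum>n<N. (norm (of_real (1 ^ n) * a n))\<^sup>2) \<le> B"
      by (rule tendsto_upperbound) simp
    then show "(\<Sum>n<N. (norm (a n))\<^sup>2) \<le> B" by simp
  qed simp
  then show ?thesis using a by (rule that)
qed

section \<open>The Szego kernel\<close>

definition degree_one_coeffs :: "quat \<Rightarrow> nat \<Rightarrow> quat" where
  "degree_one_coeffs b n = (if n = 0 then 1 else if n = 1 then - b else 0)"

lemma qcoeff_one_minus_mult: "qcoeff (\<lambda>q. 1 - q * b) = degree_one_coeffs b"
proof (rule qcoeff_eqI)
  fix q :: quat
  have "(\<lambda>n. q ^ n * degree_one_coeffs b n) sums (\<Sum>n\<in>{0, 1}. q ^ n * degree_one_coeffs b n)"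
    by (rule sums_finite) (auto simp: degree_one_coeffs_def)
  then show "(\<lambda>n. q ^ n * degree_one_coeffs b n) sums (1 - q * b)"
    by (simp add: degree_one_coeffs_def)
qed

lemma regular_conj_one_minus_mult: "regular_conj (\<lambda>p. 1 - p * b) = (\<lambda>q. 1 - q * qcnj b)"
proof
  fix q :: quat
  have "(\<Sum>n. q ^ n * qcnj (degree_one_coeffs b n)) = (\<Sum>n\<in>{0, 1}. q ^ n * qcnj (degree_one_coeffs b n))"
    by (rule suminf_finite) (auto simp: degree_one_coeffs_def quat_eq_iff)
  also have "\<dots> = 1 - q * qcnj b" by (simp add: degree_one_coeffs_def quat_eq_iff)
  finally show "regular_conj (\<lambda>p. 1 - p * b) q = 1 - q * qcnj b"
    by (simp add: regular_conj_def qcoeff_one_minus_mult)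
qed

lemma symmetrization_one_minus_mult:
  "symmetrization (\<lambda>p. 1 - p * b) q = 1 - q * (b + qcnj b) + q\<^sup>2 * (b * qcnj b)"
proof -
  let ?c = "\<lambda>n. \<Sum>k=0..n. degree_one_coeffs b k * degree_one_coeffs (qcnj b) (n - k)"
  have zero: "?c n = 0" if "n \<notin> {0, 1, 2}" for n
    using that by (intro sum.neutral) (auto simp: degree_one_coeffs_def)
  have "(\<Sum>n. q ^ n * ?c n) = (\<Sum>n\<in>{0, 1, 2}. q ^ n * ?c n)"
    by (rule suminf_finite) (use zero in auto)
  also have "\<dots> = 1 - q * (b + qcnj b) + q\<^sup>2 * (b * qcnj b)"
    by (simp add: degree_one_coeffs_def numeral_2_eq_2 algebra_simps)
  finally show ?thesis
    by (simp add: symmetrization_def star_prod_def regular_conj_one_minus_mult qcoeff_one_minus_mult)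
qed

text \<open>
  Both \<open>b + cnj b\<close> and \<open>b cnj b\<close> are real, so they commute with everything. Together with
  \<open>q E b = E - 1\<close> for the noncommutative geometric series \<open>E = \<Sum> q\<^sup>n b\<^sup>n\<close> this gives
  \<open>s E = 1 - q cnj b\<close> for the symmetrization \<open>s\<close>. A zero of \<open>s\<close> would therefore force
  \<open>q cnj b = 1\<close>, which the norms forbid.
\<close>
lemma regular_reciprocal_one_minus_mult:
  assumes "norm q \<le> 1" "norm b < 1"
  shows "regular_reciprocal (\<lambda>p. 1 - p * b) q = qseries (\<lambda>n. b ^ n) q"
proof -
  let ?E = "qseries (\<lambda>n. b ^ n) q"
  let ?s = "symmetrization (\<lambda>p. 1 - p * b) q"
  have b: "summable (\<lambda>n. norm (b ^ n))" using assms by (simp add: norm_power summable_geometric)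
  have sums: "(\<lambda>n. q ^ n * b ^ n) sums ?E" by (rule qseries_sums[OF b assms(1)])
  have step: "q * ?E * b = ?E - 1"
  proof -
    have "(\<lambda>n. q * (q ^ n * b ^ n) * b) sums (q * ?E * b)" by (intro sums_mult sums_mult2 sums)
    moreover have "q * (q ^ n * b ^ n) * b = q ^ Suc n * b ^ Suc n" for n
      by (simp add: mult.assoc power_commutes)
    ultimately have "(\<lambda>n. q ^ Suc n * b ^ Suc n) sums (q * ?E * b)" by simp
    from sums_Suc[OF this] have "(\<lambda>n. q ^ n * b ^ n) sums (q * ?E * b + 1)" by simp
    with sums have "?E = q * ?E * b + 1" by (rule sums_unique2)
    then show ?thesis by (metis add_diff_cancel_right')
  qed
  have sE: "?s * ?E = 1 - q * qcnj b"
  proof -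
    have re: "(b + qcnj b) * ?E = ?E * b + ?E * qcnj b"
      by (simp add: quat_eq_iff algebra_simps)
    have ab: "b * qcnj b * ?E = ?E * b * qcnj b"
    proof -
      have "b * qcnj b * ?E = ?E * (b * qcnj b)" unfolding mult_qcnj_self by (simp add: of_real_def)
      then show ?thesis by (simp add: mult.assoc)
    qed
    have "?s * ?E = ?E - q * ((b + qcnj b) * ?E) + q * (q * (b * qcnj b * ?E))"
      unfolding symmetrization_one_minus_mult
      by (simp only: distrib_right left_diff_distrib mult_1_left power2_eq_square mult.assoc)
    also have "\<dots> = ?E - (q * ?E * b + q * ?E * qcnj b) + q * (q * ?E * b) * qcnj b"
      unfolding re ab by (simp only: distrib_left mult.assoc)
    also have "\<dots> = 1 - q * qcnj b"
      unfolding step by (simp add: algebra_simps)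
    finally show ?thesis .
  qed
  have "?s \<noteq> 0"
  proof
    assume "?s = 0"
    with sE have "q * qcnj b = 1" by simp
    then have "norm q * norm b = 1" by (metis norm_mult norm_one norm_qcnj)
    moreover have "norm q * norm b \<le> norm b" using assms by (simp add: mult_left_le_one_le)
    ultimately show False using assms by simp
  qed
  then have "inverse ?s * (?s * ?E) = ?E" by (simp flip: mult.assoc)
  then show ?thesis
    by (simp add: regular_reciprocal_def regular_conj_one_minus_mult sE divide_inverse)
qed

lemma szego_kernel_eq:
  assumes "norm q \<le> 1" "norm b < 1"
  shows "szego_kernel b q = sqrt (1 - (norm b)\<^sup>2) *\<^sub>R qseries (\<lambda>n. qcnj b ^ n) q"
  using regular_reciprocal_one_minus_mult[of q "qcnj b"] assms by (simp add: szego_kernel_def)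

lemma radial_limit_szego_kernel:
  assumes q: "norm q = 1" and b: "norm b < 1"
  shows "radial_limit (szego_kernel b) q = sqrt (1 - (norm b)\<^sup>2) *\<^sub>R qseries (\<lambda>n. qcnj b ^ n) q"
  unfolding radial_limit_def
proof (rule tendsto_Lim)
  have s: "summable (\<lambda>n. norm (qcnj b ^ n))" using b by (simp add: norm_power summable_geometric)
  have "continuous_on {0..1} (\<lambda>r. qseries (\<lambda>n. qcnj b ^ n) (of_real r * q))"
    by (intro continuous_on_compose2[OF continuous_on_qseries[OF s]] continuous_intros)
       (use q in \<open>auto simp: norm_mult\<close>)
  from this[unfolded continuous_on_def, rule_format, of 1]
  have "((\<lambda>r. qseries (\<lambda>n. qcnj b ^ n) (of_real r * q)) \<longlongrightarrow> qseries (\<lambda>n. qcnj b ^ n) q) (at_left 1)"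
    using at_within_Icc_at_left[of 0 "1 :: real"] by simp
  then have "((\<lambda>r. sqrt (1 - (norm b)\<^sup>2) *\<^sub>R qseries (\<lambda>n. qcnj b ^ n) (of_real r * q)) \<longlongrightarrow>
      sqrt (1 - (norm b)\<^sup>2) *\<^sub>R qseries (\<lambda>n. qcnj b ^ n) q) (at_left 1)"
    by (intro tendsto_intros)
  moreover have "eventually (\<lambda>r. sqrt (1 - (norm b)\<^sup>2) *\<^sub>R qseries (\<lambda>n. qcnj b ^ n) (of_real r * q) =
      szego_kernel b (of_real r * q)) (at_left 1)"
    using eventually_at_left_real[OF zero_less_one]
    by eventually_elim (subst szego_kernel_eq, use q b in \<open>auto simp: norm_mult\<close>)
  ultimately show "((\<lambda>r. szego_kernel b (of_real r * q)) \<longlongrightarrow>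
      sqrt (1 - (norm b)\<^sup>2) *\<^sub>R qseries (\<lambda>n. qcnj b ^ n) q) (at_left 1)"
    by (rule Lim_transform_eventually)
qed simp

section \<open>Radial limits on the sphere\<close>

lemma continuous_on_qseries_ball:
  assumes c: "summable (\<lambda>n. (norm (c n))\<^sup>2)"
  shows "continuous_on (ball 0 1) (qseries c)"
proof -
  have "isCont (qseries c) q" if q: "q \<in> ball 0 1" for q
  proof -
    \<comment> \<open>Near a point of the open ball the series is a dilate of one that converges absolutely on the closed ball.\<close>
    define \<rho> where "\<rho> = (1 + norm q) / 2"
    have \<rho>: "0 < \<rho>" "\<rho> < 1" "norm q < \<rho>" using q by (auto simp: \<rho>_def add_pos_nonneg)
    have s: "summable (\<lambda>n. norm (of_real (\<rho> ^ n) * c n))" using \<rho> by (intro summable_dilate c) auto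
    have "continuous_on (ball 0 \<rho>) (\<lambda>q. qseries (\<lambda>n. of_real (\<rho> ^ n) * c n) (of_real (1 / \<rho>) * q))"
      by (intro continuous_on_compose2[OF continuous_on_qseries[OF s]] continuous_intros)
         (use \<rho> in \<open>auto simp: norm_mult divide_simps simp del: of_real_divide\<close>)
    moreover have "qseries (\<lambda>n. of_real (\<rho> ^ n) * c n) (of_real (1 / \<rho>) * q) = qseries c q" for q
    proof -
      have "qseries (\<lambda>n. of_real (\<rho> ^ n) * c n) (of_real (1 / \<rho>) * q) =
          qseries c (of_real \<rho> * (of_real (1 / \<rho>) * q))"
        by (rule qseries_dilate[symmetric])
      also have "of_real \<rho> * (of_real (1 / \<rho>) * q) = of_real (\<rho> * (1 / \<rho>)) * q"
        by (simp only: of_real_mult mult.assoc)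
      also have "\<rho> * (1 / \<rho>) = 1" using \<rho> by simp
      finally show ?thesis by simp
    qed
    ultimately have "continuous_on (ball 0 \<rho>) (qseries c)" by simp
    then show ?thesis using \<rho> by (simp add: continuous_on_eq_continuous_at)
  qed
  then show ?thesis by (simp add: continuous_on_eq_continuous_at)
qed

lemma continuous_le_if_rational_le:
  fixes g :: "real \<Rightarrow> real"
  assumes g: "continuous_on {a<..<b} g" and le: "\<And>r. r \<in> \<rat> \<Longrightarrow> r \<in> {a<..<b} \<Longrightarrow> g r \<le> e"
    and x: "x \<in> {a<..<b}"
  shows "g x \<le> e"
proof (rule ccontr)
  assume "\<not> g x \<le> e"
  then have gx: "e < g x" by simp
  have "isCont g x" using g x by (simp add: continuous_on_eq_continuous_at)
  then have "eventually (\<lambda>y. e < g y) (nhds x)"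
    using gx by (metis isCont_def order_tendstoD(1) tendsto_at_iff_tendsto_nhds)
  moreover have "eventually (\<lambda>y. y \<in> {a<..<b}) (nhds x)"
    using x by (intro eventually_nhds_in_open) auto
  ultimately have "eventually (\<lambda>y. e < g y \<and> y \<in> {a<..<b}) (nhds x)" by (rule eventually_conj)
  then obtain d where d: "0 < d" "\<And>y. dist y x < d \<Longrightarrow> e < g y \<and> y \<in> {a<..<b}"
    by (auto simp: eventually_nhds_metric)
  obtain r where r: "r \<in> \<rat>" "x < r" "r < x + d" using Rats_dense_in_real[of x "x + d"] d by auto
  then have "dist r x < d" by (simp add: dist_real_def)
  from d(2)[OF this] le[of r] r(1) show False by auto
qed

text \<open>
  For an integrand that is not measurable the Bochner integral is zero by convention, and the Borel
  algebra is not complete, so an almost everywhere argument would not be enough here. By continuity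
  in \<open>r\<close> the Cauchy criterion needs only rational radii, so the set of convergence is
  measurable. Off this set \<^const>\<open>Lim\<close> has a fixed value.
\<close>
lemma measurable_Lim_at_left_one:
  fixes \<Phi> :: "real \<Rightarrow> 'b \<Rightarrow> 'a :: {banach, second_countable_topology}"
  assumes S [measurable]: "Measurable.pred M S"
    and meas: "\<And>r. r \<in> {0<..<1} \<Longrightarrow> \<Phi> r \<in> borel_measurable M"
    and cont: "\<And>q. S q \<Longrightarrow> continuous_on {0<..<1} (\<lambda>r. \<Phi> r q)"
  shows "(\<lambda>q. if S q then Lim (at_left 1) (\<lambda>r. \<Phi> r q) else 0) \<in> borel_measurable M"
proof -
  define Q where "Q m = \<rat> \<inter> {1 - 1 / real (m + 2)<..<1}" for m
  define C where "C q \<longleftrightarrow> (\<forall>k. \<exists>m. \<forall>r\<in>Q m. \<forall>s\<in>Q m. dist (\<Phi> r q) (\<Phi> s q) \<le> 1 / real (Suc k))" for q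
  have Jsub: "{1 - 1 / real (m + 2)<..<1} \<subseteq> {0<..<1}" for m
  proof
    fix r assume "r \<in> {1 - 1 / real (m + 2)<..<1}"
    moreover have "0 \<le> 1 - 1 / real (m + 2)" by simp
    ultimately show "r \<in> {0<..<1}" unfolding greaterThanLessThan_iff by linarith
  qed
  then have Qsub: "Q m \<subseteq> {0<..<1}" for m unfolding Q_def by blast
  have Qc: "countable (Q m)" for m unfolding Q_def by (simp add: countable_rat)
  have dm: "Measurable.pred M (\<lambda>q. dist (\<Phi> r q) (\<Phi> s q) \<le> 1 / real (Suc k))" if "r \<in> Q m" "s \<in> Q m" for r s k m
  proof -
    have [measurable]: "\<Phi> r \<in> borel_measurable M" "\<Phi> s \<in> borel_measurable M"
      using Qsub meas that by blast+
    show ?thesis by measurable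
  qed
  have [measurable]: "Measurable.pred M C"
    unfolding C_def
    by (intro pred_intros_countable) (use dm Qc in \<open>auto simp: pred_def intro!: sets.sets_Collect_countable_All'\<close>)
  have C: "C q \<longleftrightarrow> (\<exists>l. ((\<lambda>r. \<Phi> r q) \<longlongrightarrow> l) (at_left 1))" if "S q" for q
  proof
    assume q: "C q"
    show "\<exists>l. ((\<lambda>r. \<Phi> r q) \<longlongrightarrow> l) (at_left 1)"
    proof (rule convergent_at_left_oneI)
      fix \<epsilon> :: real assume "0 < \<epsilon>"
      then obtain k where k: "1 / real (Suc k) < \<epsilon>" using reals_Archimedean[of \<epsilon>] by (auto simp: inverse_eq_divide)
      from q obtain m where m: "\<And>r s. r \<in> Q m \<Longrightarrow> s \<in> Q m \<Longrightarrow> dist (\<Phi> r q) (\<Phi> s q) \<le> 1 / real (Suc k)"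
        unfolding C_def by meson
      let ?J = "{1 - 1 / real (m + 2)<..<1}"
      have cJ: "continuous_on ?J (\<lambda>r. \<Phi> r q)" using cont[OF that] Jsub by (rule continuous_on_subset)
      have close: "dist (\<Phi> r q) (\<Phi> s q) \<le> 1 / real (Suc k)" if r: "r \<in> ?J" and s: "s \<in> ?J" for r s
      proof (rule continuous_le_if_rational_le[OF _ _ r])
        show "continuous_on ?J (\<lambda>r. dist (\<Phi> r q) (\<Phi> s q))" by (intro continuous_intros cJ)
        fix r' assume r': "r' \<in> \<rat>" "r' \<in> ?J"
        show "dist (\<Phi> r' q) (\<Phi> s q) \<le> 1 / real (Suc k)"
        proof (rule continuous_le_if_rational_le[OF _ _ s])
          show "continuous_on ?J (\<lambda>s. dist (\<Phi> r' q) (\<Phi> s q))" by (intro continuous_intros cJ)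
          show "dist (\<Phi> r' q) (\<Phi> s' q) \<le> 1 / real (Suc k)" if "s' \<in> \<rat>" "s' \<in> ?J" for s'
            using m r' that by (simp add: Q_def)
        qed
      qed
      show "\<exists>\<delta><1. \<forall>r\<in>{\<delta><..<1}. \<forall>s\<in>{\<delta><..<1}. dist (\<Phi> r q) (\<Phi> s q) < \<epsilon>"
      proof (intro exI conjI ballI)
        show "1 - 1 / real (m + 2) < 1" by simp
        show "dist (\<Phi> r q) (\<Phi> s q) < \<epsilon>" if "r \<in> ?J" "s \<in> ?J" for r s
          using close[OF that] k by (rule le_less_trans)
      qed
    qed
  next
    assume "\<exists>l. ((\<lambda>r. \<Phi> r q) \<longlongrightarrow> l) (at_left 1)"
    then obtain l where l: "((\<lambda>r. \<Phi> r q) \<longlongrightarrow> l) (at_left 1)" ..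
    show "C q" unfolding C_def
    proof
      fix k
      define d where "d = 1 / real (Suc k)"
      have "eventually (\<lambda>r. dist (\<Phi> r q) l < d / 2) (at_left 1)"
        by (rule tendstoD[OF l]) (simp add: d_def)
      then obtain b where b: "b < 1" "\<And>r. b < r \<Longrightarrow> r < 1 \<Longrightarrow> dist (\<Phi> r q) l < d / 2"
        by (auto simp: eventually_at_left[of 0 1])
      obtain m where m: "1 / real (Suc m) < 1 - b" using reals_Archimedean[of "1 - b"] b by (auto simp: inverse_eq_divide)
      have "1 / real (m + 2) \<le> 1 / real (Suc m)" by (intro divide_left_mono) auto
      with m have mb: "b < 1 - 1 / real (m + 2)" by linarith
      have near: "dist (\<Phi> r q) l < d / 2" if "r \<in> Q m" for r
      proof (rule b(2))
        have "1 - 1 / real (m + 2) < r" "r < 1"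
          using that unfolding Q_def Int_iff greaterThanLessThan_iff by blast+
        with mb show "b < r" "r < 1" by linarith+
      qed
      have "dist (\<Phi> r q) (\<Phi> s q) \<le> 1 / real (Suc k)" if "r \<in> Q m" "s \<in> Q m" for r s
        using near[OF that(1)] near[OF that(2)] dist_triangle2[of "\<Phi> r q" "\<Phi> s q" l]
        unfolding d_def[symmetric] by linarith
      then show "\<exists>m. \<forall>r\<in>Q m. \<forall>s\<in>Q m. dist (\<Phi> r q) (\<Phi> s q) \<le> 1 / real (Suc k)" by blast
    qed
  qed
  let ?u = radius_seq
  have u: "?u n \<in> {0<..<1}" for n using radius_seq_bounds[of n] by simp
  have [measurable]: "\<Phi> (?u n) \<in> borel_measurable M" for n by (rule meas[OF u])
  have "(\<lambda>q. if S q then (if C q then lim (\<lambda>n. \<Phi> (?u n) q) else (THE l. False)) else 0) \<in> borel_measurable M"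
    by measurable
  also have "(\<lambda>q. if S q then (if C q then lim (\<lambda>n. \<Phi> (?u n) q) else (THE l. False)) else 0) =
      (\<lambda>q. if S q then Lim (at_left 1) (\<lambda>r. \<Phi> r q) else 0)"
  proof
    fix q
    have "(if C q then lim (\<lambda>n. \<Phi> (?u n) q) else (THE l. False)) = Lim (at_left 1) (\<lambda>r. \<Phi> r q)"
      if q: "S q"
    proof (cases "C q")
      case True
      then obtain l where l: "((\<lambda>r. \<Phi> r q) \<longlongrightarrow> l) (at_left 1)" using C[OF q] by blast
      then have "(\<lambda>n. \<Phi> (?u n) q) \<longlonglongrightarrow> l" by (rule filterlim_compose[OF _ filterlim_radius_seq])
      then have "lim (\<lambda>n. \<Phi> (?u n) q) = l" by (rule limI)
      moreover have "Lim (at_left 1) (\<lambda>r. \<Phi> r q) = l" by (rule tendsto_Lim[OF _ l]) simp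
      ultimately show ?thesis using True by simp
    next
      case False
      then have "\<And>l. \<not> ((\<lambda>r. \<Phi> r q) \<longlongrightarrow> l) (at_left 1)" using C[OF q] by blast
      then show ?thesis using False by (simp add: Topological_Spaces.Lim_def)
    qed
    then show "(if S q then (if C q then lim (\<lambda>n. \<Phi> (?u n) q) else (THE l. False)) else 0) =
        (if S q then Lim (at_left 1) (\<lambda>r. \<Phi> r q) else 0)"
      by simp
  qed
  finally show ?thesis .
qed

text \<open>
  Null sets of angles correspond to null sets of slopes because \<open>t \<mapsto> cot t\<close> is differentiable.
\<close>
lemma AE_angle_of_slope:
  assumes "AE t in lborel. t \<in> {-pi..pi} \<longrightarrow> P t"
  shows "AE s in lborel. P (pi / 2 - arctan s) \<and> P (- (pi / 2 - arctan s))"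
proof -
  define N where "N = {t \<in> {-pi..pi}. \<not> P t}"
  from assms obtain N' where N': "{t \<in> space lborel. \<not> (t \<in> {-pi..pi} \<longrightarrow> P t)} \<subseteq> N'"
    "emeasure lborel N' = 0" "N' \<in> sets lborel" by (rule AE_E)
  then have "negligible N'"
    by (auto simp: negligible_iff_null_sets intro!: null_sets_completionI)
  then have N: "negligible N" by (rule negligible_subset) (use N'(1) in \<open>auto simp: N_def\<close>)
  let ?N1 = "N \<inter> {0<..<pi}" and ?N2 = "N \<inter> {-pi<..<0}"
  have neg: "negligible ((\<lambda>t. tan (pi / 2 - t)) ` ?N1 \<union> (\<lambda>t. tan (pi / 2 + t)) ` ?N2)"
  proof (intro negligible_Un negligible_differentiable_image_negligible)
    show "negligible ?N1" "negligible ?N2" using N by (auto intro: negligible_subset)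
    show "(\<lambda>t. tan (pi / 2 - t)) differentiable_on ?N1"
      unfolding differentiable_on_def
    proof
      fix t assume "t \<in> ?N1"
      then have "cos (pi / 2 - t) \<noteq> 0" by (simp add: cos_diff sin_gt_zero less_imp_neq[symmetric])
      then have "((\<lambda>t. tan (pi / 2 - t)) has_real_derivative (inverse ((cos (pi / 2 - t))\<^sup>2) * (- 1))) (at t)"
        by (auto intro!: derivative_eq_intros)
      then show "(\<lambda>t. tan (pi / 2 - t)) differentiable (at t within ?N1)"
        using real_differentiable_def differentiable_at_withinI by blast
    qed
    show "(\<lambda>t. tan (pi / 2 + t)) differentiable_on ?N2"
      unfolding differentiable_on_def
    proof
      fix t assume "t \<in> ?N2"
      then have "sin (- t) > 0" by (intro sin_gt_zero) auto
      then have "cos (pi / 2 + t) \<noteq> 0" by (simp add: cos_add)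
      then have "((\<lambda>t. tan (pi / 2 + t)) has_real_derivative (inverse ((cos (pi / 2 + t))\<^sup>2) * 1)) (at t)"
        by (auto intro!: derivative_eq_intros)
      then show "(\<lambda>t. tan (pi / 2 + t)) differentiable (at t within ?N2)"
        using real_differentiable_def differentiable_at_withinI by blast
    qed
  qed simp_all
  have "AE s in lebesgue. s \<notin> (\<lambda>t. tan (pi / 2 - t)) ` ?N1 \<union> (\<lambda>t. tan (pi / 2 + t)) ` ?N2"
    using neg by (intro AE_not_in) (simp add: negligible_iff_null_sets)
  then have "AE s in lborel. s \<notin> (\<lambda>t. tan (pi / 2 - t)) ` ?N1 \<union> (\<lambda>t. tan (pi / 2 + t)) ` ?N2"
    by (simp only: AE_completion_iff)
  then show ?thesis
  proof eventually_elim
    case (elim s)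
    let ?t = "pi / 2 - arctan s"
    have t: "0 < ?t" "?t < pi" using arctan_lbound[of s] arctan_ubound[of s] by auto
    have s: "tan (pi / 2 - ?t) = s" "tan (pi / 2 + - ?t) = s" by (simp_all add: tan_arctan)
    have "?t \<notin> N"
    proof
      assume "?t \<in> N"
      then have "?t \<in> ?N1" using t by simp
      from imageI[OF this, of "\<lambda>t. tan (pi / 2 - t)"] show False using elim unfolding s by blast
    qed
    moreover have "- ?t \<notin> N"
    proof
      assume "- ?t \<in> N"
      then have "- ?t \<in> ?N2" using t by simp
      from imageI[OF this, of "\<lambda>t. tan (pi / 2 + t)"] show False using elim unfolding s by blast
    qed
    ultimately show ?case using t by (auto simp: N_def)
  qed
qed

text \<open>
  The values of a slice function at \<open>x + y J\<close> are fixed linear combinations of those at the two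
  points \<open>x \<plusminus> y i\<close>. So the limit exists at \<open>cos t + J sin t\<close> for every \<open>J\<close> as soon as it exists on the
  slice of \<open>i\<close> at the angles \<open>t\<close> and \<open>-t\<close>, and the exceptional set depends on the slope alone.
\<close>
lemma AE_radial_limit_exists:
  assumes c: "summable (\<lambda>n. (norm (c n))\<^sup>2)"
  shows "AE q in slice_measure. norm q = 1 \<and>
    (\<exists>l. ((\<lambda>r. qseries c (of_real r * q)) \<longlongrightarrow> l) (at_left 1))"
proof -
  let ?L = "\<lambda>q. \<exists>l. ((\<lambda>r. qseries c (of_real r * q)) \<longlongrightarrow> l) (at_left 1)"
  let ?\<theta> = "\<lambda>q. pi / 2 - arctan (slope q)"
  have "AE q in slice_measure. ?L (slice_embed unit_i (cis (?\<theta> q))) \<and> ?L (slice_embed unit_i (cis (- ?\<theta> q)))"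
    by (rule AE_slice_measure_slope[OF AE_angle_of_slope[OF fatou_radial_limit[OF unit_i_imag c]]])
  with AE_slice_measure show ?thesis
  proof eventually_elim
    case (elim q)
    let ?p = "slice_embed unit_i (cis (?\<theta> q))" and ?m = "slice_embed unit_i (cis (- ?\<theta> q))"
    from elim obtain J where J: "J \<in> imag_units" and q: "q = slice_embed J (cis (?\<theta> q))"
      using unit_quat_polar by blast
    from elim obtain l l' where l: "((\<lambda>r. qseries c (of_real r * ?p)) \<longlongrightarrow> l) (at_left 1)"
      and l': "((\<lambda>r. qseries c (of_real r * ?m)) \<longlongrightarrow> l') (at_left 1)" by blast
    have "((\<lambda>r. 1 / 2 * (qseries c (of_real r * ?p) + qseries c (of_real r * ?m)) +
        J * unit_i / 2 * (qseries c (of_real r * ?m) - qseries c (of_real r * ?p))) \<longlongrightarrow>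
        1 / 2 * (l + l') + J * unit_i / 2 * (l' - l)) (at_left 1)"
      by (intro tendsto_intros l l')
    moreover have "eventually (\<lambda>r. 1 / 2 * (qseries c (of_real r * ?p) + qseries c (of_real r * ?m)) +
        J * unit_i / 2 * (qseries c (of_real r * ?m) - qseries c (of_real r * ?p)) =
        qseries c (of_real r * q)) (at_left 1)"
      using eventually_at_left_real[OF zero_less_one]
    proof eventually_elim
      case (elim r)
      let ?c = "\<lambda>n. of_real (r ^ n) * c n"
      have s: "summable (\<lambda>n. norm (?c n))" using elim by (intro summable_dilate c) auto
      have p: "(\<lambda>n. ?p ^ n * ?c n) sums qseries ?c ?p" and m: "(\<lambda>n. ?m ^ n * ?c n) sums qseries ?c ?m"
        by (rule qseries_sums[OF s], simp add: norm_slice_embed[OF unit_i_imag])+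
      have "(\<lambda>n. 1 / 2 * (?p ^ n * ?c n + ?m ^ n * ?c n) + J * unit_i / 2 * (?m ^ n * ?c n - ?p ^ n * ?c n)) sums
          (1 / 2 * (qseries ?c ?p + qseries ?c ?m) + J * unit_i / 2 * (qseries ?c ?m - qseries ?c ?p))"
        by (intro sums_add sums_diff sums_mult p m)
      moreover have "1 / 2 * (?p ^ n * ?c n + ?m ^ n * ?c n) + J * unit_i / 2 * (?m ^ n * ?c n - ?p ^ n * ?c n) =
          q ^ n * ?c n" for n
      proof -
        have "q ^ n = slice_embed J (cis (?\<theta> q) ^ n)"
          by (subst q) (simp add: slice_embed_power[OF J])
        also have "\<dots> = 1 / 2 * (?p ^ n + ?m ^ n) + J * unit_i / 2 * (?m ^ n - ?p ^ n)"
          unfolding slice_formula[OF J unit_i_imag]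
          by (simp add: slice_embed_power[OF unit_i_imag] cis_cnj)
        finally show ?thesis by (simp only: distrib_right left_diff_distrib mult.assoc)
      qed
      moreover have "(\<lambda>n. q ^ n * ?c n) sums qseries ?c q"
        by (rule qseries_sums[OF s]) (subst q, simp add: norm_slice_embed[OF J])
      ultimately have "1 / 2 * (qseries ?c ?p + qseries ?c ?m) + J * unit_i / 2 * (qseries ?c ?m - qseries ?c ?p) =
          qseries ?c q" by (simp add: sums_unique2)
      then show ?case unfolding qseries_dilate .
    qed
    ultimately have "((\<lambda>r. qseries c (of_real r * q)) \<longlongrightarrow> 1 / 2 * (l + l') + J * unit_i / 2 * (l' - l)) (at_left 1)"
      by (rule Lim_transform_eventually)
    with elim show ?case by blast
  qed
qed

section \<open>Pairing with the Szego kernel\<close>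

text \<open>
  For the dilates \<open>\<phi>\<^sub>k(q) = f(r\<^sub>k q)\<close> this is Parseval's identity. Their mean square distances are
  \<open>\<kappa> \<Sum> (r\<^sub>k\<^sup>n - r\<^sub>m\<^sup>n)\<^sup>2 |a\<^sub>n|\<^sup>2\<close>, which for \<open>m \<ge> k\<close> is at most the number \<open>D\<^sub>k\<close> obtained at \<open>r\<^sub>m = 1\<close>,
  and \<open>D\<^sub>k\<close> tends to \<open>0\<close>. Fatou's lemma carries the bound over to the almost everywhere limit \<open>F\<close> of
  the dilates. As the kernel is bounded on the sphere, the integrals converge.
\<close>
proposition hardy_inner_szego_kernel:
  assumes a: "summable (\<lambda>n. (norm (a n))\<^sup>2)" and f: "\<And>q. q \<in> unit_ball \<Longrightarrow> (\<lambda>n. q ^ n * a n) sums f q"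
    and b: "b \<in> unit_ball"
  shows "hardy_inner f (szego_kernel b) =
    (measure slice_measure (space slice_measure) / (4 * pi\<^sup>2) * sqrt (1 - (norm b)\<^sup>2)) *\<^sub>R f b"
proof -
  interpret orthogonal_powers slice_measure by (rule orthogonal_powers_slice_measure)
  let ?\<mu> = "slice_measure"
  define \<kappa> where "\<kappa> = measure ?\<mu> (space ?\<mu>)"
  have \<kappa>0: "0 \<le> \<kappa>" by (simp add: \<kappa>_def)
  define e where "e = qseries (\<lambda>n. qcnj b ^ n)"
  define B where "B = (\<Sum>n. norm (qcnj b ^ n))"
  have bn: "norm b < 1" using b by simp
  have es: "summable (\<lambda>n. norm (qcnj b ^ n))" using bn by (simp add: norm_power summable_geometric)
  have eB: "norm (e q) \<le> B" if "norm q = 1" for q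
    unfolding e_def B_def by (rule norm_qseries_le[OF es]) (use that in simp)
  have B0: "0 \<le> B" unfolding B_def by (intro suminf_nonneg es) simp
  have [measurable]: "e \<in> borel_measurable borel" by (simp add: e_def)
  have fq: "f q = qseries a q" if "q \<in> unit_ball" for q
    using f[OF that] by (simp add: qseries_def sums_iff)
  define F where "F q = (if norm q = 1 then radial_limit f q else 0)" for q
  have F_Lim: "F q = (if norm q = 1 then Lim (at_left 1) (\<lambda>r. qseries (\<lambda>n. of_real (r ^ n) * a n) q) else 0)" for q
  proof -
    have "Lim (at_left 1) (\<lambda>r. f (of_real r * q)) = Lim (at_left 1) (\<lambda>r. qseries (\<lambda>n. of_real (r ^ n) * a n) q)"
      if q: "norm q = 1"
    proof -
      have ev: "eventually (\<lambda>r. f (of_real r * q) = qseries (\<lambda>n. of_real (r ^ n) * a n) q) (at_left 1)"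
        using eventually_at_left_real[OF zero_less_one]
        by eventually_elim (subst fq, use q in \<open>auto simp: norm_mult qseries_dilate\<close>)
      show ?thesis unfolding Topological_Spaces.Lim_def
        by (intro arg_cong[where f = The] ext filterlim_cong refl ev)
    qed
    then show ?thesis by (simp add: F_def radial_limit_def)
  qed
  have [measurable]: "F \<in> borel_measurable borel"
    unfolding F_Lim[abs_def]
  proof (rule measurable_Lim_at_left_one)
    show "continuous_on {0<..<1} (\<lambda>r. qseries (\<lambda>n. of_real (r ^ n) * a n) q)" if "norm q = 1" for q
      unfolding qseries_dilate[symmetric]
      by (intro continuous_on_compose2[OF continuous_on_qseries_ball[OF a]] continuous_intros)
         (use that in \<open>auto simp: norm_mult\<close>)
  qed measurable
  \<comment> \<open>Replacing the radial limit by a function that vanishes off the sphere makes the integrand Borel measurable everywhere.\<close>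
  have reduce: "hardy_inner f (szego_kernel b) =
      (sqrt (1 - (norm b)\<^sup>2) / (4 * pi\<^sup>2)) *\<^sub>R (\<integral>q. qcnj (e q) * F q \<partial>?\<mu>)"
  proof -
    let ?t = "sqrt (1 - (norm b)\<^sup>2)"
    have "(LINT q:sphere 0 1|sphere_measure.
        (1 / (norm (qIm q))\<^sup>2) *\<^sub>R (qcnj (radial_limit (szego_kernel b) q) * radial_limit f q)) =
        (\<integral>q. slice_weight q *\<^sub>R (?t *\<^sub>R (qcnj (e q) * F q)) \<partial>sphere_measure)"
      unfolding set_lebesgue_integral_def
    proof (rule Bochner_Integration.integral_cong[OF refl])
      fix q
      show "indicator (sphere 0 1) q *\<^sub>R ((1 / (norm (qIm q))\<^sup>2) *\<^sub>R
            (qcnj (radial_limit (szego_kernel b) q) * radial_limit f q)) =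
          slice_weight q *\<^sub>R (?t *\<^sub>R (qcnj (e q) * F q))"
      proof (cases "norm q = 1")
        case True
        have "qcnj (t *\<^sub>R p) = t *\<^sub>R qcnj p" for t p by (simp add: quat_eq_iff)
        then show ?thesis
          using True by (simp add: radial_limit_szego_kernel[OF True bn] slice_weight_def F_def e_def)
      qed (simp add: slice_weight_def)
    qed
    also have "\<dots> = (\<integral>q. ?t *\<^sub>R (qcnj (e q) * F q) \<partial>?\<mu>)"
      unfolding slice_measure_def by (rule integral_density[symmetric]) auto
    finally show ?thesis by (simp add: hardy_inner_def)
  qed
  define r where "r = radius_seq"
  note r = radius_seq_bounds[folded r_def] and r_mono = radius_seq_mono[folded r_def]
    and r_lim = radius_seq_LIMSEQ[folded r_def] and r_left = filterlim_radius_seq[folded r_def]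
  define \<phi> where "\<phi> k = qseries (\<lambda>n. of_real (r k ^ n) * a n)" for k
  have s: "summable (\<lambda>n. norm (of_real (r k ^ n) * a n))" for k
    using r[of k] by (intro summable_dilate a) auto
  have [measurable]: "\<phi> k \<in> borel_measurable borel" for k by (simp add: \<phi>_def)
  have \<phi>_bound: "norm (\<phi> k q) \<le> (\<Sum>n. norm (of_real (r k ^ n) * a n))" if "norm q = 1" for k q
    unfolding \<phi>_def by (rule norm_qseries_le[OF s]) (use that in simp)
  have AE_lim: "AE q in ?\<mu>. (\<lambda>k. \<phi> k q) \<longlonglongrightarrow> F q"
    using AE_radial_limit_exists[OF a]
  proof eventually_elim
    case (elim q)
    then obtain l where "((\<lambda>r. qseries a (of_real r * q)) \<longlongrightarrow> l) (at_left 1)" by blast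
    then have l: "((\<lambda>r. qseries (\<lambda>n. of_real (r ^ n) * a n) q) \<longlongrightarrow> l) (at_left 1)"
      unfolding qseries_dilate .
    then have "F q = l" unfolding F_Lim using elim by (simp add: tendsto_Lim)
    moreover have "(\<lambda>k. \<phi> k q) \<longlonglongrightarrow> l" unfolding \<phi>_def by (rule filterlim_compose[OF l r_left])
    ultimately show ?case by simp
  qed
  define D where "D k = \<kappa> * (\<Sum>n. ((1 - r k ^ n) * norm (a n))\<^sup>2)" for k
  have le_sq: "((1 - r k ^ n) * norm (a n))\<^sup>2 \<le> (norm (a n))\<^sup>2" for k n
  proof (rule power_mono)
    have "0 \<le> r k ^ n" "r k ^ n \<le> 1" using r[of k] by (simp_all add: power_le_one)
    then show "(1 - r k ^ n) * norm (a n) \<le> norm (a n)" "0 \<le> (1 - r k ^ n) * norm (a n)"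
      by (simp_all add: mult_left_le_one_le)
  qed
  have D_sum: "summable (\<lambda>n. ((1 - r k ^ n) * norm (a n))\<^sup>2)" for k
    by (rule summable_comparison_test'[OF a, of 0]) (use le_sq in simp)
  have D0: "0 \<le> D k" for k unfolding D_def using \<kappa>0 by (intro mult_nonneg_nonneg suminf_nonneg D_sum) auto
  have D_lim: "D \<longlonglongrightarrow> 0"
  proof -
    have "(\<lambda>k. \<Sum>n. ((1 - r k ^ n) * norm (a n))\<^sup>2) \<longlonglongrightarrow> (\<Sum>n. 0)"
    proof (rule tannerys_theorem[THEN conjunct2, THEN conjunct2])
      show "(\<lambda>k. ((1 - r k ^ n) * norm (a n))\<^sup>2) \<longlonglongrightarrow> 0" for n
        by (rule tendsto_eq_intros r_lim refl | simp)+
      show "eventually (\<lambda>(n, k). norm (((1 - r k ^ n) * norm (a n))\<^sup>2) \<le> (norm (a n))\<^sup>2)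
          (at_top \<times>\<^sub>F sequentially)"
        using le_sq by (intro always_eventually) auto
    qed (use a in auto)
    from tendsto_mult_left[OF this, of \<kappa>] show ?thesis by (simp add: D_def[abs_def])
  qed
  have diff_le: "(\<integral>\<^sup>+q. ennreal ((norm (\<phi> k q - \<phi> m q))\<^sup>2) \<partial>?\<mu>) \<le> ennreal (D k)" if "k \<le> m" for k m
  proof -
    let ?c = "\<lambda>n. of_real (r k ^ n) * a n - of_real (r m ^ n) * a n"
    have cs: "summable (\<lambda>n. norm (?c n))"
      by (rule summable_comparison_test'[OF summable_add[OF s[of k] s[of m]], of 0])
         (simp only: real_norm_def abs_norm_cancel norm_triangle_ineq4)
    have eq: "\<phi> k q - \<phi> m q = qseries ?c q" if "norm q = 1" for q
    proof -
      have "(\<lambda>n. q ^ n * ?c n) sums (\<phi> k q - \<phi> m q)"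
        unfolding right_diff_distrib \<phi>_def by (intro sums_diff qseries_sums s) (use that in auto)
      then show ?thesis by (simp add: qseries_def sums_iff)
    qed
    have "(\<integral>\<^sup>+q. ennreal ((norm (\<phi> k q - \<phi> m q))\<^sup>2) \<partial>?\<mu>) = (\<integral>\<^sup>+q. ennreal ((norm (qseries ?c q))\<^sup>2) \<partial>?\<mu>)"
      by (rule nn_integral_cong_AE) (use AE_norm_one eq in \<open>auto elim!: eventually_mono\<close>)
    also have "\<dots> = ennreal (\<integral>q. (norm (qseries ?c q))\<^sup>2 \<partial>?\<mu>)"
      by (intro nn_integral_eq_integral integrable_bounded_unit[of _ "(\<Sum>n. norm (?c n))\<^sup>2"])
         (use norm_qseries_le[OF cs] in \<open>auto intro!: power_mono\<close>)
    also have "\<dots> = ennreal (\<kappa> * (\<Sum>n. (norm (?c n))\<^sup>2))"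
      unfolding parseval_norm(1)[OF cs] \<kappa>_def ..
    also have "\<dots> \<le> ennreal (D k)"
      unfolding D_def
    proof (intro ennreal_leI mult_left_mono suminf_le D_sum parseval_norm(2)[OF cs] \<kappa>0)
      fix n
      have "norm (?c n) = \<bar>r k ^ n - r m ^ n\<bar> * norm (a n)"
        by (simp only: norm_mult norm_of_real flip: left_diff_distrib of_real_diff)
      also have "\<dots> \<le> (1 - r k ^ n) * norm (a n)"
      proof (rule mult_right_mono)
        have "r k ^ n \<le> r m ^ n" "r m ^ n \<le> 1"
          using r[of k] r[of m] r_mono[OF that] by (auto intro!: power_mono power_le_one)
        then show "\<bar>r k ^ n - r m ^ n\<bar> \<le> 1 - r k ^ n" by simp
      qed simp
      finally show "(norm (?c n))\<^sup>2 \<le> ((1 - r k ^ n) * norm (a n))\<^sup>2" by (rule power_mono) simp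
    qed
    finally show ?thesis .
  qed
  \<comment> \<open>Fatou: let \<open>m\<close> tend to infinity in the previous bound.\<close>
  have nn_le: "(\<integral>\<^sup>+q. ennreal ((norm (\<phi> k q - F q))\<^sup>2) \<partial>?\<mu>) \<le> ennreal (D k)" for k
  proof -
    have "(\<integral>\<^sup>+q. ennreal ((norm (\<phi> k q - F q))\<^sup>2) \<partial>?\<mu>) =
        (\<integral>\<^sup>+q. liminf (\<lambda>m. ennreal ((norm (\<phi> k q - \<phi> m q))\<^sup>2)) \<partial>?\<mu>)"
    proof (rule nn_integral_cong_AE)
      show "AE q in ?\<mu>. ennreal ((norm (\<phi> k q - F q))\<^sup>2) = liminf (\<lambda>m. ennreal ((norm (\<phi> k q - \<phi> m q))\<^sup>2))"
        using AE_lim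
      proof eventually_elim
        case (elim q)
        then have "(\<lambda>m. ennreal ((norm (\<phi> k q - \<phi> m q))\<^sup>2)) \<longlonglongrightarrow> ennreal ((norm (\<phi> k q - F q))\<^sup>2)"
          by (intro tendsto_intros tendsto_ennrealI)
        then show ?case by (intro lim_imp_Liminf[symmetric]) simp_all
      qed
    qed
    also have "\<dots> \<le> liminf (\<lambda>m. \<integral>\<^sup>+q. ennreal ((norm (\<phi> k q - \<phi> m q))\<^sup>2) \<partial>?\<mu>)"
      by (rule nn_integral_liminf) measurable
    also have "\<dots> \<le> ennreal (D k)"
    proof -
      have "eventually (\<lambda>m. (\<integral>\<^sup>+q. ennreal ((norm (\<phi> k q - \<phi> m q))\<^sup>2) \<partial>?\<mu>) \<le> ennreal (D k)) sequentially"
        using diff_le by (auto simp: eventually_sequentially)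
      then have "liminf (\<lambda>m. \<integral>\<^sup>+q. ennreal ((norm (\<phi> k q - \<phi> m q))\<^sup>2) \<partial>?\<mu>) \<le> liminf (\<lambda>m. ennreal (D k))"
        by (rule Liminf_mono)
      then show ?thesis by (simp add: Liminf_const)
    qed
    finally show ?thesis .
  qed
  have sq_int: "integrable ?\<mu> (\<lambda>q. (norm (\<phi> k q - F q))\<^sup>2)" for k
    by (rule integrableI_bounded) (use le_less_trans[OF nn_le ennreal_less_top] in auto)
  have sq_le: "(\<integral>q. (norm (\<phi> k q - F q))\<^sup>2 \<partial>?\<mu>) \<le> D k" for k
    using nn_le[of k] D0[of k] nn_integral_eq_integral[OF sq_int, of k] by simp
  have diff_int: "integrable ?\<mu> (\<lambda>q. norm (\<phi> k q - F q))" for k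
  proof (rule Bochner_Integration.integrable_bound)
    show "integrable ?\<mu> (\<lambda>q. (norm (\<phi> k q - F q))\<^sup>2 / (2 * 1) + 1 / 2)"
      using sq_int by simp
    show "AE q in ?\<mu>. norm (norm (\<phi> k q - F q)) \<le> norm ((norm (\<phi> k q - F q))\<^sup>2 / (2 * 1) + 1 / 2)"
      using le_half_square_add[of 1] by (intro AE_I2) simp
  qed measurable
  \<comment> \<open>From mean square to mean, on a space of mass \<open>\<kappa>\<close>.\<close>
  have L1_lim: "(\<lambda>k. \<integral>q. norm (\<phi> k q - F q) \<partial>?\<mu>) \<longlonglongrightarrow> 0"
  proof (rule LIMSEQ_I)
    fix \<epsilon> :: real assume \<epsilon>: "0 < \<epsilon>"
    define t where "t = \<epsilon> / (\<kappa> + 1)"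
    have t: "0 < t" using \<epsilon> \<kappa>0 by (simp add: t_def)
    have "eventually (\<lambda>k. D k < t\<^sup>2) sequentially"
      by (rule order_tendstoD[OF D_lim]) (use t in simp)
    then obtain K where K: "\<And>k. K \<le> k \<Longrightarrow> D k < t\<^sup>2" by (auto simp: eventually_sequentially)
    have "norm ((\<integral>q. norm (\<phi> k q - F q) \<partial>?\<mu>) - 0) < \<epsilon>" if "K \<le> k" for k
    proof -
      have "(\<integral>q. norm (\<phi> k q - F q) \<partial>?\<mu>) \<le> (\<integral>q. (norm (\<phi> k q - F q))\<^sup>2 / (2 * t) + t / 2 \<partial>?\<mu>)"
        using sq_int diff_int le_half_square_add[OF t] by (intro integral_mono) auto
      also have "\<dots> = (\<integral>q. (norm (\<phi> k q - F q))\<^sup>2 \<partial>?\<mu>) / (2 * t) + \<kappa> * (t / 2)"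
        using sq_int by (subst Bochner_Integration.integral_add) (auto simp: \<kappa>_def)
      also have "\<dots> \<le> t\<^sup>2 / (2 * t) + \<kappa> * (t / 2)"
        using order_trans[OF sq_le less_imp_le[OF K[OF that]]] t by (intro add_right_mono divide_right_mono) auto
      also have "\<dots> = (\<kappa> + 1) * t / 2" using t by (simp add: field_simps power2_eq_square)
      also have "\<dots> = \<epsilon> / 2" using \<kappa>0 by (simp add: t_def)
      finally show ?thesis using \<epsilon> by simp
    qed
    then show "\<exists>K. \<forall>k\<ge>K. norm ((\<integral>q. norm (\<phi> k q - F q) \<partial>?\<mu>) - 0) < \<epsilon>" by blast
  qed
  have \<phi>_int: "integrable ?\<mu> (\<lambda>q. qcnj (e q) * \<phi> k q)" for k
    using eB \<phi>_bound[of _ k] B0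
    by (intro integrable_bounded_unit[of _ "B * (\<Sum>n. norm (of_real (r k ^ n) * a n))"])
       (auto simp: norm_mult intro!: mult_mono)
  have e_diff_le: "AE q in ?\<mu>. norm (qcnj (e q) * (\<phi> k q - F q)) \<le> B * norm (\<phi> k q - F q)" for k
    using AE_norm_one by eventually_elim (use eB in \<open>simp add: norm_mult mult_right_mono\<close>)
  have e_diff_int: "integrable ?\<mu> (\<lambda>q. qcnj (e q) * (\<phi> k q - F q))" for k
  proof (rule Bochner_Integration.integrable_bound)
    show "integrable ?\<mu> (\<lambda>q. B * norm (\<phi> k q - F q))" using diff_int by simp
    show "AE q in ?\<mu>. norm (qcnj (e q) * (\<phi> k q - F q)) \<le> norm (B * norm (\<phi> k q - F q))"
      using e_diff_le[of k] B0 by (auto elim!: eventually_mono simp: abs_mult)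
  qed measurable
  have eF: "(\<integral>q. qcnj (e q) * F q \<partial>?\<mu>) =
      (\<integral>q. qcnj (e q) * \<phi> k q \<partial>?\<mu>) - (\<integral>q. qcnj (e q) * (\<phi> k q - F q) \<partial>?\<mu>)" for k
    using Bochner_Integration.integral_diff[OF \<phi>_int e_diff_int, of k k]
    by (simp add: right_diff_distrib)
  have \<phi>_val: "(\<integral>q. qcnj (e q) * \<phi> k q \<partial>?\<mu>) = \<kappa> *\<^sub>R qseries a (of_real (r k) * b)" for k
    unfolding e_def \<phi>_def parseval[OF s es] \<kappa>_def qseries_dilate
    by (simp add: qseries_def qcnj_power)
  have "(\<lambda>k. \<integral>q. qcnj (e q) * (\<phi> k q - F q) \<partial>?\<mu>) \<longlonglongrightarrow> 0"
  proof (rule Lim_null_comparison)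
    show "(\<lambda>k. B * (\<integral>q. norm (\<phi> k q - F q) \<partial>?\<mu>)) \<longlonglongrightarrow> 0"
      using tendsto_mult_left[OF L1_lim, of B] by simp
    show "eventually (\<lambda>k. norm (\<integral>q. qcnj (e q) * (\<phi> k q - F q) \<partial>?\<mu>) \<le> B * (\<integral>q. norm (\<phi> k q - F q) \<partial>?\<mu>)) sequentially"
    proof (rule always_eventually, rule allI)
      fix k
      have "norm (\<integral>q. qcnj (e q) * (\<phi> k q - F q) \<partial>?\<mu>) \<le> (\<integral>q. norm (qcnj (e q) * (\<phi> k q - F q)) \<partial>?\<mu>)"
        by (rule integral_norm_bound)
      also have "\<dots> \<le> (\<integral>q. B * norm (\<phi> k q - F q) \<partial>?\<mu>)"
        using e_diff_int diff_int e_diff_le by (intro integral_mono_AE) auto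
      finally show "norm (\<integral>q. qcnj (e q) * (\<phi> k q - F q) \<partial>?\<mu>) \<le> B * (\<integral>q. norm (\<phi> k q - F q) \<partial>?\<mu>)" by simp
    qed
  qed
  moreover have "(\<lambda>k. \<integral>q. qcnj (e q) * \<phi> k q \<partial>?\<mu>) \<longlonglongrightarrow> \<kappa> *\<^sub>R qseries a b"
  proof -
    have cont: "isCont (qseries a) b"
      using continuous_on_qseries_ball[OF a] b by (simp add: continuous_on_eq_continuous_at)
    have "(\<lambda>k. of_real (r k) * b) \<longlonglongrightarrow> of_real 1 * b" by (intro tendsto_intros r_lim)
    then have "(\<lambda>k. of_real (r k) * b) \<longlonglongrightarrow> b" by simp
    with cont have "(\<lambda>k. qseries a (of_real (r k) * b)) \<longlonglongrightarrow> qseries a b"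
      by (rule isCont_tendsto_compose)
    then show ?thesis unfolding \<phi>_val by (intro tendsto_intros)
  qed
  ultimately have "(\<lambda>k. (\<integral>q. qcnj (e q) * \<phi> k q \<partial>?\<mu>) - (\<integral>q. qcnj (e q) * (\<phi> k q - F q) \<partial>?\<mu>)) \<longlonglongrightarrow>
      \<kappa> *\<^sub>R qseries a b - 0"
    by (intro tendsto_diff)
  then have "(\<lambda>k :: nat. \<integral>q. qcnj (e q) * F q \<partial>?\<mu>) \<longlonglongrightarrow> \<kappa> *\<^sub>R qseries a b"
    by (simp flip: eF)
  then have "(\<integral>q. qcnj (e q) * F q \<partial>?\<mu>) = \<kappa> *\<^sub>R qseries a b"
    by (rule LIMSEQ_unique[OF tendsto_const])
  then show ?thesis
    unfolding reduce using fq[OF b] by (simp add: \<kappa>_def mult.commute)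
qed

section \<open>Existence of the maximum\<close>

text \<open>
  Cauchy-Schwarz against the geometric series with sum \<open>1 / (1 - |b|\<^sup>2)\<close>, again as a termwise
  arithmetic-geometric mean inequality with weights that make both halves at most \<open>\<eta> / 2\<close>.
\<close>
lemma weighted_tail_le:
  assumes a: "summable (\<lambda>n. (norm (a n))\<^sup>2)" and \<eta>: "0 < \<eta>" "(\<Sum>n. (norm (a n))\<^sup>2) \<le> \<eta>\<^sup>2" and b: "norm b < 1"
  shows "summable (\<lambda>n. norm b ^ n * norm (a n))"
    and "sqrt (1 - (norm b)\<^sup>2) * (\<Sum>n. norm b ^ n * norm (a n)) \<le> \<eta>"
proof -
  define t where "t = sqrt (1 - (norm b)\<^sup>2)"
  have b2: "(norm b)\<^sup>2 < 1" using b by (simp add: abs_square_less_1)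
  have t: "0 < t" "t\<^sup>2 = 1 - (norm b)\<^sup>2" using b2 by (simp_all add: t_def)
  let ?m = "\<lambda>n. (\<eta> * t / 2) * ((norm b)\<^sup>2) ^ n + (1 / (2 * \<eta> * t)) * (norm (a n))\<^sup>2"
  have gs: "summable (\<lambda>n. ((norm b)\<^sup>2) ^ n)" using b2 by (intro summable_geometric) simp
  have ms: "summable ?m" by (intro summable_add summable_mult gs a)
  have le: "norm b ^ n * norm (a n) \<le> ?m n" for n
  proof -
    have "0 \<le> (\<eta> * t * norm b ^ n - norm (a n))\<^sup>2" by simp
    then have "2 * (\<eta> * t) * (norm b ^ n * norm (a n)) \<le> (\<eta> * t)\<^sup>2 * (norm b ^ n)\<^sup>2 + (norm (a n))\<^sup>2"
      by (simp add: power2_eq_square algebra_simps)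
    moreover have "(norm b ^ n)\<^sup>2 = ((norm b)\<^sup>2) ^ n" by (simp flip: power_mult add: mult.commute)
    ultimately have "norm b ^ n * norm (a n) \<le> ((\<eta> * t)\<^sup>2 * ((norm b)\<^sup>2) ^ n + (norm (a n))\<^sup>2) / (2 * (\<eta> * t))"
      using \<eta> t by (simp add: pos_le_divide_eq mult_ac)
    also have "\<dots> = ?m n" using \<eta> t by (simp add: field_simps power2_eq_square)
    finally show ?thesis .
  qed
  show sum: "summable (\<lambda>n. norm b ^ n * norm (a n))"
    by (rule summable_comparison_test'[OF ms, of 0]) (use le in simp)
  have "(\<Sum>n. norm b ^ n * norm (a n)) \<le> (\<Sum>n. ?m n)" by (intro suminf_le le sum ms)
  also have "(\<Sum>n. ?m n) = (\<eta> * t / 2) * (1 / t\<^sup>2) + (1 / (2 * \<eta> * t)) * (\<Sum>n. (norm (a n))\<^sup>2)"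
    unfolding t(2)
    by (intro sums_unique[symmetric] sums_add sums_mult geometric_sums summable_sums a) (use b2 in simp)
  also have "(\<eta> * t / 2) * (1 / t\<^sup>2) + (1 / (2 * \<eta> * t)) * (\<Sum>n. (norm (a n))\<^sup>2) \<le>
      (\<eta> * t / 2) * (1 / t\<^sup>2) + (1 / (2 * \<eta> * t)) * \<eta>\<^sup>2"
    using \<eta> t by (intro add_left_mono mult_left_mono) auto
  also have "\<dots> = \<eta> / t" using \<eta> t(1) by (simp add: field_simps power2_eq_square)
  finally show "sqrt (1 - (norm b)\<^sup>2) * (\<Sum>n. norm b ^ n * norm (a n)) \<le> \<eta>"
    using t(1) unfolding t_def[symmetric] by (simp add: field_simps)
qed

lemma weighted_qseries_vanishes_at_boundary:
  assumes a: "summable (\<lambda>n. (norm (a n))\<^sup>2)" and \<epsilon>: "0 < \<epsilon>"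
  shows "\<exists>R<1. \<forall>b. R < norm b \<and> norm b < 1 \<longrightarrow> sqrt (1 - (norm b)\<^sup>2) * norm (qseries a b) < \<epsilon>"
proof -
  define \<eta> where "\<eta> = \<epsilon> / 2"
  have \<eta>: "0 < \<eta>" using \<epsilon> by (simp add: \<eta>_def)
  have "(\<lambda>N. \<Sum>n. (norm (a (n + N)))\<^sup>2) \<longlonglongrightarrow> 0" by (rule suminf_exist_split2[OF a])
  then have "eventually (\<lambda>N. (\<Sum>n. (norm (a (n + N)))\<^sup>2) < \<eta>\<^sup>2) sequentially"
    by (rule order_tendstoD) (use \<eta> in simp)
  then obtain N where "(\<Sum>n. (norm (a (n + N)))\<^sup>2) < \<eta>\<^sup>2" by (auto simp: eventually_sequentially)
  then have N: "(\<Sum>n. (norm (a (n + N)))\<^sup>2) \<le> \<eta>\<^sup>2" by simp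
  have aN: "summable (\<lambda>n. (norm (a (n + N)))\<^sup>2)" by (rule summable_ignore_initial_segment[OF a])
  define M where "M = (\<Sum>n<N. norm (a n))"
  have M: "0 \<le> M" unfolding M_def by (intro sum_nonneg) simp
  \<comment> \<open>Once the weight is below \<open>\<tau>\<close>, the polynomial part contributes less than \<open>\<eta>\<close>.\<close>
  define \<tau> where "\<tau> = \<eta> / (M + 1)"
  have \<tau>: "0 < \<tau>" "\<tau> * M < \<eta>" using \<eta> M by (auto simp: \<tau>_def field_simps)
  define R where "R = sqrt (max 0 (1 - \<tau>\<^sup>2))"
  have "R < 1" unfolding R_def using \<tau> by simp
  moreover have "sqrt (1 - (norm b)\<^sup>2) * norm (qseries a b) < \<epsilon>" if b: "R < norm b" "norm b < 1" for b
  proof -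
    let ?t = "sqrt (1 - (norm b)\<^sup>2)"
    have "1 - \<tau>\<^sup>2 < (norm b)\<^sup>2"
    proof -
      have "R\<^sup>2 < (norm b)\<^sup>2" using b(1) by (intro power_strict_mono) (auto simp: R_def)
      then show ?thesis by (simp add: R_def)
    qed
    then have "?t < sqrt (\<tau>\<^sup>2)" by (intro real_sqrt_less_mono) simp
    then have t\<tau>: "?t < \<tau>" using \<tau> by simp
    have t0: "0 \<le> ?t" using b by (simp add: abs_square_le_1)
    note tail = weighted_tail_le[OF aN \<eta> N b(2)]
    have ns: "summable (\<lambda>n. norm (b ^ n * a n))"
    proof (rule summable_iff_shift[THEN iffD1, of _ N], rule summable_comparison_test'[OF tail(1), of 0])
      show "norm (norm (b ^ (n + N) * a (n + N))) \<le> norm b ^ n * norm (a (n + N))" for n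
        using b by (simp add: norm_mult norm_power power_decreasing mult_right_mono)
    qed
    have "norm (qseries a b) \<le> (\<Sum>n. norm (b ^ n * a n))"
      unfolding qseries_def by (rule summable_norm[OF ns])
    also have "\<dots> = (\<Sum>n. norm (b ^ (n + N) * a (n + N))) + (\<Sum>n<N. norm (b ^ n * a n))"
      by (rule suminf_split_initial_segment[OF ns])
    also have "\<dots> \<le> (\<Sum>n. norm b ^ n * norm (a (n + N))) + M"
      unfolding M_def
    proof (intro add_mono suminf_le sum_mono tail(1) summable_ignore_initial_segment[OF ns])
      show "norm (b ^ (n + N) * a (n + N)) \<le> norm b ^ n * norm (a (n + N))" for n
        using b by (simp add: norm_mult norm_power power_decreasing mult_right_mono)
      show "norm (b ^ n * a n) \<le> norm (a n)" for n
        using b by (intro norm_qseries_term_le) simp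
    qed
    finally have "?t * norm (qseries a b) \<le> ?t * ((\<Sum>n. norm b ^ n * norm (a (n + N))) + M)"
      using t0 by (rule mult_left_mono)
    also have "\<dots> = ?t * (\<Sum>n. norm b ^ n * norm (a (n + N))) + ?t * M" by (rule distrib_left)
    also have "\<dots> \<le> \<eta> + \<tau> * M" using tail(2) t\<tau> M by (intro add_mono mult_right_mono) auto
    also have "\<dots> < \<epsilon>" using \<tau>(2) by (simp add: \<eta>_def)
    finally show ?thesis .
  qed
  ultimately show ?thesis by blast
qed

text \<open>
  If \<open>g\<close> is positive somewhere, the values near the boundary are too small to compete and
  compactness of a smaller closed ball suffices; otherwise \<open>g\<close> vanishes identically.
\<close>
lemma attains_max_on_ball_if_vanishes_at_boundary:
  fixes g :: "'a :: euclidean_space \<Rightarrow> real"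
  assumes g: "continuous_on (ball 0 1) g" and nonneg: "\<And>b. b \<in> ball 0 1 \<Longrightarrow> 0 \<le> g b"
    and decay: "\<And>\<epsilon>. 0 < \<epsilon> \<Longrightarrow> \<exists>R<1. \<forall>b. R < norm b \<and> norm b < 1 \<longrightarrow> g b < \<epsilon>"
  shows "\<exists>a\<in>ball 0 1. \<forall>b\<in>ball 0 1. g b \<le> g a"
proof (cases "\<exists>b\<^sub>0\<in>ball 0 1. 0 < g b\<^sub>0")
  case True
  then obtain b\<^sub>0 where b0: "b\<^sub>0 \<in> ball 0 1" "0 < g b\<^sub>0" by blast
  from decay[OF b0(2)] obtain R where R: "R < 1" "\<And>b. R < norm b \<Longrightarrow> norm b < 1 \<Longrightarrow> g b < g b\<^sub>0" by blast
  have inR: "norm b\<^sub>0 \<le> R" using R(2)[of b\<^sub>0] b0 by force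
  have R0: "0 \<le> R" using norm_ge_zero inR by (rule order_trans)
  have "cball 0 R \<subseteq> (ball 0 1 :: 'a set)" using R(1) by auto
  then have "continuous_on (cball 0 R) g" by (rule continuous_on_subset[OF g])
  moreover have "(cball 0 R :: 'a set) \<noteq> {}" using R0 by simp
  ultimately obtain a where a: "a \<in> cball 0 R" "\<And>b. b \<in> cball 0 R \<Longrightarrow> g b \<le> g a"
    using continuous_attains_sup[of "cball 0 R" g] by auto
  have "g b \<le> g a" if "b \<in> ball 0 1" for b
  proof (cases "norm b \<le> R")
    case False
    then have "g b < g b\<^sub>0" using that by (intro R(2)) auto
    also have "g b\<^sub>0 \<le> g a" using inR by (intro a(2)) simp
    finally show ?thesis by simp
  qed (use a in simp)
  moreover have "a \<in> ball 0 1" using a(1) R(1) by simp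
  ultimately show ?thesis by blast
next
  case False
  have "\<forall>b\<in>ball 0 1. g b \<le> g 0"
  proof
    fix b :: 'a assume "b \<in> ball 0 1"
    then have "g b \<le> 0" using False by force
    also have "0 \<le> g 0" by (rule nonneg) simp
    finally show "g b \<le> g 0" .
  qed
  then show ?thesis by (intro bexI[of _ 0]) simp_all
qed

theorem theorem4p1:
  fixes f :: "quat \<Rightarrow> quat"
  assumes "f \<in> slice_hardy"
  shows "\<exists>a\<in>unit_ball. \<forall>b\<in>unit_ball.
    norm (hardy_inner f (szego_kernel b)) \<le> norm (hardy_inner f (szego_kernel a))"
proof -
  obtain c where c: "summable (\<lambda>n. (norm (c n))\<^sup>2)"
    and f: "\<And>q. q \<in> unit_ball \<Longrightarrow> (\<lambda>n. q ^ n * c n) sums f q"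
    using slice_hardy_power_series[OF assms] by blast
  define K where "K = measure slice_measure (space slice_measure) / (4 * pi\<^sup>2)"
  have K: "0 \<le> K" by (simp add: K_def)
  let ?g = "\<lambda>b. sqrt (1 - (norm b)\<^sup>2) * norm (qseries c b)"
  have norm_eq: "norm (hardy_inner f (szego_kernel b)) = K * ?g b" if b: "b \<in> unit_ball" for b
  proof -
    have "f b = qseries c b" using f[OF b] by (simp add: qseries_def sums_iff)
    then show ?thesis
      using hardy_inner_szego_kernel[OF c f b] K b by (simp add: K_def abs_mult abs_square_le_1)
  qed
  have "\<exists>a\<in>ball 0 1. \<forall>b\<in>ball 0 1. ?g b \<le> ?g a"
  proof (rule attains_max_on_ball_if_vanishes_at_boundary)
    show "continuous_on (ball 0 1) ?g"
      by (intro continuous_intros continuous_on_qseries_ball c)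
    show "0 \<le> ?g b" if "b \<in> ball 0 1" for b
      using that by (simp add: abs_square_le_1)
  qed (rule weighted_qseries_vanishes_at_boundary[OF c])
  then obtain a where a: "a \<in> unit_ball" "\<And>b. b \<in> unit_ball \<Longrightarrow> ?g b \<le> ?g a" by blast
  have "norm (hardy_inner f (szego_kernel b)) \<le> norm (hardy_inner f (szego_kernel a))"
    if b: "b \<in> unit_ball" for b
    unfolding norm_eq[OF b] norm_eq[OF a(1)] using a(2)[OF b] K by (rule mult_left_mono)
  with a(1) show ?thesis by blast
qed

end
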